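(* Let $p_1(\cdot),p_2(\cdot)\in\mathcal{P}(\mathbb{R}^n)$ both satisfy the log-Hölder conditions $$|p_i(x)-p_i(y)|\le\frac{C}{-\log|x-y|}\quad (x,y\in\mathbb{R}^n,\ |x-y|\le 1/2),\qquad |p_i(x)-p_i(y)|\le\frac{C}{\log(|x|+e)}\quad (x,y\in\mathbb{R}^n,\ |y|\ge|x|),$$ for some constant $C>0$, $i=1,2$. Let $0<\gamma<n/p_1^+$, $1\le q,\alpha\le\infty$, and suppose $p_1(x)<\alpha<q<\infty$ and $p_2(x)<\beta<q<\infty$ for all $x$. Assume that $\frac{n}{p_1(x)}-\frac{n}{p_2(x)}=\gamma$ for all $x\in\mathbb{R}^n$. Then the fractional integral operator $I_\gamma$ is bounded from $(L^{p_1(\cdot)},L^{q})^{\alpha}(\mathbb{R}^n)$ to $(L^{p_2(\cdot)},L^{q})^{\beta}(\mathbb{R}^n)$ if and only if $$\gamma=\frac{n}{\alpha}-\frac{n}{\beta}.$$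
   Context: $\mathcal{P}(\mathbb{R}^n)$ is the set of measurable $p(\cdot):\mathbb{R}^n\to[1,\infty)$ with $p_-=\operatorname{ess\,inf}p>1$ and $p^+=\operatorname{ess\,sup}p<\infty$. For such $p(\cdot)$, $L^{p(\cdot)}(\mathbb{R}^n)$ is the space of measurable $f$ with finite Luxemburg norm $\|f\|_{L^{p(\cdot)}}=\inf\{\lambda>0:\int_{\mathbb{R}^n}(|f(x)|/\lambda)^{p(x)}dx\le1\}$, and $L^{p(\cdot)}_{loc}$ consists of $f$ with $f\chi_F\in L^{p(\cdot)}$ for all compact $F$. For $1\le q,\alpha\le\infty$, the variable Fofana space $(L^{p(\cdot)},L^q)^\alpha(\mathbb{R}^n)$ is the set of $f\in L^{p(\cdot)}_{loc}(\mathbb{R}^n)$ with $$\|f\|_{(L^{p(\cdot)},L^q)^\alpha}=\sup_{r>0}\Big\|\,|B(\cdot,r)|^{\frac1\alpha-\frac1{p(\cdot)}-\frac1q}\,\|f\chi_{B(\cdot,r)}\|_{L^{p(\cdot)}}\Big\|_{L^q(\mathbb{R}^n)}<\infty,$$ i.e. the $L^q$ norm in $x$ of $x\mapsto |B(x,r)|^{1/\alpha-1/p(x)-1/q}\|f\chi_{B(x,r)}\|_{L^{p(\cdot)}}$, where $B(x,r)$ is the open Euclidean ball and $|B(x,r)|$ its Lebesgue measure. The fractional integral operator is $I_\gamma f(x)=\int_{\mathbb{R}^n}\frac{f(y)}{|x-y|^{n-\gamma}}dy$, $0<\gamma<n$. *)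

theory Defs
  imports "HOL-Analysis.Analysis" "HOL-Probability.Essential_Supremum"
begin

definition p_plus :: "('a::euclidean_space \<Rightarrow> real) \<Rightarrow> ereal" where
  "p_plus p = esssup lebesgue (\<lambda>x. ereal (p x))"

definition p_minus :: "('a::euclidean_space \<Rightarrow> real) \<Rightarrow> ereal" where
  "p_minus p = - esssup lebesgue (\<lambda>x. - ereal (p x))"

definition var_exp :: "('a::euclidean_space \<Rightarrow> real) \<Rightarrow> bool" where
  "var_exp p \<longleftrightarrow> p \<in> borel_measurable lebesgue \<and> (\<forall>x. 1 \<le> p x)
     \<and> p_minus p > 1 \<and> p_plus p < \<infinity>"

definition log_hoelder :: "real \<Rightarrow> ('a::euclidean_space \<Rightarrow> real) \<Rightarrow> bool" where
  "log_hoelder C p \<longleftrightarrow>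
     (\<forall>x y. x \<noteq> y \<and> norm (x - y) \<le> 1/2 \<longrightarrow> \<bar>p x - p y\<bar> \<le> C / (- ln (norm (x - y))))
   \<and> (\<forall>x y. norm x \<le> norm y \<longrightarrow> \<bar>p x - p y\<bar> \<le> C / ln (norm x + exp 1))"

text \<open>Real powers on [0,inf] (used with positive exponents only).\<close>
definition enn_powr :: "ennreal \<Rightarrow> real \<Rightarrow> ennreal" where
  "enn_powr t s = (if t = top then top else ennreal (enn2real t powr s))"

text \<open>Luxemburg norm of L^{p(.)}; value \<infinity> when no admissible lambda exists.\<close>
definition var_norm :: "('a::euclidean_space \<Rightarrow> real) \<Rightarrow> ('a \<Rightarrow> real) \<Rightarrow> ennreal" where
  "var_norm p f = (INF lam\<in>{lam::real. lam > 0 \<and>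
      (\<integral>\<^sup>+ x. ennreal ((\<bar>f x\<bar> / lam) powr p x) \<partial>lebesgue) \<le> 1}. ennreal lam)"

definition in_var_Lp :: "('a::euclidean_space \<Rightarrow> real) \<Rightarrow> ('a \<Rightarrow> real) \<Rightarrow> bool" where
  "in_var_Lp p f \<longleftrightarrow> f \<in> borel_measurable lebesgue \<and> var_norm p f < top"

definition in_var_Lp_loc :: "('a::euclidean_space \<Rightarrow> real) \<Rightarrow> ('a \<Rightarrow> real) \<Rightarrow> bool" where
  "in_var_Lp_loc p f \<longleftrightarrow> f \<in> borel_measurable lebesgue \<and>
     (\<forall>F. compact F \<longrightarrow> in_var_Lp p (\<lambda>x. f x * indicator F x))"

definition Lq_norm :: "real \<Rightarrow> ('a::euclidean_space \<Rightarrow> ennreal) \<Rightarrow> ennreal" where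
  "Lq_norm q g = enn_powr (\<integral>\<^sup>+ x. enn_powr (g x) q \<partial>lebesgue) (1 / q)"

definition fofana_norm :: "('a::euclidean_space \<Rightarrow> real) \<Rightarrow> real \<Rightarrow> real \<Rightarrow> ('a \<Rightarrow> real) \<Rightarrow> ennreal" where
  "fofana_norm p q \<alpha> f = (SUP r\<in>{0<..}. Lq_norm q (\<lambda>x.
      ennreal (measure lebesgue (ball x r) powr (1/\<alpha> - 1/p x - 1/q))
      * var_norm p (\<lambda>y. f y * indicator (ball x r) y)))"

definition fofana_space :: "('a::euclidean_space \<Rightarrow> real) \<Rightarrow> real \<Rightarrow> real \<Rightarrow> ('a \<Rightarrow> real) set" where
  "fofana_space p q \<alpha> = {f. in_var_Lp_loc p f \<and> fofana_norm p q \<alpha> f < top}"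

definition frac_int :: "real \<Rightarrow> ('a::euclidean_space \<Rightarrow> real) \<Rightarrow> 'a \<Rightarrow> real" where
  "frac_int \<gamma> f x = (\<integral> y. f y / norm (x - y) powr (real DIM('a) - \<gamma>) \<partial>lebesgue)"

definition fofana_bounded ::
  "(('a::euclidean_space \<Rightarrow> real) \<Rightarrow> ('a \<Rightarrow> real)) \<Rightarrow> ('a \<Rightarrow> real) \<Rightarrow> real \<Rightarrow> real
     \<Rightarrow> ('a \<Rightarrow> real) \<Rightarrow> real \<Rightarrow> bool" where
  "fofana_bounded T p1 \<alpha> q p2 \<beta> \<longleftrightarrow> (\<exists>C::real. C \<ge> 0 \<and>
     (\<forall>f \<in> fofana_space p1 q \<alpha>. T f \<in> fofana_space p2 q \<beta> \<and>
        fofana_norm p2 q \<beta> (T f) \<le> ennreal C * fofana_norm p1 q \<alpha> f))"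

end

theory Submission
  imports Defs
begin

text \<open>
  Hardy-Littlewood maximal estimates and Hedberg's inequality give the Sobolev inequality
  \<open>I_\<gamma> : L^{p1(.)} \<rightarrow> L^{p2(.)}\<close>: a function is split into its parts above and below height 1, the local
  log-Hoelder condition handles the former and the decay condition at infinity the latter.

  Sufficiency: over \<open>B(x,r)\<close> the potential of \<open>f\<close> is the potential of \<open>f\<close> restricted to \<open>B(x,2r)\<close> plus a
  dyadic sum of averages over \<open>B(x,2^j r)\<close>. After Hoelder's inequality the \<open>j\<close>-th term is the Fofana
  quantity of \<open>f\<close> at scale \<open>2^j r\<close> times a geometric factor with exponent \<open>n (1/\<beta> - 1/q) > 0\<close>; this is
  where \<open>\<gamma> = n/\<alpha> - n/\<beta>\<close> enters, making the weights of both spaces equal. For balls that are large compared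
  with the distance of their centre to the origin the factor is geometric only on average over the centres.

  Necessity: the indicator of a ball of radius \<open>\<rho>\<close> has norm at most \<open>C \<rho>^{n/\<alpha>}\<close>, while the norm of its
  potential is at least \<open>c \<rho>^{\<gamma> + n/\<beta>}\<close>. Small balls around the origin and large balls far away from it
  show that the two powers agree.
\<close>

section \<open>Real powers of extended nonnegative reals\<close>

text \<open>Exponents are compared through their reciprocals: conjugation and the relation between
  \<open>p1\<close> and \<open>p2\<close> are both affine in \<open>1 / p\<close>, so one
  oscillation constant serves all of them. All norm estimates are run on modulars of normalised
  functions; since the exponents exceed 1, dividing by a large constant turns any bounded modular
  into one that is at most 1. The obstacle is that the Fofana weight always uses the exponent at the
  centre of the ball, while the norm of the indicator of a ball that is large compared with its
  distance to the origin follows the limit exponent. For a fixed centre the two may differ by a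
  power of the radius that no constant absorbs, so the sum over scales cannot be estimated centre by
  centre. The remedy: over all centres in \<open>ball 0 (2 * R)\<close> the local norms at radius
  \<open>R\<close> are bounded by a single local norm around the origin, which in turn is bounded by
  the local norm at radius \<open>5 * R\<close> around any of these centres. Only integrals of
  weights over the centres remain to be compared, and the mismatch then occurs on both
  sides.\<close>

lemma enn_powr_top [simp]: "enn_powr top s = top"
  by (simp add: enn_powr_def)

lemma enn_powr_0 [simp]: "enn_powr 0 s = 0"
  by (simp add: enn_powr_def)

lemma enn_powr_ennreal: "0 \<le> x \<Longrightarrow> enn_powr (ennreal x) s = ennreal (x powr s)"
  by (simp add: enn_powr_def)

lemma enn_powr_1 [simp]: "enn_powr t 1 = t"
  by (cases t) (auto simp: enn_powr_ennreal)

lemma enn_powr_eq_top_iff [simp]: "enn_powr t s = top \<longleftrightarrow> t = top"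
  by (simp add: enn_powr_def)

lemma enn_powr_mono:
  assumes "t \<le> t'" "0 \<le> s" shows "enn_powr t s \<le> enn_powr t' s"
  using assms
  by (cases t; cases t') (auto simp: enn_powr_ennreal ennreal_le_iff top_unique intro!: ennreal_leI powr_mono2)

lemma enn_powr_mult:
  assumes "0 < s" shows "enn_powr (a * b) s = enn_powr a s * enn_powr b s"
  by (cases a; cases b)
     (use assms in \<open>auto simp: enn_powr_ennreal ennreal_mult_top ennreal_top_mult powr_mult
        simp flip: ennreal_mult'\<close>)

lemma enn_powr_powr: "enn_powr (enn_powr a s) t = enn_powr a (s * t)"
  by (cases a) (auto simp: enn_powr_ennreal powr_powr)

lemma enn_powr_inverse: "s \<noteq> 0 \<Longrightarrow> enn_powr (enn_powr a s) (1 / s) = a"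
  by (simp add: enn_powr_powr)

lemma enn_powr_le_iff:
  assumes "0 < s" shows "enn_powr a s \<le> enn_powr b s \<longleftrightarrow> a \<le> b"
  using enn_powr_mono[of a b s] enn_powr_mono[of "enn_powr a s" "enn_powr b s" "1/s"] assms
  by (auto simp: enn_powr_inverse)

lemma enn_powr_add_le:
  assumes "0 \<le> s"
  shows "enn_powr (a + b) s \<le> ennreal (2 powr s) * (enn_powr a s + enn_powr b s)"
proof (cases "a = top \<or> b = top")
  case False
  then obtain x y where xy: "a = ennreal x" "b = ennreal y" "0 \<le> x" "0 \<le> y"
    by (metis ennreal_cases)
  have "(x + y) powr s \<le> (2 * max x y) powr s"
    using xy assms by (intro powr_mono2) auto
  also have "\<dots> = 2 powr s * max x y powr s"
    using xy by (subst powr_mult) auto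
  also have "\<dots> \<le> 2 powr s * (x powr s + y powr s)"
    by (intro mult_left_mono) (auto simp: max_def)
  finally show ?thesis
    using xy by (simp add: enn_powr_ennreal flip: ennreal_plus ennreal_mult')
qed (auto simp: ennreal_mult_top)

lemma borel_measurable_enn_powr [measurable]:
  assumes [measurable]: "f \<in> borel_measurable M" "p \<in> borel_measurable M"
  shows "(\<lambda>x. enn_powr (f x) (p x)) \<in> borel_measurable M"
  unfolding enn_powr_def by measurable

section \<open>Balls in Lebesgue measure\<close>

abbreviation vol1 :: "'a::euclidean_space itself \<Rightarrow> real" where
  "vol1 _ \<equiv> unit_ball_vol (real DIM('a))"

lemma emeasure_lebesgue_ball:
  assumes "0 \<le> r"
  shows "emeasure lebesgue (ball (c::'a::euclidean_space) r)
    = ennreal (vol1 TYPE('a) * r powr real DIM('a))"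
proof (cases "r = 0")
  case False
  then show ?thesis
    using assms emeasure_ball[of r c] by (simp add: powr_realpow)
qed auto

lemma measure_lebesgue_ball:
  assumes "0 \<le> r"
  shows "measure lebesgue (ball (c::'a::euclidean_space) r) = vol1 TYPE('a) * r powr real DIM('a)"
  using emeasure_lebesgue_ball[OF assms, of c] by (simp add: measure_def)

lemma borel_id_lebesgue [measurable]: "(\<lambda>x. x) \<in> lebesgue \<rightarrow>\<^sub>M (borel :: 'a::euclidean_space measure)"
  by (intro measurable_completion) simp

lemma borel_indicator_ball [measurable]:
  "(\<lambda>x. indicator (ball (c::'a::euclidean_space) r) x :: 'b::{zero_neq_one,topological_space})
    \<in> borel_measurable lebesgue"
  by (intro borel_measurable_indicator') simp

lemma nn_integral_indicator_ball:
  assumes "0 \<le> r"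
  shows "(\<integral>\<^sup>+ x. indicator (ball (c::'a::euclidean_space) r) x \<partial>lebesgue)
    = ennreal (vol1 TYPE('a) * r powr real DIM('a))"
  using emeasure_lebesgue_ball[OF assms, of c] by simp

lemma sigma_finite_lebesgue: "sigma_finite_measure (lebesgue :: 'a::euclidean_space measure)"
proof
  show "\<exists>A. countable A \<and> A \<subseteq> sets lebesgue \<and> \<Union>A = space (lebesgue :: 'a measure)
    \<and> (\<forall>a\<in>A. emeasure lebesgue a \<noteq> \<infinity>)"
  proof (intro exI conjI)
    show "\<Union>(range (\<lambda>n::nat. ball (0::'a) (real n))) = space lebesgue"
      using reals_Archimedean2 by (auto simp: dist_norm)
  qed (auto simp: emeasure_lebesgue_ball simp del: emeasure_completion)
qed

section \<open>Dyadic decomposition of the Riesz kernel\<close>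

lemma dyadic_shell:
  fixes t d :: real
  assumes "0 < d" "d \<le> t"
  obtains j :: nat where "2^j * d \<le> t" "t < 2^(j+1) * d"
proof -
  have "\<exists>j::nat. t < 2^j * d"
    using real_arch_pow[of 2 "t/d"] assms by (auto simp: field_simps)
  then have 1: "t < 2^(LEAST j. t < 2^j * d) * d" (is "t < 2^?k * d")
    by (rule LeastI_ex)
  with assms have "?k \<noteq> 0" by (metis mult_1 not_less power_0)
  then obtain i where i: "?k = Suc i" by (metis not0_implies_Suc)
  then have "\<not> t < 2^i * d" by (metis lessI not_less_Least)
  with 1 i show ?thesis by (intro that[of i]) auto
qed

lemma dyadic_shell_down:
  fixes t d :: real
  assumes "0 < t" "t < d"
  obtains j :: nat where "d / 2^(j+1) \<le> t" "t < d / 2^j"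
proof -
  obtain j :: nat where "2^j * t \<le> d" "d < 2^(j+1) * t"
    using dyadic_shell[of t d] assms by auto
  show ?thesis
  \<comment> \<open>\<open>dyadic_shell\<close> closes its intervals at the other end, so the
    boundary case moves to the preceding index; \<open>j = 0\<close> would mean
    \<open>t = d\<close>.\<close>
  proof (cases "2^j * t = d")
    case False
    then show ?thesis
      using \<open>2^j * t \<le> d\<close> \<open>d < 2^(j+1) * t\<close> by (intro that[of j]) (auto simp: field_simps)
  next
    case True
    show ?thesis
    proof (cases j)
      case 0
      then show ?thesis using True assms by simp
    next
      case (Suc i)
      then show ?thesis using True assms by (intro that[of i]) (auto simp: field_simps)
    qed
  qed
qed

lemma suminf_ge_term_ennreal: "(f j :: ennreal) \<le> (\<Sum>i. f i)"
  by (metis sum_le_suminf[OF summableI, of "{j}" f] finite.emptyI finite_insert sum.empty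
      sum.insert add.right_neutral empty_iff zero_le)

text \<open>The term of the one shell containing \<open>z\<close> already dominates. Full balls in
  place of shells cost nothing in an upper bound and turn integrals against the kernel into averages
  over balls.\<close>

lemma kernel_far_le:
  fixes z :: "'a::euclidean_space"
  assumes "0 < d" "d \<le> norm z" "0 \<le> s"
  shows "ennreal (norm z powr - s) \<le>
    (\<Sum>j. ennreal ((2^j * d) powr - s) * indicator (ball 0 (2^(j+1) * d)) z)"
proof -
  obtain j :: nat where j: "2^j * d \<le> norm z" "norm z < 2^(j+1) * d"
    using dyadic_shell assms by blast
  have "ennreal (norm z powr - s) \<le> ennreal ((2^j * d) powr - s) * indicator (ball 0 (2^(j+1) * d)) z"
    using j assms by (auto intro!: ennreal_leI powr_mono2')
  also have "\<dots> \<le> (\<Sum>j. ennreal ((2^j * d) powr - s) * indicator (ball 0 (2^(j+1) * d)) z)"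
    by (rule suminf_ge_term_ennreal)
  finally show ?thesis .
qed

lemma kernel_near_le:
  fixes z :: "'a::euclidean_space"
  assumes "z \<noteq> 0" "norm z < d" "0 \<le> s"
  shows "ennreal (norm z powr - s) \<le>
    (\<Sum>j. ennreal ((d / 2^(j+1)) powr - s) * indicator (ball 0 (d / 2^j)) z)"
proof -
  obtain j :: nat where j: "d / 2^(j+1) \<le> norm z" "norm z < d / 2^j"
    using dyadic_shell_down[of "norm z" d] assms by auto
  have "0 < d" using assms(2) norm_ge_zero[of z] by linarith
  have "ennreal (norm z powr - s) \<le> ennreal ((d / 2^(j+1)) powr - s) * indicator (ball 0 (d / 2^j)) z"
    using j assms \<open>0 < d\<close> by (auto intro!: ennreal_leI powr_mono2' simp del: power_Suc)
  also have "\<dots> \<le> (\<Sum>j. ennreal ((d / 2^(j+1)) powr - s) * indicator (ball 0 (d / 2^j)) z)"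
    by (rule suminf_ge_term_ennreal)
  finally show ?thesis .
qed

lemma suminf_geometric_powr:
  assumes "0 < e"
  shows "(\<Sum>j. ennreal ((2^j) powr - e)) = ennreal (1 / (1 - 2 powr - e))"
proof -
  have "(2^j) powr - e = (2 powr - e)^j" for j :: nat
    by (simp add: powr_powr powr_realpow[symmetric] mult.commute)
  moreover have "2 powr - e < 1"
    using powr_less_mono[of "-e" 0 2] assms by simp
  ultimately show ?thesis
    by (simp add: suminf_ennreal2 suminf_geometric)
qed

text \<open>The \<open>j\<close>-th dyadic ball has volume of order \<open>2^(j * n)\<close> against
  a factor \<open>2^(- j * n * a)\<close>, so \<open>a > 1\<close> gives a geometric series. This
  integral controls the error term of every change between an exponent and its limit at
  infinity.\<close>

lemma nn_integral_norm_decay_finite: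
  assumes "1 < a"
  shows "(\<integral>\<^sup>+ (x::'a::euclidean_space). ennreal ((exp 1 + norm x) powr - (real DIM('a) * a)) \<partial>lebesgue) < top"
proof -
  let ?n = "real DIM('a)" and ?V = "vol1 TYPE('a)"
  have n0: "?n > 0" by simp
  have V: "?V > 0" by simp
  let ?f = "\<lambda>(j::nat) x::'a. ennreal ((2^j) powr - (?n * a)) * indicator (ball 0 (2^(j+1))) x"
  have le: "ennreal ((exp 1 + norm x) powr - (?n * a)) \<le> indicator (ball 0 1) x + (\<Sum>j. ?f j x)" for x :: 'a
  proof (cases "norm x < 1")
    case True
    have "(exp 1 + norm x) powr - (?n * a) \<le> 1 powr - (?n * a)"
      using assms n0 by (intro powr_mono2') (auto simp: add_increasing2)
    with True show ?thesis by (auto intro!: add_increasing2)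
  next
    case False
    have "(exp 1 + norm x) powr - (?n * a) \<le> norm x powr - (?n * a)"
      using assms n0 False by (intro powr_mono2') auto
    then have "ennreal ((exp 1 + norm x) powr - (?n * a)) \<le> ennreal (norm x powr - (?n * a))"
      by (rule ennreal_leI)
    also have "\<dots> \<le> (\<Sum>j. ?f j x)"
      using kernel_far_le[of 1 x "?n * a"] False assms n0 by simp
    finally show ?thesis by (simp add: add_increasing)
  qed
  have "(\<integral>\<^sup>+ (x::'a). ennreal ((exp 1 + norm x) powr - (?n * a)) \<partial>lebesgue)
     \<le> (\<integral>\<^sup>+ x. indicator (ball 0 1) x + (\<Sum>j. ?f j x) \<partial>lebesgue)"
    by (intro nn_integral_mono le)
  also have "\<dots> = ennreal ?V + (\<Sum>j. \<integral>\<^sup>+ x. ?f j x \<partial>lebesgue)"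
    by (subst nn_integral_add)
       (simp_all add: nn_integral_suminf nn_integral_indicator_ball del: nn_integral_indicator)
  also have "(\<lambda>j. \<integral>\<^sup>+ x. ?f j x \<partial>lebesgue) = (\<lambda>j. ennreal (?V * 2 powr ?n) * ennreal ((2^j) powr - (?n * a - ?n)))"
  proof
    fix j :: nat
    have "(\<integral>\<^sup>+ x. ?f j x \<partial>lebesgue) = ennreal ((2^j) powr - (?n * a)) * ennreal (?V * (2^(j+1)) powr ?n)"
      by (subst nn_integral_cmult) (simp_all add: nn_integral_indicator_ball del: power_Suc nn_integral_indicator)
    also have "\<dots> = ennreal (?V * 2 powr ?n) * ennreal ((2^j) powr - (?n * a - ?n))"
    proof -
      have "(2^j) powr - (?n * a) * (?V * (2^(j+1)) powr ?n) = (?V * 2 powr ?n) * ((2^j) powr - (?n * a) * (2^j) powr ?n)"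
        by (simp add: powr_mult)
      also have "(2^j) powr - (?n * a) * (2^j) powr ?n = (2^j :: real) powr - (?n * a - ?n)"
        by (simp add: powr_add[symmetric])
      finally show ?thesis using V by (simp add: ennreal_mult'[symmetric])
    qed
    finally show "(\<integral>\<^sup>+ x. ?f j x \<partial>lebesgue) = ennreal (?V * 2 powr ?n) * ennreal ((2^j) powr - (?n * a - ?n))" .
  qed
  also have "(\<Sum>j. ennreal (?V * 2 powr ?n) * ennreal ((2^j) powr - (?n * a - ?n)))
    = ennreal (?V * 2 powr ?n) * ennreal (1 / (1 - 2 powr - (?n * a - ?n)))"
    using assms by (subst ennreal_suminf_cmult, subst suminf_geometric_powr) auto
  also have "ennreal ?V + \<dots> < top"
    by (auto intro!: ennreal_mult_less_top[THEN iffD2])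
  finally show ?thesis .
qed

section \<open>The Hardy--Littlewood maximal function\<close>

definition ball_int :: "('a::euclidean_space \<Rightarrow> ennreal) \<Rightarrow> 'a \<Rightarrow> real \<Rightarrow> ennreal" where
  "ball_int g x R = (\<integral>\<^sup>+ y. g y * indicator (ball x R) y \<partial>lebesgue)"

definition maximal :: "('a::euclidean_space \<Rightarrow> ennreal) \<Rightarrow> 'a \<Rightarrow> ennreal" where
  "maximal g x = (SUP R\<in>{0<..}. ball_int g x R / ennreal (vol1 TYPE('a) * R powr real DIM('a)))"

lemma vol1_pos [simp]: "0 < vol1 TYPE('a::euclidean_space)"
  by simp

lemma ball_int_mono:
  assumes "ball x R \<subseteq> ball x' R'"
  shows "ball_int g x R \<le> ball_int g x' R'"
  unfolding ball_int_def using assms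
  by (intro nn_integral_mono mult_left_mono) (auto simp: indicator_def)

lemma ball_int_le: "ball_int g x R \<le> (\<integral>\<^sup>+ y. g y \<partial>lebesgue)"
  unfolding ball_int_def by (intro nn_integral_mono) (auto simp: indicator_def)

lemma ball_int_le_maximal:
  assumes "0 < R"
  shows "ball_int g (x::'a::euclidean_space) R \<le> ennreal (vol1 TYPE('a) * R powr real DIM('a)) * maximal g x"
proof -
  let ?c = "ennreal (vol1 TYPE('a) * R powr real DIM('a))"
  have c: "?c \<noteq> 0" "?c \<noteq> top" using assms by (auto simp: ennreal_eq_0_iff not_le mult_pos_pos)
  have "ball_int g x R = ?c * (ball_int g x R / ?c)"
    using c by (simp add: ennreal_times_divide ennreal_mult_divide_eq mult.commute)
  also have "\<dots> \<le> ?c * maximal g x"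
    unfolding maximal_def using assms by (intro mult_left_mono SUP_upper) auto
  finally show ?thesis .
qed

lemma less_maximal_iff:
  fixes x :: "'a::euclidean_space"
  assumes "0 \<le> t"
  shows "ennreal t < maximal g x \<longleftrightarrow>
    (\<exists>R>0. ennreal (t * (vol1 TYPE('a) * R powr real DIM('a))) < ball_int g x R)"
proof -
  have *: "ennreal t < b / ennreal c \<longleftrightarrow> ennreal (t * c) < b" if "0 < c" for b :: ennreal and c
  proof (cases b)
    case (real r)
    then show ?thesis using that assms
      by (simp add: divide_ennreal ennreal_less_iff pos_less_divide_eq)
  next
    case top
    then show ?thesis using that by (simp add: ennreal_top_divide)
  qed
  have "ennreal t < ball_int g x R / ennreal (vol1 TYPE('a) * R powr real DIM('a)) \<longleftrightarrow>
      ennreal (t * (vol1 TYPE('a) * R powr real DIM('a))) < ball_int g x R" if "R > 0" for R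
    by (rule *) (use that in simp)
  then show ?thesis
    unfolding maximal_def less_SUP_iff by fastforce
qed

text \<open>Moving the centre by less than \<open>e\<close> is paid for by enlarging the radius from
  \<open>R\<close> to \<open>R + e\<close>; the strict inequality survives because the volume is
  continuous in the radius. Openness yields measurability.\<close>

lemma open_maximal_gt:
  fixes g :: "'a::euclidean_space \<Rightarrow> ennreal"
  assumes "0 \<le> t"
  shows "open {x. ennreal t < maximal g x}"
proof (rule openI)
  fix x assume "x \<in> {x. ennreal t < maximal g x}"
  then obtain R where R: "R > 0"
    "ennreal (t * (vol1 TYPE('a) * R powr real DIM('a))) < ball_int g x R"
    using less_maximal_iff[OF assms] by blast
  let ?F = "\<lambda>e. t * (vol1 TYPE('a) * (R + e) powr real DIM('a))"
  obtain b where b: "ennreal (?F 0) < ennreal b" "ennreal b < ball_int g x R" "0 \<le> b"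
  proof -
    obtain c where "ennreal (?F 0) < c" "c < ball_int g x R"
      using dense R by auto
    then show ?thesis by (cases c) (auto intro: that)
  qed
  have "?F 0 < b" using b by (auto simp: ennreal_less_iff assms)
  moreover have "(?F \<longlongrightarrow> ?F 0) (at_right 0)"
    using R by (intro tendsto_intros) auto
  ultimately have "\<forall>\<^sub>F e in at_right 0. ?F e < b"
    by (auto dest: order_tendstoD)
  moreover have "\<forall>\<^sub>F e in at_right 0. (0::real) < e"
    by (simp add: eventually_at_right_less)
  ultimately obtain e where e: "?F e < b" "0 < e"
    by (metis (no_types, lifting) eventually_conj eventually_happens trivial_limit_at_right_real)
  have "ball x e \<subseteq> {x. ennreal t < maximal g x}"
  proof safe
    fix y assume "y \<in> ball x e"
    then have "ball x R \<subseteq> ball y (R + e)"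
      by (intro subsetI, simp) (smt (verit) dist_commute dist_triangle)
    then have "ball_int g x R \<le> ball_int g y (R + e)" by (rule ball_int_mono)
    moreover have "ennreal (?F e) < ennreal b" using e b by (simp add: ennreal_lessI ennreal_less_iff assms)
    ultimately have "ennreal (?F e) < ball_int g y (R + e)"
      using b(2) by order
    then show "ennreal t < maximal g y"
      using less_maximal_iff[OF assms] e R by (metis add_pos_pos)
  qed
  then show "\<exists>e>0. ball x e \<subseteq> {x. ennreal t < maximal g x}" using e by blast
qed

lemma sets_maximal_gt:
  fixes g :: "'a::euclidean_space \<Rightarrow> ennreal"
  assumes "0 \<le> t"
  shows "{x. ennreal t < maximal g x} \<in> sets lebesgue"
  using open_maximal_gt[OF assms, of g] by auto

lemma borel_measurable_maximal: "maximal (g :: 'a::euclidean_space \<Rightarrow> ennreal) \<in> borel_measurable borel"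
proof (rule borel_measurableI_greater)
  fix y :: ennreal
  show "{x \<in> space borel. y < maximal g x} \<in> sets borel"
    using open_maximal_gt[of _ g] by (cases y) auto
qed

lemma borel_measurable_maximal_lebesgue [measurable]:
  "maximal (g :: 'a::euclidean_space \<Rightarrow> ennreal) \<in> borel_measurable lebesgue"
  using borel_measurable_maximal by (intro measurable_completion) simp

text \<open>Vitali covering: the balls witnessing a large average are thinned to a countable
  disjoint family whose fivefold enlargements still cover, hence \<open>5 powr n\<close>. A finite
  integral of \<open>g\<close> bounds the radii, as the covering lemma demands.\<close>

lemma maximal_weak_type:
  fixes g :: "'a::euclidean_space \<Rightarrow> ennreal"
  assumes [measurable]: "g \<in> borel_measurable lebesgue" and "0 < t"
  shows "ennreal t * emeasure lebesgue {x. ennreal t < maximal g x}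
    \<le> ennreal (5 powr real DIM('a)) * (\<integral>\<^sup>+ y. g y \<partial>lebesgue)"
proof (cases "(\<integral>\<^sup>+ y. g y \<partial>lebesgue)")
  case (real I)
  let ?n = "real DIM('a)" and ?V = "vol1 TYPE('a)"
  define E where "E = {x. ennreal t < maximal g x}"
  have "\<exists>R>0. ennreal (t * (?V * R powr ?n)) < ball_int g x R" if "x \<in> E" for x
    using that less_maximal_iff[of t g x] assms by (auto simp: E_def)
  then obtain R where R: "\<And>x. x \<in> E \<Longrightarrow> 0 < R x"
    "\<And>x. x \<in> E \<Longrightarrow> ennreal (t * (?V * R x powr ?n)) < ball_int g x (R x)"
    by metis
  have "R x \<le> (I / (t * ?V)) powr (1 / ?n)" if "x \<in> E" for x
  proof -
    have "ennreal (t * (?V * R x powr ?n)) \<le> ennreal I"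
      unfolding real(2)[symmetric] using R(2)[OF that] ball_int_le[of g x "R x"] by order
    then have "t * (?V * R x powr ?n) \<le> I"
      using real by (subst (asm) ennreal_le_iff) auto
    then have "R x powr ?n \<le> I / (t * ?V)"
      using assms real vol1_pos by (simp add: field_simps)
    then have "(R x powr ?n) powr (1 / ?n) \<le> (I / (t * ?V)) powr (1 / ?n)"
      by (intro powr_mono2) auto
    then show ?thesis using R(1)[OF that] by (simp add: powr_powr)
  qed
  then have rad: "0 < R x \<and> R x \<le> (I / (t * ?V)) powr (1 / ?n)" if "x \<in> E" for x
    using R(1) that by blast
  have cov: "E \<subseteq> (\<Union>i\<in>E. ball i (R i))" using R(1) by force
  obtain C where C: "countable C" "C \<subseteq> E"
     "pairwise (\<lambda>i j. disjnt (ball i (R i)) (ball j (R j))) C"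
     "E \<subseteq> (\<Union>i\<in>C. ball i (5 * R i))"
    by (rule Vitali_covering_lemma_balls[OF cov rad])
  have E[measurable]: "E \<in> sets lebesgue" using open_maximal_gt[of t g] assms by (auto simp: E_def)
  have "emeasure lebesgue E = (\<integral>\<^sup>+ x. indicator E x \<partial>lebesgue)" by simp
  \<comment> \<open>Sums over the family \<open>C\<close> are written as integrals over
    \<open>count_space C\<close>, so that they commute with the Lebesgue integral.\<close>
  also have "\<dots> \<le> (\<integral>\<^sup>+ x. \<integral>\<^sup>+ i. indicator (ball i (5 * R i)) x \<partial>count_space C \<partial>lebesgue)"
  proof (intro nn_integral_mono)
    fix x
    show "indicator E x \<le> (\<integral>\<^sup>+ i. indicator (ball i (5 * R i)) x \<partial>count_space C)"
    proof (cases "x \<in> E")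
      case True
      then obtain i where i: "i \<in> C" "x \<in> ball i (5 * R i)" using C(4) by blast
      have "(1::ennreal) = (\<integral>\<^sup>+ j. indicator {i} j \<partial>count_space C)" using i by simp
      also have "\<dots> \<le> (\<integral>\<^sup>+ i. indicator (ball i (5 * R i)) x \<partial>count_space C)"
        using i by (intro nn_integral_mono) (auto simp: indicator_def)
      finally show ?thesis using True by simp
    qed auto
  qed
  also have "\<dots> = (\<integral>\<^sup>+ i. \<integral>\<^sup>+ x. indicator (ball i (5 * R i)) x \<partial>lebesgue \<partial>count_space C)"
    by (intro nn_integral_count_space_nn_integral C) auto
  also have "ennreal t * \<dots> = (\<integral>\<^sup>+ i. ennreal (5 powr ?n) * ennreal (t * (?V * R i powr ?n)) \<partial>count_space C)"
  proof (subst nn_integral_cmult[symmetric], simp, intro nn_integral_cong)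
    fix i assume "i \<in> space (count_space C)"
    then have "0 < R i" using R(1) C by auto
    then have "(\<integral>\<^sup>+ x. indicator (ball i (5 * R i)) x \<partial>lebesgue) = ennreal (?V * (5 * R i) powr ?n)"
      by (intro nn_integral_indicator_ball) auto
    with assms \<open>0 < R i\<close> show "ennreal t * (\<integral>\<^sup>+ x. indicator (ball i (5 * R i)) x \<partial>lebesgue)
      = ennreal (5 powr ?n) * ennreal (t * (?V * R i powr ?n))"
      by (simp add: powr_mult algebra_simps flip: ennreal_mult')
  qed
  also have "\<dots> = ennreal (5 powr ?n) * (\<integral>\<^sup>+ i. ennreal (t * (?V * R i powr ?n)) \<partial>count_space C)"
    by (intro nn_integral_cmult) auto
  also have "(\<integral>\<^sup>+ i. ennreal (t * (?V * R i powr ?n)) \<partial>count_space C) \<le> (\<integral>\<^sup>+ i. ball_int g i (R i) \<partial>count_space C)"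
    using R(2) C by (intro nn_integral_mono less_imp_le) auto
  also have "(\<integral>\<^sup>+ i. ball_int g i (R i) \<partial>count_space C)
    = (\<integral>\<^sup>+ x. \<integral>\<^sup>+ i. g x * indicator (ball i (R i)) x \<partial>count_space C \<partial>lebesgue)"
    unfolding ball_int_def
    by (intro nn_integral_count_space_nn_integral[symmetric] C) auto
  also have "\<dots> \<le> (\<integral>\<^sup>+ x. g x \<partial>lebesgue)"
  proof (intro nn_integral_mono)
    fix x
    show "(\<integral>\<^sup>+ i. g x * indicator (ball i (R i)) x \<partial>count_space C) \<le> g x"
    proof (cases "\<exists>i\<in>C. x \<in> ball i (R i)")
      case True
      then obtain i where i: "i \<in> C" "x \<in> ball i (R i)" by blast
      have "(\<integral>\<^sup>+ j. g x * indicator (ball j (R j)) x \<partial>count_space C)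
        \<le> (\<integral>\<^sup>+ j. g x * indicator {i} j \<partial>count_space C)"
        using C(3) i by (intro nn_integral_mono) (auto simp: pairwise_def disjnt_iff indicator_def)
      also have "\<dots> = g x" using i by (simp add: nn_integral_cmult)
      finally show ?thesis .
    next
      case False
      then have "(\<integral>\<^sup>+ i. g x * indicator (ball i (R i)) x \<partial>count_space C) = (\<integral>\<^sup>+ i. 0 \<partial>count_space C)"
        by (intro nn_integral_cong) (auto simp: indicator_def)
      then show ?thesis by simp
    qed
  qed
  finally show ?thesis by (simp add: E_def mult_left_mono)
qed (simp add: ennreal_mult_top)

lemma maximal_truncate:
  fixes g :: "'a::euclidean_space \<Rightarrow> ennreal"
  assumes [measurable]: "g \<in> borel_measurable lebesgue" and "0 < t"
  shows "maximal g x \<le> ennreal t + maximal (\<lambda>y. g y * indicator {y. ennreal t < g y} y) x"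
    (is "_ \<le> _ + maximal ?h x")
  unfolding maximal_def[of g]
proof (intro SUP_least)
  fix R :: real assume "R \<in> {0<..}"
  then have R: "0 < R" by simp
  let ?c = "vol1 TYPE('a) * R powr real DIM('a)"
  have c: "0 < ?c" using R by simp
  have "ball_int g x R \<le> (\<integral>\<^sup>+ y. ennreal t * indicator (ball x R) y + ?h y * indicator (ball x R) y \<partial>lebesgue)"
    unfolding ball_int_def by (intro nn_integral_mono) (auto simp: indicator_def)
  also have "\<dots> = ennreal t * ennreal ?c + ball_int ?h x R"
    using R unfolding ball_int_def
    by (subst nn_integral_add) (auto simp: nn_integral_cmult nn_integral_indicator_ball simp del: nn_integral_indicator)
  also have "\<dots> \<le> ennreal t * ennreal ?c + ennreal ?c * maximal ?h x"
    by (intro add_left_mono ball_int_le_maximal R)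
  also have "\<dots> = ennreal ?c * (ennreal t + maximal ?h x)" by (simp add: algebra_simps)
  finally have *: "ball_int g x R / ennreal ?c \<le> ennreal ?c * (ennreal t + maximal ?h x) / ennreal ?c"
    by (rule divide_right_mono_ennreal)
  also have "\<dots> = ennreal t + maximal ?h x"
    using c by (subst mult.commute, intro ennreal_mult_divide_eq) (auto simp: ennreal_eq_0_iff simp del: mult_pos_pos)
  finally show "ball_int g x R / ennreal ?c \<le> ennreal t + maximal ?h x" .
qed

text \<open>The part of \<open>g\<close> below \<open>t\<close> contributes at most \<open>t\<close>
  to any average, so only the part above \<open>t\<close> can lift the maximal function beyond
  \<open>2 * t\<close>. Having the integral of that part alone on the right is what makes
  interpolation work.\<close>

lemma maximal_weak_type_truncate:
  fixes g :: "'a::euclidean_space \<Rightarrow> ennreal"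
  assumes [measurable]: "g \<in> borel_measurable lebesgue" and "0 < t"
  shows "emeasure lebesgue {x. ennreal (2 * t) < maximal g x}
    \<le> ennreal (5 powr real DIM('a) / t) * (\<integral>\<^sup>+ y. g y * indicator {y. ennreal t < g y} y \<partial>lebesgue)"
    (is "_ \<le> _ * ?I")
proof -
  let ?h = "\<lambda>y. g y * indicator {y. ennreal t < g y} y"
  let ?E = "{x. ennreal t < maximal ?h x}"
  have sub: "{x. ennreal (2 * t) < maximal g x} \<subseteq> ?E"
  proof safe
    fix x assume "ennreal (2 * t) < maximal g x"
    also note maximal_truncate[OF assms]
    finally have "ennreal t + ennreal t < ennreal t + maximal ?h x"
      using assms by (simp flip: ennreal_plus)
    then show "ennreal t < maximal ?h x" by (meson add_left_mono not_le)
  qed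
  have "emeasure lebesgue {x. ennreal (2 * t) < maximal g x} \<le> emeasure lebesgue ?E"
    using open_maximal_gt[of t ?h] assms by (intro emeasure_mono sub) auto
  also have "\<dots> = ennreal (1/t) * (ennreal t * emeasure lebesgue ?E)"
    using assms by (simp add: mult.assoc[symmetric] flip: ennreal_mult')
  also have "\<dots> \<le> ennreal (1/t) * (ennreal (5 powr real DIM('a)) * ?I)"
    by (intro mult_left_mono maximal_weak_type assms) auto
  also have "\<dots> = ennreal (5 powr real DIM('a) / t) * ?I"
    using assms by (simp add: mult.assoc[symmetric] flip: ennreal_mult')
  finally show ?thesis .
qed

text \<open>Layer cake over the heights \<open>2 powr k\<close> with \<open>k\<close> an integer:
  the largest such height strictly below \<open>m\<close> is at least \<open>m / 2\<close>, and its
  term alone suffices.\<close>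

lemma dyadic_sum_ge:
  fixes m :: ennreal
  assumes "0 < s"
  shows "enn_powr m s \<le> (\<integral>\<^sup>+ k. ennreal ((2 powr (real_of_int k + 1)) powr s) *
      (if ennreal (2 powr real_of_int k) < m then 1 else 0) \<partial>count_space UNIV)"
    (is "_ \<le> (\<integral>\<^sup>+ k. ?f k \<partial>_)")
proof -
  have ge: "?f k \<le> (\<integral>\<^sup>+ k. ?f k \<partial>count_space UNIV)" for k
  proof -
    have "?f k = (\<integral>\<^sup>+ i. ?f i * indicator {k} i \<partial>count_space UNIV)"
      by (subst nn_integral_indicator_finite) auto
    also have "\<dots> \<le> (\<integral>\<^sup>+ k. ?f k \<partial>count_space UNIV)"
      by (intro nn_integral_mono) (auto simp: indicator_def)
    finally show ?thesis .
  qed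
  show ?thesis
  proof (cases m)
    case (real r)
    show ?thesis
    proof (cases "r = 0")
      case False
      with real have r: "0 < r" by simp
      define k where "k = \<lceil>log 2 r\<rceil> - 1"
      have k: "real_of_int k < log 2 r" "log 2 r \<le> real_of_int k + 1" unfolding k_def by linarith+
      have "2 powr real_of_int k < r" using k r by (simp add: powr_less_iff)
      moreover have "r \<le> 2 powr (real_of_int k + 1)" using k r by (simp add: le_powr_iff)
      ultimately have "enn_powr m s \<le> ?f k"
        using r assms by (auto simp: real enn_powr_ennreal ennreal_less_iff intro!: ennreal_leI powr_mono2)
      then show ?thesis using ge[of k] by order
    qed (use real in auto)
  next
    case top
    have "of_nat k \<le> (\<integral>\<^sup>+ k. ?f k \<partial>count_space UNIV)" for k :: nat
    proof -
      obtain j :: nat where j: "real k \<le> (2 powr s)^j"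
        using real_arch_pow[of "2 powr s" "real k"] assms by (auto intro: less_imp_le)
      have "(of_nat k :: ennreal) = ennreal (real k)" by (simp add: ennreal_of_nat_eq_real_of_nat)
      also have "\<dots> \<le> ennreal ((2 powr (real_of_int (int j) + 1)) powr s)"
      proof (intro ennreal_leI order_trans[OF j])
        have "(2 powr s)^j = 2 powr (s * real j)" by (simp add: powr_powr flip: powr_realpow)
        also have "\<dots> \<le> 2 powr ((real j + 1) * s)" using assms by (intro powr_mono) (auto simp: algebra_simps)
        finally show "(2 powr s)^j \<le> (2 powr (real_of_int (int j) + 1)) powr s" by (simp add: powr_powr)
      qed
      also have "\<dots> = ?f (int j)" using top by simp
      also note ge[of "int j"]
      finally show ?thesis .
    qed
    then have "(\<integral>\<^sup>+ k. ?f k \<partial>count_space UNIV) = top"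
      by (meson ennreal_Ex_less_of_nat not_le less_top)
    then show ?thesis by simp
  qed
qed

text \<open>Counterpart of \<open>dyadic_sum_ge\<close> for the sum that remains after the weak type
  bound. Its terms grow geometrically because \<open>s > 1\<close>, so the sum is comparable to its
  top term, which is at most \<open>(2 * g) powr (s - 1)\<close>.\<close>

lemma dyadic_sum_le:
  fixes g :: ennreal
  assumes "1 < s"
  shows "g * (\<integral>\<^sup>+ k. ennreal ((2 powr real_of_int k) powr (s - 1)) *
      (if ennreal (2 powr (real_of_int k - 1)) < g then 1 else 0) \<partial>count_space UNIV)
     \<le> ennreal (2 powr (s - 1) / (1 - 2 powr - (s - 1))) * enn_powr g s"
    (is "g * (\<integral>\<^sup>+ k. ?f k \<partial>_) \<le> ennreal ?C * _")
proof -
  have lt1: "2 powr - (s - 1) < 1" using powr_less_mono[of "-(s-1)" 0 2] assms by simp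
  then have C: "?C > 0" by simp
  show ?thesis
  proof (cases g)
    case (real r)
    show ?thesis
    proof (cases "r = 0")
      case False
      with real have r: "0 < r" by simp
      define K where "K = \<lfloor>log 2 (2 * r)\<rfloor>"
      have K: "real_of_int K \<le> log 2 (2 * r)" by (simp add: K_def)
      have zero: "?f k = 0" if "K < k" for k
      proof -
        have "log 2 (2 * r) < real_of_int k" using that unfolding K_def by linarith
        then have "2 * r < 2 powr real_of_int k" using r by (simp add: less_powr_iff)
        then have "r < 2 powr (real_of_int k - 1)" by (simp add: powr_diff)
        then show ?thesis using real by (simp add: ennreal_less_iff)
      qed
      have "(\<integral>\<^sup>+ k. ?f k \<partial>count_space UNIV) \<le> (\<integral>\<^sup>+ k. ennreal ((2 powr real_of_int k) powr (s - 1)) \<partial>count_space {..K})"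
      proof (subst nn_integral_count_space_indicator, simp, intro nn_integral_mono)
        fix k
        show "?f k \<le> ennreal ((2 powr real_of_int k) powr (s - 1)) * indicator {..K} k"
          using zero[of k] by (cases "k \<le> K") auto
      qed
      also have "\<dots> = (\<integral>\<^sup>+ j. ennreal ((2 powr real_of_int (K - int j)) powr (s - 1)) \<partial>count_space UNIV)"
        by (intro nn_integral_bij_count_space[symmetric] bij_betwI[where g="\<lambda>k. nat (K - k)"]) auto
      also have "\<dots> = (\<Sum>j. ennreal ((2 powr real_of_int (K - int j)) powr (s - 1)))"
        by (rule nn_integral_count_space_nat)
      also have "(\<lambda>j. ennreal ((2 powr real_of_int (K - int j)) powr (s - 1)))
        = (\<lambda>j. ennreal ((2 powr real_of_int K) powr (s - 1)) * ennreal ((2^j) powr - (s - 1)))"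
      proof
        fix j :: nat
        have "2 powr real_of_int (K - int j) = 2 powr real_of_int K * (2^j) powr -1"
          by (simp add: powr_diff powr_realpow powr_minus divide_simps)
        then show "ennreal ((2 powr real_of_int (K - int j)) powr (s - 1)) =
          ennreal ((2 powr real_of_int K) powr (s - 1)) * ennreal ((2^j) powr - (s - 1))"
          by (simp only: powr_mult powr_powr) (simp add: ennreal_mult')
      qed
      also have "(\<Sum>j. ennreal ((2 powr real_of_int K) powr (s - 1)) * ennreal ((2^j) powr - (s - 1)))
         = ennreal ((2 powr real_of_int K) powr (s - 1)) * ennreal (1 / (1 - 2 powr - (s - 1)))"
        using assms by (subst ennreal_suminf_cmult, subst suminf_geometric_powr) auto
      also have "\<dots> \<le> ennreal ((2 * r) powr (s - 1)) * ennreal (1 / (1 - 2 powr - (s - 1)))"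
      proof (intro mult_right_mono ennreal_leI powr_mono2)
        show "2 powr real_of_int K \<le> 2 * r" using K r by (simp add: powr_le_iff)
      qed (use assms in auto)
      also have "\<dots> = ennreal ((2 * r) powr (s - 1) / (1 - 2 powr - (s - 1)))"
        using lt1 by (simp flip: ennreal_mult')
      finally have "g * (\<integral>\<^sup>+ k. ?f k \<partial>count_space UNIV) \<le> ennreal r * ennreal ((2 * r) powr (s - 1) / (1 - 2 powr - (s - 1)))"
        unfolding real by (intro mult_left_mono) auto
      also have "\<dots> = ennreal (r * ((2 * r) powr (s - 1) / (1 - 2 powr - (s - 1))))"
        using r by (intro ennreal_mult'[symmetric]) simp
      also have "r * ((2 * r) powr (s - 1) / (1 - 2 powr - (s - 1))) = ?C * r powr s"
        using r by (simp add: powr_mult powr_diff)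
      also have "ennreal (?C * r powr s) = ennreal ?C * enn_powr g s"
        unfolding real(2) enn_powr_ennreal[OF real(1)] by (rule ennreal_mult') (use C in simp)
      finally show ?thesis .
    qed (use real in auto)
  qed (use C assms in \<open>simp add: ennreal_mult_top\<close>)
qed

text \<open>Marcinkiewicz interpolation between the weak type bound and the trivial bound for
  bounded functions: slice by dyadic heights, apply the truncated weak bound to each slice, and sum
  the heights again for fixed \<open>x\<close>.\<close>

theorem maximal_strong_type:
  fixes g :: "'a::euclidean_space \<Rightarrow> ennreal"
  assumes [measurable]: "g \<in> borel_measurable lebesgue" and s: "1 < s"
  shows "(\<integral>\<^sup>+ x. enn_powr (maximal g x) s \<partial>lebesgue)
    \<le> ennreal (2 powr s * (2 * 5 powr real DIM('a)) * (2 powr (s - 1) / (1 - 2 powr - (s - 1))))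
       * (\<integral>\<^sup>+ x. enn_powr (g x) s \<partial>lebesgue)"
proof -
  let ?n = "real DIM('a)"
  let ?A = "2 powr s * (2 * 5 powr ?n)" and ?C = "2 powr (s - 1) / (1 - 2 powr - (s - 1))"
  have lt1: "2 powr - (s - 1) < 1" using powr_less_mono[of "-(s-1)" 0 2] s by simp
  let ?a = "\<lambda>k. ennreal ((2 powr (real_of_int k + 1)) powr s)"
  have "(\<integral>\<^sup>+ x. enn_powr (maximal g x) s \<partial>lebesgue)
    \<le> (\<integral>\<^sup>+ x. (\<integral>\<^sup>+ k. ?a k * (if ennreal (2 powr real_of_int k) < maximal g x then 1 else 0)
          \<partial>count_space UNIV) \<partial>lebesgue)"
    using s by (intro nn_integral_mono dyadic_sum_ge) auto
  also have "\<dots> = (\<integral>\<^sup>+ k. \<integral>\<^sup>+ x. ?a k * (if ennreal (2 powr real_of_int k) < maximal g x then 1 else 0)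
          \<partial>lebesgue \<partial>count_space UNIV)"
    by (intro nn_integral_count_space_nn_integral) auto
  also have "\<dots> \<le> (\<integral>\<^sup>+ k. \<integral>\<^sup>+ x. ennreal ?A * (g x * (ennreal ((2 powr real_of_int k) powr (s - 1)) *
      (if ennreal (2 powr (real_of_int k - 1)) < g x then 1 else 0))) \<partial>lebesgue \<partial>count_space UNIV)"
  proof (rule nn_integral_mono)
    fix k :: int
    \<comment> \<open>Half the height of the slice: the truncated weak bound at level
      \<open>2 * t\<close> sees only the part of \<open>g\<close> above \<open>t\<close>.\<close>
    define t where "t = 2 powr (real_of_int k - 1)"
    have t: "2 powr real_of_int k = 2 * t" "0 < t" by (simp_all add: t_def powr_diff)
    let ?I = "\<integral>\<^sup>+ y. g y * indicator {y. ennreal t < g y} y \<partial>lebesgue"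
    have "(\<integral>\<^sup>+ x. ?a k * (if ennreal (2 * t) < maximal g x then 1 else 0) \<partial>lebesgue)
      = (\<integral>\<^sup>+ x. ?a k * indicator {x. ennreal (2 * t) < maximal g x} x \<partial>lebesgue)"
      by (intro nn_integral_cong) (simp add: indicator_def)
    also have "\<dots> = ?a k * emeasure lebesgue {x. ennreal (2 * t) < maximal g x}"
      using t by (intro nn_integral_cmult_indicator sets_maximal_gt) simp
    also have "\<dots> \<le> ?a k * (ennreal (5 powr ?n / t) * ?I)"
      using t by (intro mult_left_mono maximal_weak_type_truncate assms) auto
    also have "\<dots> = (?a k * ennreal (5 powr ?n / t)) * ?I"
      by (simp only: mult.assoc)
    also have "?a k * ennreal (5 powr ?n / t) = ennreal ?A * ennreal ((2 powr real_of_int k) powr (s - 1))"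
    proof -
      have "(2 powr (real_of_int k + 1)) powr s = 2 powr s * ((2 powr real_of_int k) powr (s - 1) * 2 powr real_of_int k)"
        by (simp add: powr_powr powr_add[symmetric] algebra_simps)
      then have "(2 powr (real_of_int k + 1)) powr s * (5 powr ?n / t) = ?A * (2 powr real_of_int k) powr (s - 1)"
        using t by simp
      then show ?thesis using t by (simp flip: ennreal_mult')
    qed
    also have "\<dots> * ?I
      = (\<integral>\<^sup>+ x. (ennreal ?A * ennreal ((2 powr real_of_int k) powr (s - 1))) * (g x * indicator {y. ennreal t < g y} x) \<partial>lebesgue)"
      by (intro nn_integral_cmult[symmetric]) measurable
    also have "\<dots> = (\<integral>\<^sup>+ x. ennreal ?A * (g x * (ennreal ((2 powr real_of_int k) powr (s - 1)) *
      (if ennreal t < g x then 1 else 0))) \<partial>lebesgue)"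
      by (intro nn_integral_cong) (simp add: indicator_def ac_simps)
    finally show "(\<integral>\<^sup>+ x. ?a k * (if ennreal (2 powr real_of_int k) < maximal g x then 1 else 0) \<partial>lebesgue)
      \<le> (\<integral>\<^sup>+ x. ennreal ?A * (g x * (ennreal ((2 powr real_of_int k) powr (s - 1)) *
      (if ennreal (2 powr (real_of_int k - 1)) < g x then 1 else 0))) \<partial>lebesgue)"
      by (simp only: t(1) flip: t_def)
  qed
  also have "\<dots> = (\<integral>\<^sup>+ x. \<integral>\<^sup>+ k. ennreal ?A * (g x * (ennreal ((2 powr real_of_int k) powr (s - 1)) *
      (if ennreal (2 powr (real_of_int k - 1)) < g x then 1 else 0))) \<partial>count_space UNIV \<partial>lebesgue)"
    by (intro nn_integral_count_space_nn_integral[symmetric]) auto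
  also have "\<dots> = (\<integral>\<^sup>+ x. ennreal ?A * (g x * (\<integral>\<^sup>+ k. (ennreal ((2 powr real_of_int k) powr (s - 1)) *
      (if ennreal (2 powr (real_of_int k - 1)) < g x then 1 else 0)) \<partial>count_space UNIV)) \<partial>lebesgue)"
    by (intro nn_integral_cong) (simp add: nn_integral_cmult)
  also have "\<dots> \<le> (\<integral>\<^sup>+ x. ennreal ?A * (ennreal ?C * enn_powr (g x) s) \<partial>lebesgue)"
    by (intro nn_integral_mono mult_left_mono dyadic_sum_le s) auto
  also have "\<dots> = ennreal ?A * (\<integral>\<^sup>+ x. ennreal ?C * enn_powr (g x) s \<partial>lebesgue)"
    by (rule nn_integral_cmult) measurable
  also have "(\<integral>\<^sup>+ x. ennreal ?C * enn_powr (g x) s \<partial>lebesgue) = ennreal ?C * (\<integral>\<^sup>+ x. enn_powr (g x) s \<partial>lebesgue)"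
    by (rule nn_integral_cmult) measurable
  also have "ennreal ?A * (ennreal ?C * (\<integral>\<^sup>+ x. enn_powr (g x) s \<partial>lebesgue))
    = ennreal (?A * ?C) * (\<integral>\<^sup>+ x. enn_powr (g x) s \<partial>lebesgue)"
  proof -
    have "0 \<le> ?A" "0 \<le> ?C" using lt1 by simp_all
    then have "ennreal (?A * ?C) = ennreal ?A * ennreal ?C" by (rule ennreal_mult)
    then show ?thesis by (simp only: mult.assoc)
  qed
  finally show ?thesis .
qed

section \<open>Log-Hoelder exponents\<close>

text \<open>On a ball \<open>ball x R\<close> with \<open>near x R\<close> a log-Hoelder exponent oscillates so little that
  \<open>R powr (1 / s y)\<close> and \<open>R powr (1 / s x)\<close> are comparable. The remaining balls are large and contain
  a fixed fraction of a ball around the origin, so they only feel the limit \<open>s0\<close> of the exponent at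
  infinity. Accordingly \<open>Phi s s0 x R\<close> is the size of the Luxemburg norm of the indicator of \<open>ball x R\<close>.\<close>

definition near :: "'a::euclidean_space \<Rightarrow> real \<Rightarrow> bool" where
  "near x R \<longleftrightarrow> R \<le> max 1 (norm x / 2)"

definition Phi :: "('a::euclidean_space \<Rightarrow> real) \<Rightarrow> real \<Rightarrow> 'a \<Rightarrow> real \<Rightarrow> real" where
  "Phi s s0 x R = R powr (real DIM('a) / (if near x R then s x else s0))"

lemma Phi_pos: "0 < R \<Longrightarrow> 0 < Phi s s0 x R"
  by (simp add: Phi_def)

text \<open>If \<open>t\<close> is at least a power of \<open>exp 1 + norm x\<close>, the decay condition absorbs the change of exponent;
  otherwise \<open>t powr b\<close> is below the integrable error term.\<close>

lemma powr_exponent_change: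
  fixes x :: "'a::euclidean_space"
  assumes t: "0 \<le> t" "t \<le> 1" and N: "0 \<le> N" and a: "1 < a"
    and b: "a \<le> b" "b \<le> P" and c: "a \<le> c" "c \<le> P"
    and K: "\<bar>1 / b - 1 / c\<bar> * ln (exp 1 + norm x) \<le> K"
  shows "t powr b \<le> exp (N * P^2 * K) * t powr c + (exp 1 + norm x) powr - (N * a)"
proof (cases "(exp 1 + norm x) powr - N \<le> t")
  case True
  let ?e = "exp 1 + norm x"
  have e: "?e \<ge> 1" "?e > 0" using exp_ge_add_one_self[of 1] norm_ge_zero[of x] by linarith+
  have "0 < t" using True e by (smt (verit) powr_gt_zero)
  have "- ln t \<le> N * ln ?e"
    using ln_mono[OF True] e \<open>0 < t\<close> by (simp add: ln_powr)
  \<comment> \<open>The factor \<open>P^2\<close> in the constant is the price of passing from a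
    difference of reciprocals to a difference of exponents.\<close>
  have "\<bar>b - c\<bar> \<le> P^2 * \<bar>1 / b - 1 / c\<bar>"
  proof -
    have "\<bar>b - c\<bar> = b * c * \<bar>1 / b - 1 / c\<bar>"
      using a b c by (simp add: divide_simps abs_mult)
    also have "\<dots> \<le> P * P * \<bar>1 / b - 1 / c\<bar>"
      using a b c by (intro mult_right_mono mult_mono) auto
    finally show ?thesis by (simp add: power2_eq_square)
  qed
  have "(b - c) * ln t \<le> \<bar>b - c\<bar> * (- ln t)"
  proof -
    have "\<bar>ln t\<bar> = - ln t" using t \<open>0 < t\<close> by simp
    then show ?thesis by (metis abs_ge_self abs_mult)
  qed
  also have "\<dots> \<le> (P^2 * \<bar>1 / b - 1 / c\<bar>) * (N * ln ?e)"
    using \<open>\<bar>b - c\<bar> \<le> _\<close> \<open>- ln t \<le> _\<close> t \<open>0 < t\<close> by (intro mult_mono) auto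
  also have "\<dots> = N * P^2 * (\<bar>1 / b - 1 / c\<bar> * ln ?e)" by simp
  also have "\<dots> \<le> N * P^2 * K" using N K by (intro mult_left_mono) auto
  finally have "t powr (b - c) \<le> exp (N * P^2 * K)"
    using \<open>0 < t\<close> by (simp add: powr_def)
  then have "t powr b \<le> exp (N * P^2 * K) * t powr c"
    using \<open>0 < t\<close> by (simp add: powr_diff divide_simps)
  then show ?thesis by (simp add: add_increasing2)
next
  case False
  have "exp 1 + norm x \<ge> 1" using exp_ge_add_one_self[of 1] norm_ge_zero[of x] by linarith
  have "t powr b \<le> ((exp 1 + norm x) powr - N) powr b"
    using False t a b by (intro powr_mono2) auto
  also have "\<dots> \<le> (exp 1 + norm x) powr - (N * a)"
    unfolding powr_powr using N b \<open>_ \<ge> 1\<close> by (intro powr_mono) (auto simp: mult_left_mono)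
  finally show ?thesis by (simp add: add_increasing)
qed

text \<open>\<open>s0\<close> plays the role of the limit of \<open>s\<close> at infinity. Both
  continuity conditions are put on reciprocals, which conjugation merely reflects, and
  \<open>osc\<close> combines the local condition for small balls with the decay condition for large
  balls far from the origin.\<close>

locale log_exponent =
  fixes s :: "'a::euclidean_space \<Rightarrow> real" and s0 a P K :: real
  assumes gt1: "1 < a" and lower: "\<And>x. a \<le> s x" and upper: "\<And>x. s x \<le> P"
    and lower_inf: "a \<le> s0" and upper_inf: "s0 \<le> P"
    and meas [measurable]: "s \<in> borel_measurable lebesgue"
    and osc: "\<And>x y R. \<lbrakk>0 < R; near x R; y \<in> ball x R\<rbrakk> \<Longrightarrow> \<bar>ln R\<bar> * \<bar>1 / s x - 1 / s y\<bar> \<le> K"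
    and decay: "\<And>x. \<bar>1 / s x - 1 / s0\<bar> * ln (exp 1 + norm x) \<le> K"
begin

lemma s_gt1: "1 < s x" using gt1 lower[of x] by linarith
lemma s_pos: "0 < s x" using s_gt1[of x] by linarith
lemma inf_gt1: "1 < s0" using gt1 lower_inf by linarith
lemma P_gt1: "1 < P" using inf_gt1 upper_inf by linarith

text \<open>\<open>osc\<close> bounds the absolute value of \<open>ln R\<close>, so the estimate
  works for small and for large \<open>R\<close> and for either sign of \<open>e\<close>.\<close>

lemma powr_osc:
  assumes "0 < R" "near x R" "y \<in> ball x R" "\<bar>e\<bar> \<le> L * \<bar>1 / s x - 1 / s y\<bar>" "0 \<le> L"
  shows "R powr e \<le> exp (L * K)"
proof -
  have "e * ln R \<le> \<bar>e\<bar> * \<bar>ln R\<bar>" by (metis abs_ge_self abs_mult)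
  also have "\<dots> \<le> L * \<bar>1 / s x - 1 / s y\<bar> * \<bar>ln R\<bar>" using assms by (intro mult_right_mono) auto
  also have "\<dots> = L * (\<bar>ln R\<bar> * \<bar>1 / s x - 1 / s y\<bar>)" by simp
  also have "\<dots> \<le> L * K" using assms osc by (intro mult_left_mono) auto
  finally show ?thesis using assms by (simp add: powr_def)
qed

text \<open>In the near case the exponents at \<open>x\<close> and \<open>y\<close> differ so little
  that only \<open>R powr - n\<close> and a constant remain. In the other case \<open>R > 1\<close>,
  so the base is at most 1 and its exponent may be changed from \<open>s0\<close> to
  \<open>s y\<close> at the cost of the integrable error.\<close>

lemma Phi_modular_pointwise:
  assumes "0 < R" "y \<in> ball x R"
  shows "Phi s s0 x R powr - s y \<le> exp (real DIM('a) * P^2 * K) * R powr - real DIM('a)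
    + (exp 1 + norm y) powr - (real DIM('a) * a)"
proof (cases "near x R")
  case True
  let ?n = "real DIM('a)"
  have "Phi s s0 x R powr - s y = R powr - ?n * R powr (?n * s y * (1 / s y - 1 / s x))"
    using True assms s_pos[of x] s_pos[of y] by (simp add: Phi_def powr_powr powr_add[symmetric] divide_simps algebra_simps)
  also have "\<dots> \<le> R powr - ?n * exp (?n * P^2 * K)"
  proof (intro mult_left_mono powr_osc[OF assms(1) True assms(2)])
    \<comment> \<open>The crude \<open>P^2\<close> instead of \<open>P\<close> lets both cases share
      one constant.\<close>
    have "s y \<le> P^2" using s_pos[of y] upper[of y] P_gt1
      by (smt (verit) mult_less_cancel_left2 power2_eq_square)
    then show "\<bar>?n * s y * (1 / s y - 1 / s x)\<bar> \<le> ?n * P^2 * \<bar>1 / s x - 1 / s y\<bar>"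
      using s_pos[of y] by (auto simp: abs_mult abs_minus_commute intro!: mult_right_mono)
  qed auto
  finally show ?thesis by (simp add: mult.commute add_increasing2)
next
  case False
  let ?n = "real DIM('a)"
  have R1: "1 < R" using False by (auto simp: near_def)
  have "(R powr - (?n / s0)) powr s y \<le> exp (?n * P^2 * K) * (R powr - (?n / s0)) powr s0
    + (exp 1 + norm y) powr - (?n * a)"
  proof (rule powr_exponent_change)
    have "R powr - (?n / s0) \<le> R powr 0" using R1 inf_gt1 by (intro powr_mono) auto
    then show "R powr - (?n / s0) \<le> 1" using R1 by simp
  qed (use gt1 lower upper lower_inf upper_inf decay in auto)
  then show ?thesis using False R1 inf_gt1 by (simp add: Phi_def powr_powr)
qed

text \<open>The indicator of \<open>ball x R\<close> divided by \<open>Phi s s0 x R\<close> has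
  bounded modular, uniformly in \<open>x\<close> and \<open>R\<close>: \<open>Phi\<close> bounds the
  norm of the indicator up to a constant.\<close>

lemma Phi_modular_bound:
  "\<exists>A\<ge>1. \<forall>x R. 0 < R \<longrightarrow> ball_int (\<lambda>y. ennreal (Phi s s0 x R powr - s y)) x R \<le> ennreal A"
proof -
  let ?n = "real DIM('a)" and ?V = "vol1 TYPE('a)"
  let ?T = "\<integral>\<^sup>+ (y::'a). ennreal ((exp 1 + norm y) powr - (?n * a)) \<partial>lebesgue"
  obtain T where T: "?T = ennreal T" "0 \<le> T"
    using nn_integral_norm_decay_finite[where 'a='a, OF gt1] by (cases ?T) auto
  show ?thesis
  proof (intro exI conjI allI impI)
    show "1 \<le> max 1 (exp (?n * P^2 * K) * ?V + T)" by simp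
    fix x :: 'a and R :: real assume R: "0 < R"
    have "ball_int (\<lambda>y. ennreal (Phi s s0 x R powr - s y)) x R
      \<le> (\<integral>\<^sup>+ y. ennreal (exp (?n * P^2 * K) * R powr - ?n) * indicator (ball x R) y
          + ennreal ((exp 1 + norm y) powr - (?n * a)) \<partial>lebesgue)"
      unfolding ball_int_def
    proof (intro nn_integral_mono)
      fix y
      show "ennreal (Phi s s0 x R powr - s y) * indicator (ball x R) y \<le>
        ennreal (exp (?n * P^2 * K) * R powr - ?n) * indicator (ball x R) y + ennreal ((exp 1 + norm y) powr - (?n * a))"
        using Phi_modular_pointwise[OF R, of y x]
        by (cases "y \<in> ball x R") (auto simp flip: ennreal_plus intro!: ennreal_leI)
    qed
    also have "\<dots> = ennreal (exp (?n * P^2 * K) * R powr - ?n) * ennreal (?V * R powr ?n) + ?T"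
      using R by (subst nn_integral_add) (auto simp: nn_integral_cmult nn_integral_indicator_ball simp del: nn_integral_indicator)
    also have "\<dots> = ennreal (exp (?n * P^2 * K) * ?V + T)"
      using R T by (simp add: powr_minus field_simps flip: ennreal_mult' ennreal_plus)
    also have "\<dots> \<le> ennreal (max 1 (exp (?n * P^2 * K) * ?V + T))" by (intro ennreal_leI) simp
    finally show "ball_int (\<lambda>y. ennreal (Phi s s0 x R powr - s y)) x R
      \<le> ennreal (max 1 (exp (?n * P^2 * K) * ?V + T))" .
  qed
qed

text \<open>Conjugation reverses the order, so the conjugate of the upper bound \<open>P\<close>
  becomes the lower bound. Reciprocals turn into \<open>1 - 1 / z\<close>, which leaves their
  differences and hence \<open>K\<close> unchanged up to sign.\<close>

lemma conjugate:
  "log_exponent (\<lambda>x. s x / (s x - 1)) (s0 / (s0 - 1)) (P / (P - 1)) (a / (a - 1)) K"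
proof -
  have mono: "z / (z - 1) \<le> y / (y - 1)" if "1 < y" "y \<le> z" for y z :: real
    using that by (simp add: divide_simps algebra_simps)
  have recip: "1 / (z / (z - 1)) = 1 - 1 / z" if "1 < z" for z :: real
    using that by (simp add: divide_simps)
  show ?thesis
  proof
    show "1 < P / (P - 1)" using P_gt1 by simp
    show "\<bar>ln R\<bar> * \<bar>1 / (s x / (s x - 1)) - 1 / (s y / (s y - 1))\<bar> \<le> K"
      if "0 < R" "near x R" "y \<in> ball x R" for x y R
      unfolding recip[OF s_gt1] using osc[OF that] by (simp add: abs_minus_commute)
    show "\<bar>1 / (s x / (s x - 1)) - 1 / (s0 / (s0 - 1))\<bar> * ln (exp 1 + norm x) \<le> K" for x
      unfolding recip[OF s_gt1] recip[OF inf_gt1] using decay[of x] by (simp add: abs_minus_commute)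
  qed (use mono gt1 s_gt1 inf_gt1 lower upper lower_inf upper_inf in auto)
qed

lemma Phi_conjugate:
  assumes "0 < R"
  shows "Phi (\<lambda>x. s x / (s x - 1)) (s0 / (s0 - 1)) x R = R powr real DIM('a) / Phi s s0 x R"
  using assms s_pos[of x] inf_gt1
  by (auto simp: Phi_def powr_diff[symmetric] divide_simps algebra_simps)

text \<open>Hoelder's inequality against the indicator of a ball, without dual norms: Young's
  inequality applied to \<open>g y * (1 / F)\<close>, with \<open>F\<close> the \<open>Phi\<close>
  of the conjugate exponent, leaves the modular of \<open>g\<close> and that of a normalised
  indicator.\<close>

lemma ball_int_le_Phi:
  "\<exists>A\<ge>1. \<forall>g x R. g \<in> borel_measurable lebesgue \<longrightarrow> (\<forall>y. 0 \<le> g y) \<longrightarrow> 0 < R \<longrightarrow>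
     ball_int (\<lambda>y. ennreal (g y powr s y)) x R \<le> 1 \<longrightarrow>
     ball_int (\<lambda>y. ennreal (g y)) x R \<le> ennreal (A * (R powr real DIM('a) / Phi s s0 x R))"
proof -
  let ?s' = "\<lambda>x. s x / (s x - 1)" and ?i = "s0 / (s0 - 1)"
  interpret conj: log_exponent ?s' ?i "P / (P - 1)" "a / (a - 1)" K by (rule conjugate)
  obtain A where A: "A \<ge> 1" "\<And>x R. 0 < R \<Longrightarrow>
    ball_int (\<lambda>y. ennreal (Phi ?s' ?i x R powr - ?s' y)) x R \<le> ennreal A"
    using conj.Phi_modular_bound by blast
  show ?thesis
  proof (intro exI conjI allI impI)
    show "1 \<le> 1 + A" using A by simp
    fix g :: "'a \<Rightarrow> real" and x R
    assume [measurable]: "g \<in> borel_measurable lebesgue" and g: "\<forall>y. 0 \<le> g y" and R: "0 < R"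
      and mod: "ball_int (\<lambda>y. ennreal (g y powr s y)) x R \<le> 1"
    define F where "F = Phi ?s' ?i x R"
    have F: "0 < F" using R by (simp add: F_def Phi_pos)
    have young: "g y * (1 / F) \<le> g y powr s y + F powr - ?s' y" for y
    proof -
      have "g y * (1 / F) \<le> g y powr s y / s y + (1 / F) powr ?s' y / ?s' y"
        using s_gt1[of y] conj.s_gt1[of y] g F by (intro Youngs_inequality) (auto simp: divide_simps)
      also have "\<dots> \<le> g y powr s y + (1 / F) powr ?s' y"
        using s_gt1[of y] conj.s_gt1[of y] by (intro add_mono) (auto simp: divide_le_eq mult_le_cancel_left1 simp del: mult_divide_mult_cancel_left_if times_divide_eq_right divide_divide_eq_right)
      also have "(1 / F) powr ?s' y = F powr - ?s' y" using F by (simp add: powr_minus powr_divide divide_simps)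
      finally show ?thesis .
    qed
    have "ennreal (1 / F) * ball_int (\<lambda>y. ennreal (g y)) x R
      = (\<integral>\<^sup>+ y. ennreal (g y * (1 / F)) * indicator (ball x R) y \<partial>lebesgue)"
      unfolding ball_int_def using F g
      by (subst nn_integral_cmult[symmetric]) (auto intro!: nn_integral_cong simp: indicator_def mult.commute simp flip: ennreal_mult'')
    also have "\<dots> \<le> (\<integral>\<^sup>+ y. ennreal (g y powr s y) * indicator (ball x R) y
        + ennreal (F powr - ?s' y) * indicator (ball x R) y \<partial>lebesgue)"
      using young by (intro nn_integral_mono) (auto simp: indicator_def intro!: ennreal_leI simp flip: ennreal_plus)
    also have "\<dots> = ball_int (\<lambda>y. ennreal (g y powr s y)) x R + ball_int (\<lambda>y. ennreal (F powr - ?s' y)) x R"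
      unfolding ball_int_def by (intro nn_integral_add) measurable
    also have "\<dots> \<le> 1 + ennreal A"
      using mod A R by (intro add_mono) (auto simp: F_def)
    also have "\<dots> = ennreal (1 + A)" using A by (simp flip: ennreal_1 ennreal_plus)
    finally have "ennreal F * (ennreal (1 / F) * ball_int (\<lambda>y. ennreal (g y)) x R) \<le> ennreal F * ennreal (1 + A)"
      by (rule mult_left_mono) simp
    also have "\<dots> = ennreal (F * (1 + A))" using F A by (intro ennreal_mult[symmetric]) auto
    finally have "ball_int (\<lambda>y. ennreal (g y)) x R \<le> ennreal (F * (1 + A))"
      using F A by (simp add: mult.assoc[symmetric] flip: ennreal_mult')
    then show "ball_int (\<lambda>y. ennreal (g y)) x R \<le> ennreal ((1 + A) * (R powr real DIM('a) / Phi s s0 x R))"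
      using Phi_conjugate[OF R, of x] by (simp add: F_def mult.commute)
  qed
qed

lemma powr_le_powr_inf:
  assumes "0 \<le> t" "t \<le> 1"
  shows "t powr s x \<le> exp (real DIM('a) * P^2 * K) * t powr s0 + (exp 1 + norm x) powr - (real DIM('a) * a)"
  using assms gt1 lower upper lower_inf upper_inf decay by (intro powr_exponent_change) auto

lemma powr_inf_le_powr:
  assumes "0 \<le> t" "t \<le> 1"
  shows "t powr s0 \<le> exp (real DIM('a) * P^2 * K) * t powr s x + (exp 1 + norm x) powr - (real DIM('a) * a)"
  using assms gt1 lower upper lower_inf upper_inf decay by (intro powr_exponent_change) (auto simp: abs_minus_commute)

end

section \<open>Riesz potentials\<close>

definition riesz :: "real \<Rightarrow> ('a::euclidean_space \<Rightarrow> ennreal) \<Rightarrow> 'a \<Rightarrow> ennreal" where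
  "riesz \<gamma> g x = (\<integral>\<^sup>+ y. g y * ennreal (norm (x - y) powr - (real DIM('a) - \<gamma>)) \<partial>lebesgue)"

lemma indicator_ball_diff: "indicator (ball 0 r) (x - y :: 'a::euclidean_space) = indicator (ball x r) y"
  by (simp add: indicator_def dist_norm norm_minus_commute)

lemma riesz_cmult:
  assumes [measurable]: "g \<in> borel_measurable lebesgue"
  shows "riesz \<gamma> (\<lambda>y. c * g y) x = c * riesz \<gamma> g x"
  unfolding riesz_def by (subst nn_integral_cmult[symmetric]) (auto simp: mult.assoc)

lemma riesz_add:
  assumes [measurable]: "g \<in> borel_measurable lebesgue" "h \<in> borel_measurable lebesgue"
  shows "riesz \<gamma> (\<lambda>y. g y + h y) x = riesz \<gamma> g x + riesz \<gamma> h x"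
  unfolding riesz_def by (subst nn_integral_add[symmetric]) (auto simp: algebra_simps)

lemma riesz_far_le:
  fixes x :: "'a::euclidean_space"
  assumes g [measurable]: "g \<in> borel_measurable lebesgue" and "0 < d" "0 \<le> s"
  shows "(\<integral>\<^sup>+ y. g y * ennreal (norm (x - y) powr - s) * indicator (- ball x d) y \<partial>lebesgue)
    \<le> (\<Sum>j. ennreal ((2^j * d) powr - s) * ball_int g x (2^(j+1) * d))"
proof -
  have "(\<integral>\<^sup>+ y. g y * ennreal (norm (x - y) powr - s) * indicator (- ball x d) y \<partial>lebesgue)
    \<le> (\<integral>\<^sup>+ y. (\<Sum>j. ennreal ((2^j * d) powr - s) * (g y * indicator (ball x (2^(j+1) * d)) y)) \<partial>lebesgue)"
  proof (intro nn_integral_mono)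
    fix y
    show "g y * ennreal (norm (x - y) powr - s) * indicator (- ball x d) y
      \<le> (\<Sum>j. ennreal ((2^j * d) powr - s) * (g y * indicator (ball x (2^(j+1) * d)) y))"
    proof (cases "y \<in> ball x d")
      case False
      then have "d \<le> norm (x - y)" by (simp add: dist_norm)
      from kernel_far_le[OF assms(2) this assms(3)]
      have "g y * ennreal (norm (x - y) powr - s)
        \<le> g y * (\<Sum>j. ennreal ((2^j * d) powr - s) * indicator (ball 0 (2^(j+1) * d)) (x - y))"
        by (rule mult_left_mono) simp
      also have "\<dots> = (\<Sum>j. ennreal ((2^j * d) powr - s) * (g y * indicator (ball x (2^(j+1) * d)) y))"
        by (subst ennreal_suminf_cmult[symmetric], rule suminf_cong)
           (simp add: indicator_ball_diff mult_ac)
      finally show ?thesis using False by simp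
    qed simp
  qed
  also have "\<dots> = (\<Sum>j. ennreal ((2^j * d) powr - s) * ball_int g x (2^(j+1) * d))"
    unfolding ball_int_def by (subst nn_integral_suminf) (auto simp: nn_integral_cmult)
  finally show ?thesis .
qed

text \<open>On the ball of radius \<open>d / 2^j\<close> the kernel times the volume is of order
  \<open>(d / 2^j) powr (n - s)\<close>; \<open>s < n\<close> makes this summable.\<close>

lemma riesz_near_le:
  fixes x :: "'a::euclidean_space"
  assumes g [measurable]: "g \<in> borel_measurable lebesgue" and "0 < d" and s: "0 \<le> s" "s < real DIM('a)"
  shows "(\<integral>\<^sup>+ y. g y * ennreal (norm (x - y) powr - s) * indicator (ball x d) y \<partial>lebesgue)
    \<le> ennreal (vol1 TYPE('a) * 2 powr s / (1 - 2 powr - (real DIM('a) - s)) * d powr (real DIM('a) - s))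
        * maximal g x"
proof -
  let ?n = "real DIM('a)" and ?V = "vol1 TYPE('a)"
  have AE: "AE y in lebesgue. y \<noteq> x" by (rule AE_completion, rule AE_lborel_singleton)
  have "(\<integral>\<^sup>+ y. g y * ennreal (norm (x - y) powr - s) * indicator (ball x d) y \<partial>lebesgue)
    \<le> (\<integral>\<^sup>+ y. (\<Sum>j. ennreal ((d / 2^(j+1)) powr - s) * (g y * indicator (ball x (d / 2^j)) y)) \<partial>lebesgue)"
  proof (rule nn_integral_mono_AE, use AE in eventually_elim)
    fix y assume "y \<noteq> x"
    show "g y * ennreal (norm (x - y) powr - s) * indicator (ball x d) y
      \<le> (\<Sum>j. ennreal ((d / 2^(j+1)) powr - s) * (g y * indicator (ball x (d / 2^j)) y))"
    proof (cases "y \<in> ball x d")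
      case True
      then have "norm (x - y) < d" "x - y \<noteq> 0" using \<open>y \<noteq> x\<close> by (auto simp: dist_norm)
      from kernel_near_le[OF this(2,1) s(1)]
      have "g y * ennreal (norm (x - y) powr - s)
        \<le> g y * (\<Sum>j. ennreal ((d / 2^(j+1)) powr - s) * indicator (ball 0 (d / 2^j)) (x - y))"
        by (rule mult_left_mono) simp
      also have "\<dots> = (\<Sum>j. ennreal ((d / 2^(j+1)) powr - s) * (g y * indicator (ball x (d / 2^j)) y))"
        by (subst ennreal_suminf_cmult[symmetric], rule suminf_cong)
           (simp add: indicator_ball_diff mult_ac)
      finally show ?thesis using True by simp
    qed simp
  qed
  also have "\<dots> = (\<Sum>j. ennreal ((d / 2^(j+1)) powr - s) * ball_int g x (d / 2^j))"
    unfolding ball_int_def by (subst nn_integral_suminf) (auto simp: nn_integral_cmult)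
  also have "\<dots> \<le> (\<Sum>j. (ennreal (?V * 2 powr s * d powr (?n - s)) * maximal g x) * ennreal ((2^j) powr - (?n - s)))"
  proof (intro suminf_le summableI)
    fix j :: nat
    have d: "0 < d / 2^j" using assms by simp
    have "ennreal ((d / 2^(j+1)) powr - s) * ball_int g x (d / 2^j)
      \<le> ennreal ((d / 2^(j+1)) powr - s) * (ennreal (?V * (d / 2^j) powr ?n) * maximal g x)"
      by (intro mult_left_mono ball_int_le_maximal d) simp
    also have "\<dots> = ennreal ((d / 2^(j+1)) powr - s * (?V * (d / 2^j) powr ?n)) * maximal g x"
      by (subst ennreal_mult') (simp_all only: mult.assoc powr_ge_zero)
    also have "(d / 2^(j+1)) powr - s * (?V * (d / 2^j) powr ?n) = ?V * 2 powr s * d powr (?n - s) * (2^j) powr - (?n - s)"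
    proof -
      have "(z / 2) powr - s = z powr - s * 2 powr s" for z :: real
        by (simp add: powr_divide powr_minus divide_simps)
      from this[of "d / 2^j"] have "(d / 2^(j+1)) powr - s = (d / 2^j) powr - s * 2 powr s"
        by (simp add: mult.commute)
      moreover have "(d / 2^j) powr - s * (d / 2^j) powr ?n = d powr (?n - s) * (2^j) powr - (?n - s)"
      proof -
        have "(d / 2^j) powr - s * (d / 2^j) powr ?n = (d / 2^j) powr (?n - s)"
          by (simp only: powr_add[symmetric]) simp
        also have "\<dots> = d powr (?n - s) * (2^j) powr - (?n - s)"
          unfolding powr_divide powr_minus_divide[of _ "?n - s"] by simp
        finally show ?thesis .
      qed
      ultimately show ?thesis by (simp add: mult_ac)
    qed
    finally show "ennreal ((d / 2^(j+1)) powr - s) * ball_int g x (d / 2^j)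
      \<le> (ennreal (?V * 2 powr s * d powr (?n - s)) * maximal g x) * ennreal ((2^j) powr - (?n - s))"
      by (subst (asm) ennreal_mult'') (auto simp: mult_ac)
  qed
  also have "\<dots> = (ennreal (?V * 2 powr s * d powr (?n - s)) * maximal g x) * ennreal (1 / (1 - 2 powr - (?n - s)))"
    using s by (subst ennreal_suminf_cmult, subst suminf_geometric_powr) auto
  also have "\<dots> = (ennreal (?V * 2 powr s * d powr (?n - s)) * ennreal (1 / (1 - 2 powr - (?n - s)))) * maximal g x"
    by (simp only: mult_ac)
  also have "ennreal (?V * 2 powr s * d powr (?n - s)) * ennreal (1 / (1 - 2 powr - (?n - s)))
    = ennreal (?V * 2 powr s / (1 - 2 powr - (?n - s)) * d powr (?n - s))"
    by (subst ennreal_mult'[symmetric]) auto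
  finally show ?thesis .
qed

lemma riesz_split:
  fixes x :: "'a::euclidean_space"
  assumes [measurable]: "g \<in> borel_measurable lebesgue" and "0 < d" and \<gamma>: "0 < \<gamma>" "\<gamma> < real DIM('a)"
  shows "riesz \<gamma> g x \<le> ennreal (vol1 TYPE('a) * 2 powr (real DIM('a) - \<gamma>) / (1 - 2 powr - \<gamma>) * d powr \<gamma>) * maximal g x
     + (\<Sum>j. ennreal ((2^j * d) powr - (real DIM('a) - \<gamma>)) * ball_int g x (2^(j+1) * d))"
proof -
  let ?n = "real DIM('a)"
  let ?k = "\<lambda>y. g y * ennreal (norm (x - y) powr - (?n - \<gamma>))"
  have "riesz \<gamma> g x = (\<integral>\<^sup>+ y. ?k y * indicator (ball x d) y + ?k y * indicator (- ball x d) y \<partial>lebesgue)"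
    unfolding riesz_def by (intro nn_integral_cong) (auto simp: indicator_def)
  also have "\<dots> = (\<integral>\<^sup>+ y. ?k y * indicator (ball x d) y \<partial>lebesgue) + (\<integral>\<^sup>+ y. ?k y * indicator (- ball x d) y \<partial>lebesgue)"
    by (intro nn_integral_add) auto
  also have "\<dots> \<le> ennreal (vol1 TYPE('a) * 2 powr (?n - \<gamma>) / (1 - 2 powr - \<gamma>) * d powr \<gamma>) * maximal g x
     + (\<Sum>j. ennreal ((2^j * d) powr - (?n - \<gamma>)) * ball_int g x (2^(j+1) * d))"
    using riesz_near_le[of g d "?n - \<gamma>" x] assms by (intro add_mono riesz_far_le) auto
  finally show ?thesis .
qed

text \<open>The growth hypothesis on the averages is only needed for the radius \<open>\<delta>\<close> that balances the near part
  \<open>\<delta> powr \<gamma> * maximal g x\<close> against the far part \<open>\<delta> powr - e\<close>.\<close>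

lemma hedberg:
  assumes \<gamma>: "0 < \<gamma>" "\<gamma> < real DIM('a::euclidean_space)" and \<theta>: "0 < \<theta>" and B: "0 \<le> B"
  shows "\<exists>C\<ge>1. \<forall>(g :: 'a \<Rightarrow> ennreal) x e. g \<in> borel_measurable lebesgue \<longrightarrow> 0 < e \<longrightarrow>
    (\<forall>\<delta>>0. maximal g x = ennreal (\<delta> powr - (\<gamma> + e)) \<longrightarrow>
       (\<forall>j::nat. ball_int g x (2^(j+1) * \<delta>)
          \<le> ennreal (B * (2^(j+1) * \<delta>) powr (real DIM('a) - \<gamma>) * (\<delta> powr - e * (2^j) powr - \<theta>)))) \<longrightarrow>
    riesz \<gamma> g x \<le> ennreal C * enn_powr (maximal g x) (e / (\<gamma> + e))"
proof -
  let ?n = "real DIM('a)"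
  define C1 where "C1 = vol1 TYPE('a) * 2 powr (?n - \<gamma>) / (1 - 2 powr - \<gamma>)"
  define C2 where "C2 = B * 2 powr (?n - \<gamma>) * (1 / (1 - 2 powr - \<theta>))"
  have lt1: "2 powr - z < 1" if "0 < z" for z :: real
    using powr_less_mono[of "-z" 0 2] that by simp
  have C: "0 \<le> C1" "0 \<le> C2" using lt1 \<gamma> \<theta> B by (auto simp: C1_def C2_def less_imp_le)
  show ?thesis
  proof (intro exI[of _ "1 + C1 + C2"] conjI allI impI)
    show "1 \<le> 1 + C1 + C2" using C by simp
    fix g :: "'a \<Rightarrow> ennreal" and x e
    assume g [measurable]: "g \<in> borel_measurable lebesgue" and e: "0 < e"
      and hyp: "\<forall>\<delta>>0. maximal g x = ennreal (\<delta> powr - (\<gamma> + e)) \<longrightarrow>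
       (\<forall>j::nat. ball_int g x (2^(j+1) * \<delta>)
          \<le> ennreal (B * (2^(j+1) * \<delta>) powr (?n - \<gamma>) * (\<delta> powr - e * (2^j) powr - \<theta>)))"
    show "riesz \<gamma> g x \<le> ennreal (1 + C1 + C2) * enn_powr (maximal g x) (e / (\<gamma> + e))"
    proof (cases "maximal g x")
      case top
      then show ?thesis using C by (simp add: ennreal_mult_top)
    next
      case (real m)
      show ?thesis
      proof (cases "m = 0")
        case True
        have "ball_int g x R = 0" if "0 < R" for R
          using ball_int_le_maximal[OF that, of g x] real True by simp
        then have "riesz \<gamma> g x \<le> 0"
          using riesz_split[OF g zero_less_one \<gamma>, of x] real True by simp
        then show ?thesis by simp
      next
        case False
        with real have m: "0 < m" by simp
        define \<delta> where "\<delta> = m powr (- 1 / (\<gamma> + e))"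
        have \<delta>: "0 < \<delta>" using m by (simp add: \<delta>_def)
        have "- 1 / (\<gamma> + e) * - (\<gamma> + e) = 1" using e \<gamma> by (simp add: divide_simps)
        then have "\<delta> powr - (\<gamma> + e) = m" using m unfolding \<delta>_def powr_powr by simp
        with hyp \<delta> real have bi: "ball_int g x (2^(j+1) * \<delta>)
          \<le> ennreal (B * (2^(j+1) * \<delta>) powr (?n - \<gamma>) * (\<delta> powr - e * (2^j) powr - \<theta>))" for j :: nat
          by simp
        define E where "E = m powr (e / (\<gamma> + e))"
        have E1: "\<delta> powr - e = E" using e \<gamma> by (simp add: \<delta>_def E_def powr_powr)
        have E2: "\<delta> powr \<gamma> * m = E"
        proof -
          have "\<delta> powr \<gamma> * m = m powr (- \<gamma> / (\<gamma> + e)) * m powr 1" using m by (simp add: \<delta>_def powr_powr)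
          also have "\<dots> = m powr (- \<gamma> / (\<gamma> + e) + 1)" by (rule powr_add[symmetric])
          also have "- \<gamma> / (\<gamma> + e) + 1 = e / (\<gamma> + e)" using e \<gamma> by (simp add: divide_simps)
          finally show ?thesis by (simp add: E_def)
        qed
        have "riesz \<gamma> g x \<le> ennreal (C1 * \<delta> powr \<gamma>) * ennreal m
           + (\<Sum>j. ennreal ((2^j * \<delta>) powr - (?n - \<gamma>)) * ball_int g x (2^(j+1) * \<delta>))"
          using riesz_split[OF g \<delta> \<gamma>, of x] real by (simp add: C1_def)
        also have "ennreal (C1 * \<delta> powr \<gamma>) * ennreal m = ennreal (C1 * E)"
          using m C E2 by (simp add: mult.assoc flip: ennreal_mult'')
        also have "(\<Sum>j. ennreal ((2^j * \<delta>) powr - (?n - \<gamma>)) * ball_int g x (2^(j+1) * \<delta>))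
          \<le> (\<Sum>j. ennreal (B * 2 powr (?n - \<gamma>) * E) * ennreal ((2^j) powr - \<theta>))"
        proof (intro suminf_le summableI)
          fix j :: nat
          have "ennreal ((2^j * \<delta>) powr - (?n - \<gamma>)) * ball_int g x (2^(j+1) * \<delta>)
            \<le> ennreal ((2^j * \<delta>) powr - (?n - \<gamma>)) *
               ennreal (B * (2^(j+1) * \<delta>) powr (?n - \<gamma>) * (\<delta> powr - e * (2^j) powr - \<theta>))"
            by (intro mult_left_mono bi) simp
          also have "\<dots> = ennreal ((2^j * \<delta>) powr - (?n - \<gamma>) *
               (B * (2^(j+1) * \<delta>) powr (?n - \<gamma>) * (\<delta> powr - e * (2^j) powr - \<theta>)))"
            by (rule ennreal_mult'[symmetric]) simp
          also have "(2^j * \<delta>) powr - (?n - \<gamma>) *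
               (B * (2^(j+1) * \<delta>) powr (?n - \<gamma>) * (\<delta> powr - e * (2^j) powr - \<theta>))
             = B * 2 powr (?n - \<gamma>) * E * (2^j) powr - \<theta>"
          proof -
            have "(2^(j+1) * \<delta>) powr (?n - \<gamma>) = 2 powr (?n - \<gamma>) * (2^j * \<delta>) powr (?n - \<gamma>)"
              using \<delta> by (simp add: powr_mult mult.assoc)
            moreover have "(2^j * \<delta>) powr - (?n - \<gamma>) * (2^j * \<delta>) powr (?n - \<gamma>) = 1"
              using \<delta> by (simp only: powr_add[symmetric]) simp
            ultimately show ?thesis unfolding E1 by (simp add: mult_ac)
          qed
          also have "ennreal (B * 2 powr (?n - \<gamma>) * E * (2^j) powr - \<theta>)
             = ennreal (B * 2 powr (?n - \<gamma>) * E) * ennreal ((2^j) powr - \<theta>)"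
            by (rule ennreal_mult'') simp
          finally show "ennreal ((2^j * \<delta>) powr - (?n - \<gamma>)) * ball_int g x (2^(j+1) * \<delta>)
            \<le> ennreal (B * 2 powr (?n - \<gamma>) * E) * ennreal ((2^j) powr - \<theta>)" .
        qed
        also have "\<dots> = ennreal (C2 * E)"
        proof -
          have "ennreal (C2 * E) = ennreal ((B * 2 powr (?n - \<gamma>) * E) * (1 / (1 - 2 powr - \<theta>)))"
            by (simp add: C2_def)
          also have "\<dots> = ennreal (B * 2 powr (?n - \<gamma>) * E) * ennreal (1 / (1 - 2 powr - \<theta>))"
            using lt1[OF \<theta>] by (intro ennreal_mult'') simp
          finally show ?thesis
            using \<theta> by (subst ennreal_suminf_cmult, subst suminf_geometric_powr) auto
        qed
        also have "ennreal (C1 * E) + ennreal (C2 * E) = ennreal ((C1 + C2) * E)"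
          using C by (simp add: E_def distrib_right)
        also have "\<dots> \<le> ennreal ((1 + C1 + C2) * E)"
          by (intro ennreal_leI mult_right_mono) (auto simp: E_def)
        also have "\<dots> = ennreal (1 + C1 + C2) * enn_powr (maximal g x) (e / (\<gamma> + e))"
          unfolding real(2) enn_powr_ennreal[OF real(1)] E_def using C by (intro ennreal_mult') simp
        finally show ?thesis by (simp add: add_mono)
      qed
    qed
  qed
qed

section \<open>Variable-exponent Hardy--Littlewood--Sobolev inequality\<close>

lemma vol1_nonzero [simp]: "vol1 TYPE('a::euclidean_space) \<noteq> 0"
  using vol1_pos[where 'a='a] by linarith

lemma maximal_le_1:
  fixes x :: "'a::euclidean_space"
  assumes "\<And>y. g y \<le> 1"
  shows "maximal g x \<le> 1"
  unfolding maximal_def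
proof (intro SUP_least)
  fix R :: real assume "R \<in> {0<..}"
  then have R: "0 < R" by simp
  let ?c = "vol1 TYPE('a) * R powr real DIM('a)"
  have c: "0 < ?c" using R by simp
  have "ball_int g x R \<le> (\<integral>\<^sup>+ y. indicator (ball x R) y \<partial>lebesgue)"
    unfolding ball_int_def using assms by (intro nn_integral_mono) (auto simp: indicator_def)
  also have "\<dots> = ennreal ?c" using R by (intro nn_integral_indicator_ball) simp
  finally have "ball_int g x R / ennreal ?c \<le> ennreal ?c / ennreal ?c"
    by (rule divide_right_mono_ennreal)
  also have "\<dots> = 1" using R by (simp add: divide_ennreal)
  finally show "ball_int g x R / ennreal ?c \<le> 1" .
qed

context log_exponent
begin

text \<open>A variable-exponent substitute for Jensen's inequality. It moves the exponent
  \<open>s x\<close> inside the maximal function as \<open>s y / a\<close> and leaves the constant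
  exponent \<open>a > 1\<close> outside, where \<open>maximal_strong_type\<close> applies.\<close>

lemma maximal_powr_le:
  "\<exists>C\<ge>1. \<forall>(g :: 'a \<Rightarrow> real) x. g \<in> borel_measurable lebesgue \<longrightarrow> (\<forall>y. g y = 0 \<or> 1 \<le> g y) \<longrightarrow>
     (\<integral>\<^sup>+ y. ennreal (g y powr s y) \<partial>lebesgue) \<le> 1 \<longrightarrow> 1 < maximal (\<lambda>y. ennreal (g y)) x \<longrightarrow>
     enn_powr (maximal (\<lambda>y. ennreal (g y)) x) (s x)
      \<le> ennreal C * enn_powr (maximal (\<lambda>y. ennreal (g y powr (s y / a))) x) a"
proof -
  let ?n = "real DIM('a)" and ?V = "vol1 TYPE('a)"
  \<comment> \<open>\<open>C0\<close> bounds the oscillating powers of the average \<open>Q\<close>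
    below: \<open>Q\<close> is at most the inverse volume of the ball, the volume constant is raised
    to a power between \<open>- P\<close> and 0, and the power of the radius is controlled by
    \<open>powr_osc\<close>.\<close>
  define C0 where "C0 = max 1 (?V powr - P) * exp (?n * P * K)"
  have C0: "0 < C0" by (simp add: C0_def)
  show ?thesis
  proof (intro exI[of _ "(1 + C0) powr P"] conjI allI impI)
    show "1 \<le> (1 + C0) powr P" using C0 P_gt1 by (intro ge_one_powr_ge_zero) auto
    fix g :: "'a \<Rightarrow> real" and x
    assume g [measurable]: "g \<in> borel_measurable lebesgue" and g01: "\<forall>y. g y = 0 \<or> 1 \<le> g y"
      and mod: "(\<integral>\<^sup>+ y. ennreal (g y powr s y) \<partial>lebesgue) \<le> 1"
      and gt: "1 < maximal (\<lambda>y. ennreal (g y)) x"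
    define h where "h = (\<lambda>y. g y powr (s y / a))"
    have [measurable]: "h \<in> borel_measurable lebesgue" unfolding h_def by measurable
    have h_ge: "g y \<le> h y" and h_le: "h y \<le> g y powr s y" for y
    proof -
      have e: "1 \<le> s y / a" "s y / a \<le> s y" using gt1 lower[of y] s_pos[of y] by (auto simp: divide_le_eq mult_le_cancel_left1)
      show "g y \<le> h y" using g01[rule_format, of y] powr_mono[OF e(1), of "g y"] by (auto simp: h_def)
      show "h y \<le> g y powr s y" using g01[rule_format, of y] powr_mono[OF e(2), of "g y"] by (auto simp: h_def)
    qed
    define H where "H = maximal (\<lambda>y. ennreal (h y)) x"
    have main: "ball_int (\<lambda>y. ennreal (g y)) x R / ennreal (?V * R powr ?n)
       \<le> max 1 (ennreal (1 + C0) * enn_powr H (a / s x))" if R: "0 < R" for R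
    proof (cases "ball_int (\<lambda>y. ennreal (g y)) x R / ennreal (?V * R powr ?n) \<le> 1")
      case False
      let ?c = "?V * R powr ?n"
      have c: "0 < ?c" using R by simp
      have bh: "ball_int (\<lambda>y. ennreal (h y)) x R \<le> 1"
        using mod nn_integral_mono[of lebesgue "\<lambda>y. ennreal (h y)" "\<lambda>y. ennreal (g y powr s y)"] h_le
          ball_int_le[of "\<lambda>y. ennreal (h y)" x R] by (auto intro: order_trans ennreal_leI)
      then obtain b where b: "ball_int (\<lambda>y. ennreal (h y)) x R = ennreal b" "0 \<le> b" "b \<le> 1"
        by (cases "ball_int (\<lambda>y. ennreal (h y)) x R") (auto simp: top_unique)
      define Q where "Q = b / ?c"
      have bQ: "b = ?c * Q" using R by (simp add: Q_def)
      have "ball_int (\<lambda>y. ennreal (g y)) x R \<le> ball_int (\<lambda>y. ennreal (h y)) x R"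
        unfolding ball_int_def using h_ge by (intro nn_integral_mono mult_right_mono ennreal_leI) auto
      then have "ball_int (\<lambda>y. ennreal (g y)) x R / ennreal ?c \<le> ennreal Q"
        unfolding b(1) Q_def using c b by (metis divide_ennreal divide_right_mono_ennreal)
      then have Q1: "1 < Q" using False by (smt (verit) ennreal_leI ennreal_1 order_trans)
      have Qle: "Q \<le> 1 / ?c" using b c by (simp add: Q_def divide_right_mono)
      \<comment> \<open>Splitting at height \<open>\<kappa>\<close> bounds \<open>g\<close> by \<open>\<kappa> + h * \<kappa> powr (1 - s / a)\<close>; here \<open>1 < Q\<close> forces the
        ball to be small, so the oscillation of \<open>s\<close> on it costs only a constant.\<close>
      define \<kappa> where "\<kappa> = Q powr (a / s x)"
      have \<kappa>: "0 < \<kappa>" using Q1 by (simp add: \<kappa>_def)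
      have Qpow: "Q powr e \<le> C0" if y: "y \<in> ball x R" and e: "\<bar>e\<bar> \<le> P * \<bar>1 / s x - 1 / s y\<bar>" for e y
      proof -
        have u: "0 < 1 / s z" "1 / s z < 1" for z using s_gt1[of z] s_pos[of z] by (auto simp: divide_less_eq)
        have "\<bar>1 / s x - 1 / s y\<bar> \<le> 1" using u[of x] u[of y] by linarith
        then have eP: "\<bar>e\<bar> \<le> P" using e P_gt1 by (smt (verit) mult_left_le)
        have "Q powr e \<le> Q powr \<bar>e\<bar>" using Q1 by (intro powr_mono) auto
        also have "\<dots> \<le> (1 / ?c) powr \<bar>e\<bar>" using Q1 Qle by (intro powr_mono2) auto
        also have "\<dots> = ?V powr - \<bar>e\<bar> * R powr (- ?n * \<bar>e\<bar>)"
          using R by (simp add: powr_divide powr_mult powr_powr powr_minus_divide divide_simps powr_minus)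
        also have "\<dots> \<le> max 1 (?V powr - P) * exp (?n * P * K)"
        proof (rule mult_mono)
          show "?V powr - \<bar>e\<bar> \<le> max 1 (?V powr - P)"
          proof (cases "?V \<le> 1")
            case True
            have "?V powr - \<bar>e\<bar> \<le> ?V powr - P" using eP True by (intro powr_mono') auto
            then show ?thesis by simp
          next
            case False
            have "?V powr - \<bar>e\<bar> \<le> ?V powr 0" using False by (intro powr_mono) auto
            then show ?thesis by simp
          qed
          show "R powr (- ?n * \<bar>e\<bar>) \<le> exp (?n * P * K)"
          proof (cases "R \<le> 1")
            case True
            then show ?thesis using R y e P_gt1
              by (intro powr_osc[of R x y]) (auto simp: near_def abs_mult intro: mult_left_mono)
          next
            case False
            have "0 \<le> K" using decay[of 0] by (simp add: order_trans[OF abs_ge_zero])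
            have "R powr (- ?n * \<bar>e\<bar>) \<le> R powr 0" using False by (intro powr_mono) auto
            also have "\<dots> \<le> exp (?n * P * K)" using False \<open>0 \<le> K\<close> P_gt1 by simp
            finally show ?thesis .
          qed
        qed auto
        finally show ?thesis by (simp add: C0_def)
      qed
      have pw: "g y \<le> \<kappa> + h y * (C0 * (\<kappa> / Q))" if y: "y \<in> ball x R" for y
      proof (cases "g y \<le> \<kappa>")
        case True
        then show ?thesis using \<kappa> C0 Q1 by (smt (verit) divide_nonneg_nonneg h_def mult_nonneg_nonneg powr_ge_zero)
      next
        case False
        then have gy: "0 < g y" using \<kappa> by linarith
        have "g y = h y * g y powr (1 - s y / a)" using gy by (simp add: h_def powr_diff)
        also have "\<dots> \<le> h y * \<kappa> powr (1 - s y / a)"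
          using False \<kappa> gt1 lower[of y] by (intro mult_left_mono powr_mono2') (auto simp: h_def divide_simps)
        \<comment> \<open>With \<open>s x\<close> in place of \<open>s y\<close> the left side would
          be exactly \<open>\<kappa> / Q\<close>; the remaining power of \<open>Q\<close> measures
          the oscillation of the exponent.\<close>
        also have "\<kappa> powr (1 - s y / a) = \<kappa> / Q * Q powr ((s x - s y) / s x)"
        proof -
          have "\<kappa> powr (1 - s y / a) = Q powr (a / s x + (- 1) + (s x - s y) / s x)"
            unfolding \<kappa>_def powr_powr using gt1 s_pos[of x] by (intro arg_cong[where f="(powr) Q"]) (simp add: divide_simps algebra_simps)
          also have "\<dots> = \<kappa> / Q * Q powr ((s x - s y) / s x)"
            using Q1 unfolding powr_add by (simp add: \<kappa>_def powr_minus divide_simps)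
          finally show ?thesis .
        qed
        also have "h y * (\<kappa> / Q * Q powr ((s x - s y) / s x)) \<le> h y * (\<kappa> / Q * C0)"
        proof (intro mult_left_mono Qpow[OF y])
          have "(s x - s y) / s x = s y * (1 / s y - 1 / s x)" using s_pos[of x] s_pos[of y] by (simp add: divide_simps)
          then show "\<bar>(s x - s y) / s x\<bar> \<le> P * \<bar>1 / s x - 1 / s y\<bar>"
            using upper[of y] s_pos[of y] by (auto simp: abs_mult abs_minus_commute intro: mult_right_mono)
        qed (use \<kappa> Q1 in \<open>auto simp: h_def\<close>)
        finally show ?thesis using \<kappa> by (simp add: mult_ac)
      qed
      have "ball_int (\<lambda>y. ennreal (g y)) x R
        \<le> (\<integral>\<^sup>+ y. ennreal \<kappa> * indicator (ball x R) y + ennreal (C0 * (\<kappa> / Q)) * (ennreal (h y) * indicator (ball x R) y) \<partial>lebesgue)"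
        unfolding ball_int_def
      proof (intro nn_integral_mono)
        fix y
        show "ennreal (g y) * indicator (ball x R) y \<le>
          ennreal \<kappa> * indicator (ball x R) y + ennreal (C0 * (\<kappa> / Q)) * (ennreal (h y) * indicator (ball x R) y)"
        proof (cases "y \<in> ball x R")
          case True
          have "ennreal (g y) \<le> ennreal (\<kappa> + C0 * (\<kappa> / Q) * h y)"
            using pw[OF True] by (intro ennreal_leI) (simp add: mult_ac)
          also have "\<dots> = ennreal \<kappa> + ennreal (C0 * (\<kappa> / Q)) * ennreal (h y)"
          proof -
            have "0 \<le> h y" by (simp add: h_def)
            moreover have "0 \<le> C0 * (\<kappa> / Q)" using \<kappa> C0 Q1 by simp
            ultimately show ?thesis using \<kappa> by (subst ennreal_plus) (auto simp only: ennreal_mult mult_nonneg_nonneg less_imp_le)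
          qed
          finally show ?thesis using True by simp
        qed simp
      qed
      also have "\<dots> = ennreal \<kappa> * ennreal ?c + ennreal (C0 * (\<kappa> / Q)) * ball_int (\<lambda>y. ennreal (h y)) x R"
        unfolding ball_int_def using R
        by (subst nn_integral_add) (auto simp: nn_integral_cmult nn_integral_indicator_ball simp del: nn_integral_indicator)
      also have "\<dots> = ennreal (\<kappa> * ?c + C0 * (\<kappa> / Q) * b)"
      proof -
        have "0 \<le> C0 * (\<kappa> / Q)" "0 \<le> \<kappa> * ?c" "0 \<le> C0 * (\<kappa> / Q) * b" using \<kappa> c C0 Q1 b by simp_all
        then show ?thesis unfolding b(1) using \<kappa> c b by (simp only: ennreal_plus ennreal_mult less_imp_le)
      qed
      also have "\<kappa> * ?c + C0 * (\<kappa> / Q) * b = ?c * ((1 + C0) * \<kappa>)"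
        unfolding bQ using Q1 by (simp add: field_simps)
      finally have "ball_int (\<lambda>y. ennreal (g y)) x R / ennreal ?c \<le> ennreal (?c * ((1 + C0) * \<kappa>)) / ennreal ?c"
        by (rule divide_right_mono_ennreal)
      also have "\<dots> = ennreal ((1 + C0) * \<kappa>)"
        using c C0 \<kappa> by (subst divide_ennreal) auto
      also have "\<dots> = ennreal (1 + C0) * enn_powr (ennreal Q) (a / s x)"
        using Q1 C0 by (simp add: enn_powr_ennreal \<kappa>_def ennreal_mult'')
      also have "\<dots> \<le> ennreal (1 + C0) * enn_powr H (a / s x)"
      proof (intro mult_left_mono enn_powr_mono)
        have "ennreal Q = ball_int (\<lambda>y. ennreal (h y)) x R / ennreal ?c"
          unfolding b(1) Q_def using c b by (simp add: divide_ennreal)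
        also have "\<dots> \<le> H" unfolding H_def maximal_def using R by (intro SUP_upper) auto
        finally show "ennreal Q \<le> H" .
      qed (use gt1 s_pos[of x] in auto)
      finally show ?thesis by (rule max.coboundedI2)
    qed (rule max.coboundedI1)
    have "maximal (\<lambda>y. ennreal (g y)) x \<le> max 1 (ennreal (1 + C0) * enn_powr H (a / s x))"
      unfolding maximal_def[of "\<lambda>y. ennreal (g y)"] by (intro SUP_least main) auto
    with gt have "maximal (\<lambda>y. ennreal (g y)) x \<le> ennreal (1 + C0) * enn_powr H (a / s x)"
      by (auto simp: le_max_iff_disj)
    then have "enn_powr (maximal (\<lambda>y. ennreal (g y)) x) (s x) \<le> enn_powr (ennreal (1 + C0) * enn_powr H (a / s x)) (s x)"
      using s_pos[of x] by (intro enn_powr_mono) auto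
    also have "\<dots> = ennreal ((1 + C0) powr s x) * enn_powr H a"
      using C0 s_pos[of x] by (simp add: enn_powr_mult enn_powr_powr enn_powr_ennreal del: ennreal_plus)
    also have "\<dots> \<le> ennreal ((1 + C0) powr P) * enn_powr H a"
      using C0 upper by (intro mult_right_mono ennreal_leI powr_mono) auto
    finally show "enn_powr (maximal (\<lambda>y. ennreal (g y)) x) (s x)
      \<le> ennreal ((1 + C0) powr P) * enn_powr (maximal (\<lambda>y. ennreal (g y powr (s y / a))) x) a"
      by (simp add: H_def h_def)
  qed
qed

end

locale sobolev_pair =
  p1: log_exponent p1 p10 a P K + p2: log_exponent p2 p20 a P K
  for p1 p2 :: "'a::euclidean_space \<Rightarrow> real" and p10 p20 a P K :: real +
  fixes \<gamma> :: real
  assumes \<gamma>_pos: "0 < \<gamma>"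
    and sobolev: "\<And>x. real DIM('a) / p1 x - real DIM('a) / p2 x = \<gamma>"
    and sobolev_inf: "real DIM('a) / p10 - real DIM('a) / p20 = \<gamma>"
begin

lemma \<gamma>_less: "\<gamma> < real DIM('a)"
proof -
  have "real DIM('a) / p1 0 < real DIM('a)" using p1.s_gt1[of 0] by (simp add: divide_less_eq)
  moreover have "0 < real DIM('a) / p2 0" using p2.s_pos[of 0] by simp
  ultimately show ?thesis using sobolev[of 0] by linarith
qed

lemma Phi_sobolev:
  assumes "0 < R"
  shows "Phi p1 p10 x R = R powr \<gamma> * Phi p2 p20 x R"
  using assms sobolev[of x] sobolev_inf unfolding Phi_def by (auto simp: powr_add[symmetric] algebra_simps)

lemma ball_int_le_Phi2:
  "\<exists>A\<ge>1. \<forall>g x R. g \<in> borel_measurable lebesgue \<longrightarrow> (\<forall>y. 0 \<le> g y) \<longrightarrow> 0 < R \<longrightarrow>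
     ball_int (\<lambda>y. ennreal (g y powr p1 y)) x R \<le> 1 \<longrightarrow>
     ball_int (\<lambda>y. ennreal (g y)) x R \<le> ennreal (A * (R powr (real DIM('a) - \<gamma>) / Phi p2 p20 x R))"
  using p1.ball_int_le_Phi by (simp add: Phi_sobolev powr_diff)

text \<open>Supplies the growth hypothesis of \<open>hedberg\<close>. The starting radius keeps the
  exact power \<open>n / p2 x\<close>, which fixes the Hedberg exponent at \<open>x\<close>; the
  gain in \<open>j\<close> only needs some rate uniform in \<open>x\<close>, and
  \<open>n / P\<close> survives when the ball leaves the near regime.\<close>

lemma inverse_Phi_le:
  assumes "0 < \<delta>" "\<delta> \<le> 1"
  shows "1 / Phi p2 p20 x (2^(j+1) * \<delta>) \<le> \<delta> powr - (real DIM('a) / p2 x) * (2^j) powr - (real DIM('a) / P)"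
proof -
  let ?n = "real DIM('a)" and ?R = "2^(j+1) * \<delta>"
  have R: "0 < ?R" using assms by simp
  have P: "?n / P \<le> ?n / p2 x" using p2.upper[of x] p2.s_pos[of x] by (intro divide_left_mono) auto
  have split: "?R powr - e = \<delta> powr - e * (2^(j+1)) powr - e" for e
    using assms by (subst powr_mult) (auto simp: mult.commute simp del: power_Suc)
  have two: "(2^(j+1) :: real) powr - (?n / P) \<le> (2^j) powr - (?n / P)"
    using p2.P_gt1 by (intro powr_mono2') auto
  show ?thesis
  proof (cases "near x ?R")
    case True
    have "1 / Phi p2 p20 x ?R = \<delta> powr - (?n / p2 x) * (2^(j+1)) powr - (?n / p2 x)"
      using True unfolding split[symmetric] by (simp add: Phi_def powr_minus_divide)
    also have "\<dots> \<le> \<delta> powr - (?n / p2 x) * (2^(j+1)) powr - (?n / P)"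
      using P by (intro mult_left_mono powr_mono one_le_power) auto
    also have "\<dots> \<le> \<delta> powr - (?n / p2 x) * (2^j) powr - (?n / P)"
      by (intro mult_left_mono two) simp
    finally show ?thesis .
  next
    case False
    then have R1: "1 \<le> ?R" by (auto simp: near_def)
    have "?n / P \<le> ?n / p20" using p2.upper_inf p2.inf_gt1 by (intro divide_left_mono) auto
    then have "1 / Phi p2 p20 x ?R \<le> ?R powr - (?n / P)"
      using False R1 by (simp add: Phi_def powr_minus_divide[symmetric] powr_mono del: power_Suc)
    also have "\<dots> \<le> \<delta> powr - (?n / p2 x) * (2^j) powr - (?n / P)"
      unfolding split using assms P by (intro mult_mono two powr_mono') auto
    finally show ?thesis .
  qed
qed

end

lemma borel_measurable_riesz [measurable]:
  fixes g :: "'a::euclidean_space \<Rightarrow> ennreal"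
  assumes [measurable]: "g \<in> borel_measurable lebesgue"
  shows "riesz \<gamma> g \<in> borel_measurable lebesgue"
proof -
  have "(\<lambda>x. riesz \<gamma> g x) = (\<lambda>x. \<integral>\<^sup>+ y. g y * ennreal (dist (fst (x, y)) (snd (x, y)) powr - (real DIM('a) - \<gamma>)) \<partial>lebesgue)"
    by (simp add: riesz_def dist_norm)
  also have "\<dots> \<in> borel_measurable lebesgue"
  proof (rule sigma_finite_measure.borel_measurable_nn_integral[OF sigma_finite_lebesgue])
    show "(\<lambda>(x, y). g y * ennreal (dist (fst (x, y)) (snd (x, y)) powr - (real DIM('a) - \<gamma>)))
      \<in> borel_measurable (lebesgue \<Otimes>\<^sub>M lebesgue)"
      unfolding case_prod_beta prod.collapse by measurable
  qed
  finally show ?thesis .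
qed

section \<open>The Sobolev inequality in modular form\<close>

context sobolev_pair
begin

lemma decay_integral:
  obtains T where "0 \<le> T"
    "(\<integral>\<^sup>+ (y::'a). ennreal ((exp 1 + norm y) powr - (real DIM('a) * a)) \<partial>lebesgue) = ennreal T"
  using nn_integral_norm_decay_finite[where 'a='a, OF p1.gt1]
  by (cases "\<integral>\<^sup>+ (y::'a). ennreal ((exp 1 + norm y) powr - (real DIM('a) * a)) \<partial>lebesgue") auto

lemma maximal_strong_type_ex:
  assumes "1 < s"
  obtains CM where "0 \<le> CM" "\<And>g :: 'a \<Rightarrow> ennreal. g \<in> borel_measurable lebesgue \<Longrightarrow>
    (\<integral>\<^sup>+ x. enn_powr (maximal g x) s \<partial>lebesgue) \<le> ennreal CM * (\<integral>\<^sup>+ x. enn_powr (g x) s \<partial>lebesgue)"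
proof (rule that)
  have "2 powr - (s - 1) < 1" using powr_less_mono[of "-(s-1)" 0 2] assms by simp
  then show "0 \<le> 2 powr s * (2 * 5 powr real DIM('a)) * (2 powr (s - 1) / (1 - 2 powr - (s - 1)))" by simp
qed (rule maximal_strong_type[OF _ assms])

text \<open>For functions bounded by 1 the exponent \<open>p1\<close> may be replaced by its limit
  \<open>p10\<close> up to an integrable error, and the classical argument runs with the constant
  exponents \<open>p10\<close> and \<open>p20\<close>. The maximal function is again at most 1, so
  the limit \<open>p20\<close> can be changed back to \<open>p2 x\<close> in the same way.\<close>

lemma hls_small:
  "\<exists>A\<ge>0. \<forall>g :: 'a \<Rightarrow> real. g \<in> borel_measurable lebesgue \<longrightarrow> (\<forall>y. 0 \<le> g y \<and> g y \<le> 1) \<longrightarrow>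
     (\<integral>\<^sup>+ y. ennreal (g y powr p1 y) \<partial>lebesgue) \<le> 1 \<longrightarrow>
     (\<integral>\<^sup>+ x. enn_powr (riesz \<gamma> (\<lambda>y. ennreal (g y)) x) (p2 x) \<partial>lebesgue) \<le> ennreal A"
proof -
  let ?n = "real DIM('a)"
  let ?dec = "\<lambda>y::'a. (exp 1 + norm y) powr - (?n * a)"
  obtain T where T: "0 \<le> T" "(\<integral>\<^sup>+ y. ennreal (?dec y) \<partial>lebesgue) = ennreal T"
    using decay_integral by blast
  define E where "E = exp (?n * P^2 * K)"
  have E: "0 < E" by (simp add: E_def)
  \<comment> \<open>\<open>E + T\<close> bounds the modular of \<open>g\<close> for the exponent
    \<open>p10\<close>; since \<open>p10 > 1\<close>, division by \<open>c\<close> makes it at most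
    1.\<close>
  define c where "c = max 1 (E + T)"
  have c: "1 \<le> c" "E + T \<le> c" by (auto simp: c_def)
  \<comment> \<open>A constant exponent has no oscillation, hence the constant 0.\<close>
  interpret pc: log_exponent "\<lambda>_::'a. p10" p10 a P 0
    by unfold_locales (use p1.gt1 p1.lower_inf p1.upper_inf in auto)
  obtain A1 where A1: "1 \<le> A1" "\<And>(g :: 'a \<Rightarrow> real) x R. \<lbrakk>g \<in> borel_measurable lebesgue; \<forall>y. 0 \<le> g y; 0 < R;
     ball_int (\<lambda>y. ennreal (g y powr p10)) x R \<le> 1\<rbrakk> \<Longrightarrow>
     ball_int (\<lambda>y. ennreal (g y)) x R \<le> ennreal (A1 * (R powr ?n / Phi (\<lambda>_. p10) p10 x R))"
    using pc.ball_int_le_Phi by blast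
  define e where "e = ?n / p20"
  have e: "0 < e" using p2.inf_gt1 by (simp add: e_def)
  have ge: "\<gamma> + e = ?n / p10" using sobolev_inf by (simp add: e_def)
  \<comment> \<open>The Hedberg power followed by the power \<open>p20\<close> is exactly
    \<open>p10\<close>, the exponent of the strong type bound.\<close>
  have eq: "e / (\<gamma> + e) = p10 / p20" unfolding ge unfolding e_def using p1.inf_gt1 p2.inf_gt1 by (simp add: divide_simps)
  obtain C where C: "1 \<le> C" "\<And>(g :: 'a \<Rightarrow> ennreal) x e. \<lbrakk>g \<in> borel_measurable lebesgue; 0 < e;
    \<forall>\<delta>>0. maximal g x = ennreal (\<delta> powr - (\<gamma> + e)) \<longrightarrow>
       (\<forall>j::nat. ball_int g x (2^(j+1) * \<delta>)
          \<le> ennreal (A1 * (2^(j+1) * \<delta>) powr (?n - \<gamma>) * (\<delta> powr - e * (2^j) powr - (?n / p20))))\<rbrakk> \<Longrightarrow>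
    riesz \<gamma> g x \<le> ennreal C * enn_powr (maximal g x) (e / (\<gamma> + e))"
    using hedberg[OF \<gamma>_pos \<gamma>_less, of "?n / p20" A1] A1 p2.inf_gt1 by auto
  obtain CM where CM: "0 \<le> CM" "\<And>g :: 'a \<Rightarrow> ennreal. g \<in> borel_measurable lebesgue \<Longrightarrow>
    (\<integral>\<^sup>+ x. enn_powr (maximal g x) p10 \<partial>lebesgue) \<le> ennreal CM * (\<integral>\<^sup>+ x. enn_powr (g x) p10 \<partial>lebesgue)"
    using maximal_strong_type_ex[OF p1.inf_gt1] by blast
  show ?thesis
  proof (intro exI[of _ "(c * C) powr P * (E * CM + T)"] conjI allI impI)
    show "0 \<le> (c * C) powr P * (E * CM + T)" using E CM T by simp
    fix g :: "'a \<Rightarrow> real"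
    assume g [measurable]: "g \<in> borel_measurable lebesgue" and g01: "\<forall>y. 0 \<le> g y \<and> g y \<le> 1"
      and mod: "(\<integral>\<^sup>+ y. ennreal (g y powr p1 y) \<partial>lebesgue) \<le> 1"
    have "(\<integral>\<^sup>+ y. ennreal (g y powr p10) \<partial>lebesgue)
      \<le> (\<integral>\<^sup>+ y. ennreal E * ennreal (g y powr p1 y) + ennreal (?dec y) \<partial>lebesgue)"
    proof (rule nn_integral_mono)
      fix y
      have "ennreal (g y powr p10) \<le> ennreal (E * g y powr p1 y + ?dec y)"
        using p1.powr_inf_le_powr[of "g y" y] g01 by (intro ennreal_leI) (simp add: E_def)
      then show "ennreal (g y powr p10) \<le> ennreal E * ennreal (g y powr p1 y) + ennreal (?dec y)"
        using E by (simp add: ennreal_mult)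
    qed
    also have "\<dots> = ennreal E * (\<integral>\<^sup>+ y. ennreal (g y powr p1 y) \<partial>lebesgue) + ennreal T"
      using T by (subst nn_integral_add) (auto simp: nn_integral_cmult)
    also have "\<dots> \<le> ennreal E * 1 + ennreal T" by (intro add_mono mult_left_mono mod) auto
    also have "\<dots> = ennreal (E + T)" using E T by simp
    also have "\<dots> \<le> ennreal c" by (intro ennreal_leI c)
    finally have gc: "(\<integral>\<^sup>+ y. ennreal (g y powr p10) \<partial>lebesgue) \<le> ennreal c" .
    define g' where "g' = (\<lambda>y. g y / c)"
    have [measurable]: "g' \<in> borel_measurable lebesgue" unfolding g'_def by measurable
    have g'01: "0 \<le> g' y" "g' y \<le> 1" for y
      using g01[rule_format, of y] c by (auto simp: g'_def divide_le_eq)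
    have "(\<integral>\<^sup>+ y. ennreal (g' y powr p10) \<partial>lebesgue) \<le> (\<integral>\<^sup>+ y. ennreal (1 / c) * ennreal (g y powr p10) \<partial>lebesgue)"
    proof (rule nn_integral_mono)
      fix y
      have "c powr 1 \<le> c powr p10" using c p1.inf_gt1 by (intro powr_mono) auto
      then have "g y powr p10 / c powr p10 \<le> g y powr p10 / c" using c by (intro divide_left_mono) auto
      then show "ennreal (g' y powr p10) \<le> ennreal (1 / c) * ennreal (g y powr p10)"
        using g01[rule_format, of y] c by (auto simp: g'_def powr_divide simp flip: ennreal_mult'' intro!: ennreal_leI)
    qed
    also have "\<dots> \<le> ennreal (1 / c) * ennreal c"
      by (subst nn_integral_cmult, measurable) (intro mult_left_mono gc, simp)
    also have "\<dots> = 1" using c by (simp flip: ennreal_mult'')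
    finally have g'mod: "(\<integral>\<^sup>+ y. ennreal (g' y powr p10) \<partial>lebesgue) \<le> 1" .
    let ?G = "\<lambda>y. ennreal (g' y)"
    have G [measurable]: "?G \<in> borel_measurable lebesgue" by measurable
    have "riesz \<gamma> ?G x \<le> ennreal C * enn_powr (maximal ?G x) (e / (\<gamma> + e))" for x
    proof (intro C(2) G e allI impI)
      fix \<delta> :: real and j :: nat assume \<delta>: "0 < \<delta>"
      let ?R = "2^(j+1) * \<delta>"
      have R: "0 < ?R" using \<delta> by simp
      have "ball_int ?G x ?R \<le> ennreal (A1 * (?R powr ?n / Phi (\<lambda>_. p10) p10 x ?R))"
        using g'01 R g'mod ball_int_le[of "\<lambda>y. ennreal (g' y powr p10)" x ?R]
        by (intro A1) (auto intro: order_trans)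
      also have "A1 * (?R powr ?n / Phi (\<lambda>_. p10) p10 x ?R) = A1 * ?R powr (?n - \<gamma>) * ?R powr - e"
        using R by (simp add: Phi_def ge[symmetric] powr_diff[symmetric] powr_add[symmetric] mult.assoc diff_diff_eq del: power_Suc)
      also have "\<dots> \<le> A1 * ?R powr (?n - \<gamma>) * (2^j * \<delta>) powr - e"
        using A1 \<delta> e by (intro mult_left_mono powr_mono2') auto
      also have "(2^j * \<delta>) powr - e = \<delta> powr - e * (2^j) powr - (?n / p20)"
        using \<delta> by (simp add: powr_mult e_def)
      finally show "ball_int ?G x ?R \<le> ennreal (A1 * ?R powr (?n - \<gamma>) * (\<delta> powr - e * (2^j) powr - (?n / p20)))"
        by (simp add: ennreal_leI)
    qed
    note hed = this[unfolded eq]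
    have "(\<integral>\<^sup>+ x. enn_powr (riesz \<gamma> (\<lambda>y. ennreal (g y)) x) (p2 x) \<partial>lebesgue)
      \<le> (\<integral>\<^sup>+ x. ennreal ((c * C) powr P) * (ennreal E * enn_powr (maximal ?G x) p10 + ennreal (?dec x)) \<partial>lebesgue)"
    proof (rule nn_integral_mono)
      fix x
      obtain m where m: "maximal ?G x = ennreal m" "0 \<le> m" "m \<le> 1"
        using maximal_le_1[of ?G x] g'01 by (cases "maximal ?G x") (auto simp: top_unique)
      define t where "t = m powr (p10 / p20)"
      have t: "0 \<le> t" "t \<le> 1" using m p1.inf_gt1 p2.inf_gt1 by (auto simp: t_def powr_le1)
      have tp: "t powr p20 = m powr p10" using p2.inf_gt1 by (simp add: t_def powr_powr)
      have "(\<lambda>y. ennreal (g y)) = (\<lambda>y. ennreal c * ?G y)"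
        using c g01 by (auto simp: g'_def simp flip: ennreal_mult'')
      then have "riesz \<gamma> (\<lambda>y. ennreal (g y)) x = ennreal c * riesz \<gamma> ?G x"
        by (simp add: riesz_cmult)
      also have "\<dots> \<le> ennreal c * (ennreal C * ennreal t)"
        using hed[of x] m by (intro mult_left_mono) (auto simp: enn_powr_ennreal t_def)
      also have "\<dots> = ennreal (c * C * t)"
        using c C t by (simp flip: ennreal_mult add: mult.assoc)
      finally have "enn_powr (riesz \<gamma> (\<lambda>y. ennreal (g y)) x) (p2 x) \<le> enn_powr (ennreal (c * C * t)) (p2 x)"
        using p2.s_pos[of x] by (intro enn_powr_mono) auto
      also have "\<dots> = ennreal ((c * C * t) powr p2 x)"
        using c C t by (intro enn_powr_ennreal) auto
      also have "\<dots> \<le> ennreal ((c * C) powr P * (E * m powr p10 + ?dec x))"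
      proof (intro ennreal_leI)
        have "(c * C * t) powr p2 x = (c * C) powr p2 x * t powr p2 x"
          by (rule powr_mult)
        also have "\<dots> \<le> (c * C) powr P * (E * t powr p20 + ?dec x)"
        proof (rule mult_mono)
          have "1 * 1 \<le> c * C" using c C by (intro mult_mono) auto
          then show "(c * C) powr p2 x \<le> (c * C) powr P" using p2.upper[of x] by (intro powr_mono) auto
          show "t powr p2 x \<le> E * t powr p20 + ?dec x"
            using p2.powr_le_powr_inf[OF t, of x] by (simp add: E_def)
        qed auto
        finally show "(c * C * t) powr p2 x \<le> (c * C) powr P * (E * m powr p10 + ?dec x)" by (simp add: tp)
      qed
      also have "\<dots> = ennreal ((c * C) powr P) * (ennreal E * enn_powr (maximal ?G x) p10 + ennreal (?dec x))"
        using E m by (simp add: ennreal_mult enn_powr_ennreal)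
      finally show "enn_powr (riesz \<gamma> (\<lambda>y. ennreal (g y)) x) (p2 x) \<le> \<dots>" .
    qed
    also have "\<dots> = ennreal ((c * C) powr P) * (ennreal E * (\<integral>\<^sup>+ x. enn_powr (maximal ?G x) p10 \<partial>lebesgue) + ennreal T)"
      using T by (subst nn_integral_cmult, measurable, subst nn_integral_add) (auto simp: nn_integral_cmult)
    also have "\<dots> \<le> ennreal ((c * C) powr P) * (ennreal E * (ennreal CM * 1) + ennreal T)"
    proof (intro mult_left_mono add_right_mono)
      have "(\<integral>\<^sup>+ x. enn_powr (maximal ?G x) p10 \<partial>lebesgue) \<le> ennreal CM * (\<integral>\<^sup>+ x. enn_powr (?G x) p10 \<partial>lebesgue)"
        by (intro CM G)
      also have "\<dots> \<le> ennreal CM * 1"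
        using g'mod g'01 by (intro mult_left_mono) (auto simp: enn_powr_ennreal)
      finally show "(\<integral>\<^sup>+ x. enn_powr (maximal ?G x) p10 \<partial>lebesgue) \<le> ennreal CM * 1" .
    qed auto
    also have "\<dots> = ennreal ((c * C) powr P * (E * CM + T))"
      using E CM T by (simp add: ennreal_mult)
    finally show "(\<integral>\<^sup>+ x. enn_powr (riesz \<gamma> (\<lambda>y. ennreal (g y)) x) (p2 x) \<partial>lebesgue)
      \<le> ennreal ((c * C) powr P * (E * CM + T))" .
  qed
qed

text \<open>Where the maximal function exceeds 1, the Hedberg bound with the exponent at
  \<open>x\<close> combines with \<open>maximal_powr_le\<close>. Where it is at most 1, the integral
  bound for \<open>g\<close>, a consequence of \<open>g\<close> being 0 or at least 1, already
  suffices: the Hedberg argument for integrable functions has \<open>e = n - \<gamma>\<close>, and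
  the resulting power of the maximal function stays uniformly above 1.\<close>

lemma hls_large:
  "\<exists>A\<ge>0. \<forall>g :: 'a \<Rightarrow> real. g \<in> borel_measurable lebesgue \<longrightarrow> (\<forall>y. g y = 0 \<or> 1 \<le> g y) \<longrightarrow>
     (\<integral>\<^sup>+ y. ennreal (g y powr p1 y) \<partial>lebesgue) \<le> 1 \<longrightarrow>
     (\<integral>\<^sup>+ x. enn_powr (riesz \<gamma> (\<lambda>y. ennreal (g y)) x) (p2 x) \<partial>lebesgue) \<le> ennreal A"
proof -
  let ?n = "real DIM('a)"
  obtain A1 where A1: "1 \<le> A1" "\<And>(g :: 'a \<Rightarrow> real) x R. \<lbrakk>g \<in> borel_measurable lebesgue; \<forall>y. 0 \<le> g y; 0 < R;
     ball_int (\<lambda>y. ennreal (g y powr p1 y)) x R \<le> 1\<rbrakk> \<Longrightarrow>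
     ball_int (\<lambda>y. ennreal (g y)) x R \<le> ennreal (A1 * (R powr (?n - \<gamma>) / Phi p2 p20 x R))"
    using ball_int_le_Phi2 by blast
  obtain C1 where C1: "1 \<le> C1" "\<And>(g :: 'a \<Rightarrow> ennreal) x e. \<lbrakk>g \<in> borel_measurable lebesgue; 0 < e;
    \<forall>\<delta>>0. maximal g x = ennreal (\<delta> powr - (\<gamma> + e)) \<longrightarrow>
       (\<forall>j::nat. ball_int g x (2^(j+1) * \<delta>)
          \<le> ennreal (1 * (2^(j+1) * \<delta>) powr (?n - \<gamma>) * (\<delta> powr - e * (2^j) powr - (?n - \<gamma>))))\<rbrakk> \<Longrightarrow>
    riesz \<gamma> g x \<le> ennreal C1 * enn_powr (maximal g x) (e / (\<gamma> + e))"
    using hedberg[OF \<gamma>_pos \<gamma>_less, of "?n - \<gamma>" 1] \<gamma>_less by auto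
  obtain C2 where C2: "1 \<le> C2" "\<And>(g :: 'a \<Rightarrow> ennreal) x e. \<lbrakk>g \<in> borel_measurable lebesgue; 0 < e;
    \<forall>\<delta>>0. maximal g x = ennreal (\<delta> powr - (\<gamma> + e)) \<longrightarrow>
       (\<forall>j::nat. ball_int g x (2^(j+1) * \<delta>)
          \<le> ennreal (A1 * (2^(j+1) * \<delta>) powr (?n - \<gamma>) * (\<delta> powr - e * (2^j) powr - (?n / P))))\<rbrakk> \<Longrightarrow>
    riesz \<gamma> g x \<le> ennreal C2 * enn_powr (maximal g x) (e / (\<gamma> + e))"
    using hedberg[OF \<gamma>_pos \<gamma>_less, of "?n / P" A1] A1 p2.P_gt1 by auto
  obtain C3 where C3: "1 \<le> C3" "\<And>(g :: 'a \<Rightarrow> real) x. \<lbrakk>g \<in> borel_measurable lebesgue; \<forall>y. g y = 0 \<or> 1 \<le> g y;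
     (\<integral>\<^sup>+ y. ennreal (g y powr p1 y) \<partial>lebesgue) \<le> 1; 1 < maximal (\<lambda>y. ennreal (g y)) x\<rbrakk> \<Longrightarrow>
     enn_powr (maximal (\<lambda>y. ennreal (g y)) x) (p1 x)
      \<le> ennreal C3 * enn_powr (maximal (\<lambda>y. ennreal (g y powr (p1 y / a))) x) a"
    using p1.maximal_powr_le by blast
  \<comment> \<open>In the region where the maximal function is at most 1 its power is
    \<open>1 + (1 - 1 / p1 x) * p2 x\<close>, which is at least \<open>2 - 1 / a\<close>. The other
    bound \<open>a' \<le> a\<close> keeps the modular of \<open>g\<close> for \<open>a'\<close>
    below the one for \<open>p1\<close>, as \<open>g\<close> is 0 or at least 1.\<close>
  define a' where "a' = min a (2 - 1 / a)"
  have a': "1 < a'" "a' \<le> a" "a' \<le> 2 - 1 / a" using p1.gt1 by (auto simp: a'_def divide_less_eq)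
  obtain M1 where M1: "0 \<le> M1" "\<And>g :: 'a \<Rightarrow> ennreal. g \<in> borel_measurable lebesgue \<Longrightarrow>
    (\<integral>\<^sup>+ x. enn_powr (maximal g x) a' \<partial>lebesgue) \<le> ennreal M1 * (\<integral>\<^sup>+ x. enn_powr (g x) a' \<partial>lebesgue)"
    using maximal_strong_type_ex[OF a'(1)] by blast
  obtain M2 where M2: "0 \<le> M2" "\<And>g :: 'a \<Rightarrow> ennreal. g \<in> borel_measurable lebesgue \<Longrightarrow>
    (\<integral>\<^sup>+ x. enn_powr (maximal g x) a \<partial>lebesgue) \<le> ennreal M2 * (\<integral>\<^sup>+ x. enn_powr (g x) a \<partial>lebesgue)"
    using maximal_strong_type_ex[OF p1.gt1] by blast
  show ?thesis
  proof (intro exI[of _ "C1 powr P * M1 + C2 powr P * C3 * M2"] conjI allI impI)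
    show "0 \<le> C1 powr P * M1 + C2 powr P * C3 * M2" using M1 M2 C3 by simp
    fix g :: "'a \<Rightarrow> real"
    assume g [measurable]: "g \<in> borel_measurable lebesgue" and g01: "\<forall>y. g y = 0 \<or> 1 \<le> g y"
      and mod: "(\<integral>\<^sup>+ y. ennreal (g y powr p1 y) \<partial>lebesgue) \<le> 1"
    have g0: "0 \<le> g y" for y using g01[rule_format, of y] by auto
    let ?G = "\<lambda>y. ennreal (g y)" and ?H = "\<lambda>y. ennreal (g y powr (p1 y / a))"
    have G [measurable]: "?G \<in> borel_measurable lebesgue" by measurable
    have H [measurable]: "?H \<in> borel_measurable lebesgue" by measurable
    have pow_le: "ennreal (g y powr z) \<le> ennreal (g y powr p1 y)" if "0 < z" "z \<le> p1 y" for y z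
    proof (cases "g y = 0")
      case False
      then show ?thesis using g01[rule_format, of y] that by (intro ennreal_leI powr_mono) auto
    qed simp
    have G1: "(\<integral>\<^sup>+ y. ?G y \<partial>lebesgue) \<le> 1"
    proof -
      have "(\<integral>\<^sup>+ y. ?G y \<partial>lebesgue) \<le> (\<integral>\<^sup>+ y. ennreal (g y powr p1 y) \<partial>lebesgue)"
        using pow_le[of 1] p1.s_gt1 g0 by (intro nn_integral_mono) (auto simp: less_imp_le)
      then show ?thesis using mod by order
    qed
    have pw: "enn_powr (riesz \<gamma> ?G x) (p2 x) \<le> ennreal (C1 powr P) * enn_powr (maximal ?G x) a'
       + ennreal (C2 powr P * C3) * enn_powr (maximal ?H x) a" for x
    proof (cases "maximal ?G x \<le> 1")
      case True
      obtain m where m: "maximal ?G x = ennreal m" "0 \<le> m" "m \<le> 1"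
        using True by (cases "maximal ?G x") (auto simp: top_unique)
      have ge: "\<gamma> + (?n - \<gamma>) = ?n" by simp
      have "riesz \<gamma> ?G x \<le> ennreal C1 * enn_powr (maximal ?G x) ((?n - \<gamma>) / (\<gamma> + (?n - \<gamma>)))"
      proof (intro C1(2) G allI impI)
        fix \<delta> :: real and j :: nat assume \<delta>: "0 < \<delta>"
        have "ball_int ?G x (2^(j+1) * \<delta>) \<le> ennreal 1"
          using ball_int_le[of ?G x "2^(j+1) * \<delta>"] G1 by (auto intro: order_trans)
        also have "\<dots> \<le> ennreal (1 * (2^(j+1) * \<delta>) powr (?n - \<gamma>) * (\<delta> powr - (?n - \<gamma>) * (2^j) powr - (?n - \<gamma>)))"
        proof (intro ennreal_leI)
          have "1 = (2^j * \<delta>) powr (?n - \<gamma>) * (2^j * \<delta>) powr - (?n - \<gamma>)"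
            using \<delta> by (simp only: powr_add[symmetric]) simp
          also have "\<dots> \<le> (2^(j+1) * \<delta>) powr (?n - \<gamma>) * (2^j * \<delta>) powr - (?n - \<gamma>)"
            using \<delta> \<gamma>_less by (intro mult_right_mono powr_mono2) auto
          also have "(2^j * \<delta>) powr - (?n - \<gamma>) = \<delta> powr - (?n - \<gamma>) * (2^j) powr - (?n - \<gamma>)"
            unfolding powr_mult by simp
          finally show "1 \<le> 1 * (2^(j+1) * \<delta>) powr (?n - \<gamma>) * (\<delta> powr - (?n - \<gamma>) * (2^j) powr - (?n - \<gamma>))"
            by (simp only: mult_1)
        qed
        finally show "ball_int ?G x (2^(j+1) * \<delta>) \<le> \<dots>" .
      qed (use \<gamma>_less in simp)
      then have "riesz \<gamma> ?G x \<le> ennreal (C1 * m powr ((?n - \<gamma>) / ?n))"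
        unfolding ge m(1) enn_powr_ennreal[OF m(2)] using C1 by (simp add: ennreal_mult)
      then have "enn_powr (riesz \<gamma> ?G x) (p2 x) \<le> enn_powr (ennreal (C1 * m powr ((?n - \<gamma>) / ?n))) (p2 x)"
        using p2.s_pos[of x] by (intro enn_powr_mono) auto
      also have "\<dots> = ennreal (C1 powr p2 x * m powr ((?n - \<gamma>) / ?n * p2 x))"
        using C1 m by (simp add: enn_powr_ennreal powr_mult powr_powr)
      also have "\<dots> \<le> ennreal (C1 powr P * m powr a')"
      proof (intro ennreal_leI mult_mono)
        have "(?n - \<gamma>) / ?n = 1 - 1 / p1 x + 1 / p2 x"
        proof -
          have "\<gamma> / ?n = 1 / p1 x - 1 / p2 x" by (simp add: sobolev[symmetric, of x] diff_divide_distrib)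
          then show ?thesis by (simp add: diff_divide_distrib)
        qed
        then have 1: "(?n - \<gamma>) / ?n * p2 x = 1 + (1 - 1 / p1 x) * p2 x" using p2.s_pos[of x] by (simp add: field_simps)
        have "1 / p1 x \<le> 1 / a" using p1.lower[of x] p1.gt1 by (intro divide_left_mono) auto
        moreover have "1 / a < 1" using p1.gt1 by simp
        ultimately have "(1 - 1 / a) * 1 \<le> (1 - 1 / p1 x) * p2 x"
          using p2.s_gt1[of x] by (intro mult_mono) auto
        then have "1 + (1 - 1 / a) * 1 \<le> (?n - \<gamma>) / ?n * p2 x" unfolding 1 by (rule add_left_mono)
        moreover have "a' \<le> 1 + (1 - 1 / a) * 1" using a' by simp
        ultimately have "a' \<le> (?n - \<gamma>) / ?n * p2 x" by (rule order_trans[rotated])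
        then show "m powr ((?n - \<gamma>) / ?n * p2 x) \<le> m powr a'" using m by (intro powr_mono') auto
        show "C1 powr p2 x \<le> C1 powr P" using C1 p2.upper[of x] by (intro powr_mono) auto
      qed auto
      also have "\<dots> = ennreal (C1 powr P) * enn_powr (maximal ?G x) a'"
        using m by (simp add: enn_powr_ennreal ennreal_mult)
      finally show ?thesis by (simp add: add_increasing2)
    next
      case False
      define e where "e = ?n / p2 x"
      have e: "0 < e" using p2.s_pos by (simp add: e_def)
      have ge: "\<gamma> + e = ?n / p1 x" using sobolev[of x] by (simp add: e_def)
      have eq: "e / (\<gamma> + e) = p1 x / p2 x" unfolding ge unfolding e_def using p1.s_pos[of x] p2.s_pos[of x] by (simp add: divide_simps)
      have "riesz \<gamma> ?G x \<le> ennreal C2 * enn_powr (maximal ?G x) (e / (\<gamma> + e))"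
      proof (intro C2(2) G e allI impI)
        fix \<delta> :: real and j :: nat assume \<delta>: "0 < \<delta>" "maximal ?G x = ennreal (\<delta> powr - (\<gamma> + e))"
        \<comment> \<open>A maximal function above 1 forces a small balancing radius, the only range
          where \<open>inverse_Phi_le\<close> is available.\<close>
        have \<delta>1: "\<delta> \<le> 1"
        proof (rule ccontr)
          assume "\<not> \<delta> \<le> 1"
          then have "\<delta> powr - (\<gamma> + e) \<le> \<delta> powr 0" using e \<gamma>_pos by (intro powr_mono) auto
          then have "maximal ?G x \<le> ennreal 1" unfolding \<delta>(2) using \<delta> by (intro ennreal_leI) auto
          with False show False by simp
        qed
        let ?R = "2^(j+1) * \<delta>"
        have R: "0 < ?R" using \<delta> by simp
        have "ball_int ?G x ?R \<le> ennreal (A1 * (?R powr (?n - \<gamma>) / Phi p2 p20 x ?R))"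
          using g0 R mod ball_int_le[of "\<lambda>y. ennreal (g y powr p1 y)" x ?R]
          by (intro A1) (auto intro: order_trans)
        also have "A1 * (?R powr (?n - \<gamma>) / Phi p2 p20 x ?R) = A1 * ?R powr (?n - \<gamma>) * (1 / Phi p2 p20 x ?R)" by simp
        also have "\<dots> \<le> A1 * ?R powr (?n - \<gamma>) * (\<delta> powr - e * (2^j) powr - (?n / P))"
          using A1 inverse_Phi_le[OF \<delta>(1) \<delta>1, of x j] by (intro mult_left_mono) (auto simp: e_def)
        finally show "ball_int ?G x ?R \<le> ennreal (A1 * ?R powr (?n - \<gamma>) * (\<delta> powr - e * (2^j) powr - (?n / P)))"
          by (simp add: ennreal_leI)
      qed
      then have "enn_powr (riesz \<gamma> ?G x) (p2 x) \<le> enn_powr (ennreal C2 * enn_powr (maximal ?G x) (p1 x / p2 x)) (p2 x)"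
        unfolding eq using p2.s_pos[of x] by (intro enn_powr_mono) auto
      also have "\<dots> = ennreal (C2 powr p2 x) * enn_powr (maximal ?G x) (p1 x)"
        using C2 p2.s_pos[of x] by (simp add: enn_powr_mult enn_powr_powr enn_powr_ennreal)
      also have "\<dots> \<le> ennreal (C2 powr P) * (ennreal C3 * enn_powr (maximal ?H x) a)"
        using C2 p2.upper[of x] False by (intro mult_mono ennreal_leI powr_mono C3 g g01 mod) auto
      also have "\<dots> = ennreal (C2 powr P * C3) * enn_powr (maximal ?H x) a"
        using C3 by (simp add: ennreal_mult mult.assoc)
      finally show ?thesis by (simp add: add_increasing)
    qed
    have "(\<integral>\<^sup>+ x. enn_powr (riesz \<gamma> ?G x) (p2 x) \<partial>lebesgue)
      \<le> (\<integral>\<^sup>+ x. ennreal (C1 powr P) * enn_powr (maximal ?G x) a'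
       + ennreal (C2 powr P * C3) * enn_powr (maximal ?H x) a \<partial>lebesgue)"
      by (intro nn_integral_mono pw)
    also have "\<dots> = ennreal (C1 powr P) * (\<integral>\<^sup>+ x. enn_powr (maximal ?G x) a' \<partial>lebesgue)
       + ennreal (C2 powr P * C3) * (\<integral>\<^sup>+ x. enn_powr (maximal ?H x) a \<partial>lebesgue)"
      by (subst nn_integral_add) (auto simp: nn_integral_cmult)
    also have "\<dots> \<le> ennreal (C1 powr P) * (ennreal M1 * 1) + ennreal (C2 powr P * C3) * (ennreal M2 * 1)"
    proof (intro add_mono mult_left_mono)
      have "(\<integral>\<^sup>+ x. enn_powr (?G x) a' \<partial>lebesgue) \<le> (\<integral>\<^sup>+ y. ennreal (g y powr p1 y) \<partial>lebesgue)"
      proof (rule nn_integral_mono)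
        fix y
        have "0 < a'" "a' \<le> p1 y" using a' p1.lower[of y] by auto
        then show "enn_powr (?G y) a' \<le> ennreal (g y powr p1 y)"
          unfolding enn_powr_ennreal[OF g0] by (rule pow_le)
      qed
      then show "(\<integral>\<^sup>+ x. enn_powr (maximal ?G x) a' \<partial>lebesgue) \<le> ennreal M1 * 1"
        using mod by (intro order_trans[OF M1(2)[OF G]] mult_left_mono) auto
      have "(\<integral>\<^sup>+ x. enn_powr (?H x) a \<partial>lebesgue) = (\<integral>\<^sup>+ y. ennreal (g y powr p1 y) \<partial>lebesgue)"
        using p1.gt1 by (intro nn_integral_cong) (simp add: enn_powr_ennreal powr_powr)
      then show "(\<integral>\<^sup>+ x. enn_powr (maximal ?H x) a \<partial>lebesgue) \<le> ennreal M2 * 1"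
        using mod by (intro order_trans[OF M2(2)[OF H]] mult_left_mono) auto
    qed auto
    also have "\<dots> = ennreal (C1 powr P * M1 + C2 powr P * C3 * M2)"
      using M1 M2 C3 by (simp add: ennreal_mult)
    finally show "(\<integral>\<^sup>+ x. enn_powr (riesz \<gamma> ?G x) (p2 x) \<partial>lebesgue) \<le> ennreal (C1 powr P * M1 + C2 powr P * C3 * M2)" .
  qed
qed

text \<open>The two height parts are added by quasi-convexity. As \<open>p2 > 1\<close>, dividing
  the function by \<open>A \<ge> 1\<close> lowers the modular at least by the factor
  \<open>1 / A\<close>, which absorbs the constant.\<close>

theorem hls_modular:
  "\<exists>A\<ge>1. \<forall>g :: 'a \<Rightarrow> real. g \<in> borel_measurable lebesgue \<longrightarrow> (\<forall>y. 0 \<le> g y) \<longrightarrow>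
     (\<integral>\<^sup>+ y. ennreal (g y powr p1 y) \<partial>lebesgue) \<le> 1 \<longrightarrow>
     (\<integral>\<^sup>+ x. enn_powr (riesz \<gamma> (\<lambda>y. ennreal (g y / A)) x) (p2 x) \<partial>lebesgue) \<le> 1"
proof -
  obtain A1 where A1: "0 \<le> A1" "\<And>g :: 'a \<Rightarrow> real. \<lbrakk>g \<in> borel_measurable lebesgue; \<forall>y. 0 \<le> g y \<and> g y \<le> 1;
     (\<integral>\<^sup>+ y. ennreal (g y powr p1 y) \<partial>lebesgue) \<le> 1\<rbrakk> \<Longrightarrow>
     (\<integral>\<^sup>+ x. enn_powr (riesz \<gamma> (\<lambda>y. ennreal (g y)) x) (p2 x) \<partial>lebesgue) \<le> ennreal A1"
    using hls_small by blast
  obtain A2 where A2: "0 \<le> A2" "\<And>g :: 'a \<Rightarrow> real. \<lbrakk>g \<in> borel_measurable lebesgue; \<forall>y. g y = 0 \<or> 1 \<le> g y;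
     (\<integral>\<^sup>+ y. ennreal (g y powr p1 y) \<partial>lebesgue) \<le> 1\<rbrakk> \<Longrightarrow>
     (\<integral>\<^sup>+ x. enn_powr (riesz \<gamma> (\<lambda>y. ennreal (g y)) x) (p2 x) \<partial>lebesgue) \<le> ennreal A2"
    using hls_large by blast
  define B where "B = 2 powr P * (A1 + A2)"
  define A where "A = max 1 B"
  have B: "0 \<le> B" using A1 A2 by (simp add: B_def)
  have A: "1 \<le> A" "B \<le> A" by (auto simp: A_def)
  show ?thesis
  proof (intro exI[of _ A] conjI allI impI A)
    fix g :: "'a \<Rightarrow> real"
    assume g [measurable]: "g \<in> borel_measurable lebesgue" and g0: "\<forall>y. 0 \<le> g y"
      and mod: "(\<integral>\<^sup>+ y. ennreal (g y powr p1 y) \<partial>lebesgue) \<le> 1"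
    define g1 where "g1 = (\<lambda>y. if g y \<le> 1 then g y else 0)"
    define g2 where "g2 = (\<lambda>y. if g y \<le> 1 then 0 else g y)"
    have [measurable]: "g1 \<in> borel_measurable lebesgue" unfolding g1_def by measurable
    have [measurable]: "g2 \<in> borel_measurable lebesgue" unfolding g2_def by measurable
    have "(\<integral>\<^sup>+ y. ennreal (g1 y powr p1 y) \<partial>lebesgue) \<le> 1"
      by (rule order_trans[OF nn_integral_mono mod]) (auto simp: g1_def)
    then have r1: "(\<integral>\<^sup>+ x. enn_powr (riesz \<gamma> (\<lambda>y. ennreal (g1 y)) x) (p2 x) \<partial>lebesgue) \<le> ennreal A1"
      using g0 by (intro A1) (auto simp: g1_def)
    have "(\<integral>\<^sup>+ y. ennreal (g2 y powr p1 y) \<partial>lebesgue) \<le> 1"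
      by (rule order_trans[OF nn_integral_mono mod]) (auto simp: g2_def)
    then have r2: "(\<integral>\<^sup>+ x. enn_powr (riesz \<gamma> (\<lambda>y. ennreal (g2 y)) x) (p2 x) \<partial>lebesgue) \<le> ennreal A2"
      by (intro A2) (auto simp: g2_def)
    have pw: "enn_powr (riesz \<gamma> (\<lambda>y. ennreal (g y / A)) x) (p2 x) \<le> ennreal (2 powr P / A) *
      (enn_powr (riesz \<gamma> (\<lambda>y. ennreal (g1 y)) x) (p2 x) + enn_powr (riesz \<gamma> (\<lambda>y. ennreal (g2 y)) x) (p2 x))" for x
    proof -
      have "(\<lambda>y. ennreal (g y / A)) = (\<lambda>y. ennreal (1 / A) * (ennreal (g1 y) + ennreal (g2 y)))"
        using g0 A by (auto simp: fun_eq_iff g1_def g2_def simp flip: ennreal_mult')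
      then have "riesz \<gamma> (\<lambda>y. ennreal (g y / A)) x = ennreal (1 / A) * (riesz \<gamma> (\<lambda>y. ennreal (g1 y)) x + riesz \<gamma> (\<lambda>y. ennreal (g2 y)) x)"
        by (simp add: riesz_cmult riesz_add)
      then have "enn_powr (riesz \<gamma> (\<lambda>y. ennreal (g y / A)) x) (p2 x)
        = ennreal ((1 / A) powr p2 x) * enn_powr (riesz \<gamma> (\<lambda>y. ennreal (g1 y)) x + riesz \<gamma> (\<lambda>y. ennreal (g2 y)) x) (p2 x)"
        using A p2.s_pos[of x] by (simp add: enn_powr_mult enn_powr_ennreal)
      also have "\<dots> \<le> ennreal (1 / A) * (ennreal (2 powr P) *
        (enn_powr (riesz \<gamma> (\<lambda>y. ennreal (g1 y)) x) (p2 x) + enn_powr (riesz \<gamma> (\<lambda>y. ennreal (g2 y)) x) (p2 x)))"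
      proof (rule mult_mono)
        have "(1 / A) powr p2 x \<le> (1 / A) powr 1" using A p2.s_gt1[of x] by (intro powr_mono') auto
        then show "ennreal ((1 / A) powr p2 x) \<le> ennreal (1 / A)" using A by (intro ennreal_leI) auto
        have "ennreal (2 powr p2 x) \<le> ennreal (2 powr P)" using p2.upper[of x] by (intro ennreal_leI powr_mono) auto
        then show "enn_powr (riesz \<gamma> (\<lambda>y. ennreal (g1 y)) x + riesz \<gamma> (\<lambda>y. ennreal (g2 y)) x) (p2 x)
         \<le> ennreal (2 powr P) * (enn_powr (riesz \<gamma> (\<lambda>y. ennreal (g1 y)) x) (p2 x) + enn_powr (riesz \<gamma> (\<lambda>y. ennreal (g2 y)) x) (p2 x))"
          using p2.s_pos[of x] by (intro order_trans[OF enn_powr_add_le] mult_right_mono) auto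
      qed auto
      also have "\<dots> = ennreal (2 powr P / A) *
        (enn_powr (riesz \<gamma> (\<lambda>y. ennreal (g1 y)) x) (p2 x) + enn_powr (riesz \<gamma> (\<lambda>y. ennreal (g2 y)) x) (p2 x))"
        using A by (simp add: mult.assoc[symmetric] flip: ennreal_mult')
      finally show ?thesis .
    qed
    have "(\<integral>\<^sup>+ x. enn_powr (riesz \<gamma> (\<lambda>y. ennreal (g y / A)) x) (p2 x) \<partial>lebesgue)
      \<le> (\<integral>\<^sup>+ x. ennreal (2 powr P / A) *
      (enn_powr (riesz \<gamma> (\<lambda>y. ennreal (g1 y)) x) (p2 x) + enn_powr (riesz \<gamma> (\<lambda>y. ennreal (g2 y)) x) (p2 x)) \<partial>lebesgue)"
      by (intro nn_integral_mono pw)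
    also have "\<dots> = ennreal (2 powr P / A) * ((\<integral>\<^sup>+ x. enn_powr (riesz \<gamma> (\<lambda>y. ennreal (g1 y)) x) (p2 x) \<partial>lebesgue)
       + (\<integral>\<^sup>+ x. enn_powr (riesz \<gamma> (\<lambda>y. ennreal (g2 y)) x) (p2 x) \<partial>lebesgue))"
      by (subst nn_integral_cmult, measurable, subst nn_integral_add) auto
    also have "\<dots> \<le> ennreal (2 powr P / A) * (ennreal A1 + ennreal A2)"
      by (intro mult_left_mono add_mono r1 r2) auto
    also have "\<dots> = ennreal (B / A)"
      using A1 A2 A by (simp add: B_def flip: ennreal_plus ennreal_mult')
    also have "\<dots> \<le> ennreal 1" using A B by (intro ennreal_leI) (simp add: divide_le_eq)
    finally show "(\<integral>\<^sup>+ x. enn_powr (riesz \<gamma> (\<lambda>y. ennreal (g y / A)) x) (p2 x) \<partial>lebesgue) \<le> 1" by simp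
  qed
qed

end

lemma half_powr: "(z / 2 :: real) powr - s = 2 powr s * z powr - s"
  by (simp add: powr_divide powr_minus divide_simps)

section \<open>The Luxemburg norm\<close>

definition modular :: "('a::euclidean_space \<Rightarrow> real) \<Rightarrow> ('a \<Rightarrow> real) \<Rightarrow> real \<Rightarrow> ennreal" where
  "modular p f \<mu> = (\<integral>\<^sup>+ x. ennreal ((\<bar>f x\<bar> / \<mu>) powr p x) \<partial>lebesgue)"

lemma var_norm_le: "0 < \<mu> \<Longrightarrow> modular p f \<mu> \<le> 1 \<Longrightarrow> var_norm p f \<le> ennreal \<mu>"
  unfolding var_norm_def modular_def by (intro INF_lower) auto

text \<open>Turns a bound that is linear in every admissible scaling into a bound by the infimum; if
  no scaling is admissible the right side is infinite because \<open>c > 0\<close>.\<close>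

lemma le_var_norm:
  assumes "\<And>\<mu>. 0 < \<mu> \<Longrightarrow> modular p f \<mu> \<le> 1 \<Longrightarrow> X \<le> ennreal c * ennreal \<mu>" and "0 < c"
  shows "X \<le> ennreal c * var_norm p f"
proof -
  have c: "ennreal c \<noteq> 0" "ennreal c \<noteq> top" using assms by auto
  have "X / ennreal c \<le> var_norm p f"
    unfolding var_norm_def
  proof (rule INF_greatest)
    fix \<mu> assume "\<mu> \<in> {lam. 0 < lam \<and> (\<integral>\<^sup>+ x. ennreal ((\<bar>f x\<bar> / lam) powr p x) \<partial>lebesgue) \<le> 1}"
    then have "X \<le> ennreal c * ennreal \<mu>" using assms by (auto simp: modular_def)
    then have "X / ennreal c \<le> ennreal c * ennreal \<mu> / ennreal c" by (rule divide_right_mono_ennreal)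
    also have "\<dots> = ennreal \<mu>" using c by (metis ennreal_mult_divide_eq mult.commute)
    finally show "X / ennreal c \<le> ennreal \<mu>" .
  qed
  then have "ennreal c * (X / ennreal c) \<le> ennreal c * var_norm p f" by (intro mult_left_mono) auto
  moreover have "ennreal c * (X / ennreal c) = X"
    using c by (metis ennreal_mult_divide_eq ennreal_times_divide mult.commute)
  ultimately show ?thesis by simp
qed

lemma modular_mono:
  assumes "\<And>x. \<bar>f x\<bar> \<le> \<bar>g x\<bar>" "0 < \<mu>" "\<And>x. 0 \<le> p x"
  shows "modular p f \<mu> \<le> modular p g \<mu>"
  unfolding modular_def using assms
  by (intro nn_integral_mono ennreal_leI powr_mono2 divide_right_mono) auto

lemma var_norm_mono:
  assumes "\<And>x. \<bar>f x\<bar> \<le> \<bar>g x\<bar>" "\<And>x. 0 \<le> p x"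
  shows "var_norm p f \<le> var_norm p g"
proof -
  have "var_norm p f \<le> ennreal 1 * var_norm p g"
  proof (rule le_var_norm)
    fix l :: real assume l: "0 < l" "modular p g l \<le> 1"
    then have "modular p f l \<le> 1"
      using assms by (intro order_trans[OF modular_mono[of f g l p] l(2)]) auto
    then show "var_norm p f \<le> ennreal 1 * ennreal l" using var_norm_le[OF l(1)] by simp
  qed simp
  then show ?thesis by simp
qed

lemma modular_antimono:
  assumes "\<And>x. 0 \<le> p x" "0 < \<mu>" "\<mu> \<le> \<mu>'"
  shows "modular p f \<mu>' \<le> modular p f \<mu>"
  unfolding modular_def using assms
  by (intro nn_integral_mono ennreal_leI powr_mono2 divide_left_mono) auto

definition loc_norm :: "('a::euclidean_space \<Rightarrow> real) \<Rightarrow> ('a \<Rightarrow> real) \<Rightarrow> 'a \<Rightarrow> real \<Rightarrow> ennreal" where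
  "loc_norm p f x R = var_norm p (\<lambda>y. f y * indicator (ball x R) y)"

lemma modular_ball:
  "modular p (\<lambda>y. f y * indicator (ball x R) y) \<mu> = ball_int (\<lambda>y. ennreal ((\<bar>f y\<bar> / \<mu>) powr p y)) x R"
  unfolding modular_def ball_int_def by (intro nn_integral_cong) (auto simp: indicator_def)

lemma loc_norm_mono:
  assumes "ball x R \<subseteq> ball x' R'" "\<And>x. 0 \<le> p x"
  shows "loc_norm p f x R \<le> loc_norm p f x' R'"
  unfolding loc_norm_def using assms by (intro var_norm_mono) (auto simp: indicator_def)

lemma borel_measurable_ball_int [measurable]:
  fixes g :: "'a::euclidean_space \<Rightarrow> ennreal"
  assumes [measurable]: "g \<in> borel_measurable lebesgue"
  shows "(\<lambda>x. ball_int g x R) \<in> borel_measurable lebesgue"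
proof -
  have "(\<lambda>x. ball_int g x R) = (\<lambda>x. \<integral>\<^sup>+ y. g y * (if dist (fst (x, y)) (snd (x, y)) < R then 1 else 0) \<partial>lebesgue)"
    unfolding ball_int_def by (intro ext nn_integral_cong) (simp add: indicator_def)
  also have "\<dots> \<in> borel_measurable lebesgue"
  proof (rule sigma_finite_measure.borel_measurable_nn_integral[OF sigma_finite_lebesgue])
    show "(\<lambda>(x, y). g y * (if dist (fst (x, y)) (snd (x, y)) < R then 1 else 0))
      \<in> borel_measurable (lebesgue \<Otimes>\<^sub>M lebesgue)"
      unfolding case_prod_beta prod.collapse by measurable
  qed
  finally show ?thesis .
qed

text \<open>The modular decreases in the scaling, so the norm is below \<open>y\<close> exactly if
  some rational scaling below \<open>y\<close> is admissible. The strict sublevel sets are thus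
  countable unions of sets given by integrals over balls.\<close>

lemma borel_measurable_loc_norm:
  fixes f p :: "'a::euclidean_space \<Rightarrow> real"
  assumes [measurable]: "f \<in> borel_measurable lebesgue" "p \<in> borel_measurable lebesgue"
    and p: "\<And>x. 0 \<le> p x"
  shows "(\<lambda>x. loc_norm p f x R) \<in> borel_measurable lebesgue"
proof (rule borel_measurableI_less)
  fix y :: ennreal
  let ?M = "\<lambda>l x. ball_int (\<lambda>z. ennreal ((\<bar>f z\<bar> / l) powr p z)) x R"
  have "{x \<in> space lebesgue. loc_norm p f x R < y}
    = (\<Union>l\<in>{l\<in>\<rat>. 0 < l \<and> ennreal l < y}. {x \<in> space lebesgue. ?M l x \<le> 1})"
  proof (intro set_eqI iffI)
    fix x assume "x \<in> {x \<in> space lebesgue. loc_norm p f x R < y}"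
    then obtain l where l: "0 < l" "?M l x \<le> 1" "ennreal l < y"
      unfolding loc_norm_def var_norm_def modular_ball[symmetric, unfolded modular_def]
      by (auto simp: INF_less_iff modular_ball modular_def)
    obtain z where z: "ennreal l < ennreal z" "ennreal z < y" "0 \<le> z"
    proof -
      obtain c where "ennreal l < c" "c < y" using dense l(3) by blast
      then show ?thesis by (cases c) (auto intro: that)
    qed
    have "l < z" using z l by (simp add: ennreal_less_iff)
    then obtain k where k: "k \<in> \<rat>" "l < k" "k < z" using Rats_dense_in_real by blast
    have "?M k x \<le> 1"
      using modular_antimono[where p=p and f="\<lambda>y. f y * indicator (ball x R) y" and \<mu>=l and \<mu>'=k] p k l(1,2)
      by (simp add: modular_ball)
    moreover have "ennreal k < y" using k z l by (metis ennreal_less_iff less_trans less_imp_le less_le_trans)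
    ultimately show "x \<in> (\<Union>l\<in>{l\<in>\<rat>. 0 < l \<and> ennreal l < y}. {x \<in> space lebesgue. ?M l x \<le> 1})"
      using k l by (auto intro!: bexI[of _ k])
  next
    fix x assume "x \<in> (\<Union>l\<in>{l\<in>\<rat>. 0 < l \<and> ennreal l < y}. {x \<in> space lebesgue. ?M l x \<le> 1})"
    then obtain l where l: "0 < l" "ennreal l < y" "?M l x \<le> 1" by blast
    then have "loc_norm p f x R \<le> ennreal l"
      unfolding loc_norm_def by (intro var_norm_le) (simp_all add: modular_ball)
    with l show "x \<in> {x \<in> space lebesgue. loc_norm p f x R < y}" by auto
  qed
  also have "\<dots> \<in> sets lebesgue"
  proof (rule sets.countable_UN'')
    show "{x \<in> space lebesgue. ?M l x \<le> 1} \<in> sets lebesgue" for l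
      by measurable
    show "countable {l\<in>\<rat>. 0 < l \<and> ennreal l < y}"
      by (rule countable_subset[OF _ countable_rat]) auto
  qed
  finally show "{x \<in> space lebesgue. loc_norm p f x R < y} \<in> sets lebesgue" .
qed

text \<open>This needs no integrability: \<open>frac_int\<close> is a Bochner integral, hence 0 where the integral diverges.\<close>

lemma frac_int_le_riesz:
  fixes f :: "'a::euclidean_space \<Rightarrow> real"
  shows "ennreal \<bar>frac_int \<gamma> f x\<bar> \<le> riesz \<gamma> (\<lambda>y. ennreal \<bar>f y\<bar>) x"
proof (cases "integrable lebesgue (\<lambda>y. f y / norm (x - y) powr (real DIM('a) - \<gamma>))")
  case True
  have "ennreal \<bar>frac_int \<gamma> f x\<bar> \<le> (\<integral>\<^sup>+ y. ennreal (norm (f y / norm (x - y) powr (real DIM('a) - \<gamma>))) \<partial>lebesgue)"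
    unfolding frac_int_def real_norm_def[symmetric] by (rule integral_norm_bound_ennreal[OF True])
  also have "\<dots> = riesz \<gamma> (\<lambda>y. ennreal \<bar>f y\<bar>) x"
    unfolding riesz_def
    by (intro nn_integral_cong, simp only: powr_minus)
       (simp add: ennreal_mult'[symmetric] divide_inverse abs_mult)
  finally show ?thesis .
next
  case False
  then show ?thesis by (simp add: frac_int_def not_integrable_integral_eq)
qed

lemma borel_measurable_frac_int:
  fixes f :: "'a::euclidean_space \<Rightarrow> real"
  assumes [measurable]: "f \<in> borel_measurable lebesgue"
  shows "frac_int \<gamma> f \<in> borel_measurable lebesgue"
proof -
  have "frac_int \<gamma> f = (\<lambda>x. \<integral> y. f y / dist (fst (x, y)) (snd (x, y)) powr (real DIM('a) - \<gamma>) \<partial>lebesgue)"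
    by (simp add: frac_int_def dist_norm fun_eq_iff)
  also have "\<dots> \<in> borel_measurable lebesgue"
  proof (rule sigma_finite_measure.borel_measurable_lebesgue_integral[OF sigma_finite_lebesgue])
    show "(\<lambda>(x, y). f y / dist (fst (x, y)) (snd (x, y)) powr (real DIM('a) - \<gamma>))
      \<in> borel_measurable (lebesgue \<Otimes>\<^sub>M lebesgue)"
      unfolding case_prod_beta prod.collapse by measurable
  qed
  finally show ?thesis .
qed

section \<open>Local estimate for the potential of a function\<close>

context sobolev_pair
begin

lemma ball_int_le_loc_norm:
  "\<exists>A\<ge>1. \<forall>f x R. f \<in> borel_measurable lebesgue \<longrightarrow> 0 < R \<longrightarrow>
     ball_int (\<lambda>y. ennreal \<bar>f y\<bar>) x R
      \<le> ennreal (A * (R powr (real DIM('a) - \<gamma>) / Phi p2 p20 x R)) * loc_norm p1 f x R"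
proof -
  obtain A where A: "1 \<le> A" "\<And>(g :: 'a \<Rightarrow> real) x R. \<lbrakk>g \<in> borel_measurable lebesgue; \<forall>y. 0 \<le> g y; 0 < R;
     ball_int (\<lambda>y. ennreal (g y powr p1 y)) x R \<le> 1\<rbrakk> \<Longrightarrow>
     ball_int (\<lambda>y. ennreal (g y)) x R \<le> ennreal (A * (R powr (real DIM('a) - \<gamma>) / Phi p2 p20 x R))"
    using ball_int_le_Phi2 by blast
  show ?thesis
  proof (intro exI[of _ A] conjI allI impI A)
    fix f :: "'a \<Rightarrow> real" and x :: 'a and R :: real
    assume [measurable]: "f \<in> borel_measurable lebesgue" and R: "0 < R"
    let ?c = "A * (R powr (real DIM('a) - \<gamma>) / Phi p2 p20 x R)"
    have c: "0 < ?c" using A R Phi_pos[OF R, of p2 p20 x] by simp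
    show "ball_int (\<lambda>y. ennreal \<bar>f y\<bar>) x R \<le> ennreal ?c * loc_norm p1 f x R"
      unfolding loc_norm_def
    proof (rule le_var_norm[OF _ c])
      fix \<mu> :: real assume l: "0 < \<mu>" "modular p1 (\<lambda>y. f y * indicator (ball x R) y) \<mu> \<le> 1"
      have "ball_int (\<lambda>y. ennreal (\<bar>f y\<bar> / \<mu>)) x R \<le> ennreal ?c"
        using l R by (intro A) (auto simp: modular_ball)
      moreover have "ball_int (\<lambda>y. ennreal \<bar>f y\<bar>) x R = ennreal \<mu> * ball_int (\<lambda>y. ennreal (\<bar>f y\<bar> / \<mu>)) x R"
        unfolding ball_int_def using l
        by (subst nn_integral_cmult[symmetric]) (auto simp: mult.assoc[symmetric] simp flip: ennreal_mult')
      ultimately show "ball_int (\<lambda>y. ennreal \<bar>f y\<bar>) x R \<le> ennreal ?c * ennreal \<mu>"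
        by (metis mult.commute mult_left_mono zero_le)
    qed
  qed
qed

text \<open>For \<open>y\<close> in \<open>ball x r\<close> and \<open>z\<close> outside
  \<open>ball x (2 * r)\<close> the kernels at \<open>y\<close> and at \<open>x\<close> agree up to
  a factor, so the dyadic sum can be centred at \<open>x\<close> and does not depend on
  \<open>y\<close>. The exponent \<open>j + 2\<close> comes from starting at radius
  \<open>2 * r\<close> and using the outer radius of each shell.\<close>

lemma riesz_far_loc_norm:
  "\<exists>A\<ge>1. \<forall>f x y r. f \<in> borel_measurable lebesgue \<longrightarrow> 0 < r \<longrightarrow> y \<in> ball x r \<longrightarrow>
     riesz \<gamma> (\<lambda>z. ennreal \<bar>f z\<bar> * indicator (- ball x (2 * r)) z) y
      \<le> ennreal A * (\<Sum>j. ennreal (1 / Phi p2 p20 x (2^(j+2) * r)) * loc_norm p1 f x (2^(j+2) * r))"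
proof -
  let ?s = "real DIM('a) - \<gamma>"
  obtain A where A: "1 \<le> A" "\<And>(f :: 'a \<Rightarrow> real) x R. \<lbrakk>f \<in> borel_measurable lebesgue; 0 < R\<rbrakk> \<Longrightarrow>
     ball_int (\<lambda>y. ennreal \<bar>f y\<bar>) x R \<le> ennreal (A * (R powr ?s / Phi p2 p20 x R)) * loc_norm p1 f x R"
    using ball_int_le_loc_norm by blast
  have s: "0 \<le> ?s" using \<gamma>_less by simp
  show ?thesis
  proof (intro exI[of _ "2 powr ?s * (2 powr ?s * A)"] conjI allI impI)
    have "1 * (1 * 1) \<le> 2 powr ?s * (2 powr ?s * A)"
      using A s by (intro mult_mono) (auto simp: ge_one_powr_ge_zero)
    then show "1 \<le> 2 powr ?s * (2 powr ?s * A)" by simp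
    fix f :: "'a \<Rightarrow> real" and x y :: 'a and r :: real
    assume f [measurable]: "f \<in> borel_measurable lebesgue" and r: "0 < r" and y: "y \<in> ball x r"
    let ?F = "\<lambda>j. loc_norm p1 f x (2^(j+2) * r)"
    have "riesz \<gamma> (\<lambda>z. ennreal \<bar>f z\<bar> * indicator (- ball x (2 * r)) z) y
      \<le> (\<integral>\<^sup>+ z. ennreal (2 powr ?s) * (ennreal \<bar>f z\<bar> * ennreal (norm (x - z) powr - ?s) * indicator (- ball x (2 * r)) z) \<partial>lebesgue)"
      unfolding riesz_def
    proof (rule nn_integral_mono)
      fix z
      show "ennreal \<bar>f z\<bar> * indicator (- ball x (2 * r)) z * ennreal (norm (y - z) powr - ?s)
        \<le> ennreal (2 powr ?s) * (ennreal \<bar>f z\<bar> * ennreal (norm (x - z) powr - ?s) * indicator (- ball x (2 * r)) z)"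
      proof (cases "z \<in> ball x (2 * r)")
        case False
        then have xz: "2 * r \<le> norm (x - z)" by (simp add: dist_norm)
        have "norm (x - z) \<le> norm (x - y) + norm (y - z)" using norm_triangle_ineq[of "x - y" "y - z"] by simp
        moreover have "norm (x - y) < r" using y by (simp add: dist_norm)
        ultimately have "norm (x - z) / 2 \<le> norm (y - z)" using xz by simp
        then have "norm (y - z) powr - ?s \<le> (norm (x - z) / 2) powr - ?s"
          using xz r s by (intro powr_mono2') auto
        also have "\<dots> = 2 powr ?s * norm (x - z) powr - ?s"
          by (rule half_powr)
        finally have "ennreal (norm (y - z) powr - ?s) \<le> ennreal (2 powr ?s) * ennreal (norm (x - z) powr - ?s)"
          by (simp add: ennreal_mult'[symmetric] ennreal_leI)
        then have "ennreal \<bar>f z\<bar> * ennreal (norm (y - z) powr - ?s)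
          \<le> ennreal \<bar>f z\<bar> * (ennreal (2 powr ?s) * ennreal (norm (x - z) powr - ?s))" by (rule mult_left_mono) simp
        with False show ?thesis by (simp add: mult_ac)
      qed simp
    qed
    also have "\<dots> = ennreal (2 powr ?s) * (\<integral>\<^sup>+ z. ennreal \<bar>f z\<bar> * ennreal (norm (x - z) powr - ?s) * indicator (- ball x (2 * r)) z \<partial>lebesgue)"
      by (rule nn_integral_cmult) measurable
    also have "\<dots> \<le> ennreal (2 powr ?s) * (\<Sum>j. ennreal ((2^j * (2 * r)) powr - ?s) * ball_int (\<lambda>z. ennreal \<bar>f z\<bar>) x (2^(j+1) * (2 * r)))"
      using r s by (intro mult_left_mono riesz_far_le) auto
    also have "(\<Sum>j. ennreal ((2^j * (2 * r)) powr - ?s) * ball_int (\<lambda>z. ennreal \<bar>f z\<bar>) x (2^(j+1) * (2 * r)))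
      \<le> (\<Sum>j. ennreal (2 powr ?s * A) * (ennreal (1 / Phi p2 p20 x (2^(j+2) * r)) * ?F j))"
    proof (intro suminf_le summableI)
      fix j :: nat
      define R where "R = 2^(j+2) * r"
      have R: "0 < R" "2^(j+1) * (2 * r) = R" "2^j * (2 * r) = R / 2" using r by (auto simp: R_def)
      have "ennreal ((R / 2) powr - ?s) * ball_int (\<lambda>z. ennreal \<bar>f z\<bar>) x R
        \<le> ennreal ((R / 2) powr - ?s) * (ennreal (A * (R powr ?s / Phi p2 p20 x R)) * loc_norm p1 f x R)"
        by (intro mult_left_mono A f R) simp
      also have "\<dots> = ennreal ((R / 2) powr - ?s * (A * (R powr ?s / Phi p2 p20 x R))) * loc_norm p1 f x R"
        by (subst ennreal_mult') (simp_all only: mult.assoc powr_ge_zero)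
      also have "(R / 2) powr - ?s * (A * (R powr ?s / Phi p2 p20 x R)) = (2 powr ?s * A) * (1 / Phi p2 p20 x R)"
      proof -
        have e: "R powr - ?s * R powr ?s = 1" using R by (simp only: powr_add[symmetric]) simp
        have "(R / 2) powr - ?s * (A * (R powr ?s / Phi p2 p20 x R))
          = (2 powr ?s * A) * (1 / Phi p2 p20 x R) * (R powr - ?s * R powr ?s)"
          unfolding half_powr by (simp only: divide_inverse mult_ac mult_1_left)
        then show ?thesis unfolding e by (simp only: mult_1_right)
      qed
      also have "ennreal \<dots> = ennreal (2 powr ?s * A) * ennreal (1 / Phi p2 p20 x R)"
        using A by (intro ennreal_mult') simp
      finally show "ennreal ((2^j * (2 * r)) powr - ?s) * ball_int (\<lambda>z. ennreal \<bar>f z\<bar>) x (2^(j+1) * (2 * r))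
        \<le> ennreal (2 powr ?s * A) * (ennreal (1 / Phi p2 p20 x (2^(j+2) * r)) * ?F j)"
        unfolding R R_def[symmetric] by (simp add: mult.assoc)
    qed
    also have "\<dots> = ennreal (2 powr ?s * A) * (\<Sum>j. ennreal (1 / Phi p2 p20 x (2^(j+2) * r)) * ?F j)"
      by (rule ennreal_suminf_cmult)
    also have "ennreal (2 powr ?s) * \<dots> = ennreal (2 powr ?s * (2 powr ?s * A)) * (\<Sum>j. ennreal (1 / Phi p2 p20 x (2^(j+2) * r)) * ?F j)"
      by (subst ennreal_mult'[of "2 powr ?s"]) (simp_all only: mult.assoc powr_ge_zero)
    finally show "riesz \<gamma> (\<lambda>z. ennreal \<bar>f z\<bar> * indicator (- ball x (2 * r)) z) y
      \<le> ennreal (2 powr ?s * (2 powr ?s * A)) * (\<Sum>j. ennreal (1 / Phi p2 p20 x (2^(j+2) * r)) * ?F j)"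
      by (simp add: mult_left_mono)
  qed
qed

text \<open>The far part is bounded by a constant on \<open>ball x r\<close>; its norm there is that
  constant times the norm of an indicator, which yields the factor \<open>Phi p2 p20 x r\<close>.
  The near part is covered by \<open>hls_modular\<close>. Both enter one modular.\<close>

lemma local_estimate:
  "\<exists>C\<ge>1. \<forall>f x r. f \<in> borel_measurable lebesgue \<longrightarrow> 0 < r \<longrightarrow>
     loc_norm p2 (frac_int \<gamma> f) x r \<le> ennreal C * (loc_norm p1 f x (2 * r)
       + (\<Sum>j. ennreal (Phi p2 p20 x r / Phi p2 p20 x (2^(j+2) * r)) * loc_norm p1 f x (2^(j+2) * r)))"
proof -
  obtain A1 where A1: "1 \<le> A1" "\<And>(f :: 'a \<Rightarrow> real) x y r. \<lbrakk>f \<in> borel_measurable lebesgue; 0 < r; y \<in> ball x r\<rbrakk> \<Longrightarrow>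
     riesz \<gamma> (\<lambda>z. ennreal \<bar>f z\<bar> * indicator (- ball x (2 * r)) z) y
      \<le> ennreal A1 * (\<Sum>j. ennreal (1 / Phi p2 p20 x (2^(j+2) * r)) * loc_norm p1 f x (2^(j+2) * r))"
    using riesz_far_loc_norm by blast
  obtain A2 where A2: "1 \<le> A2" "\<And>g :: 'a \<Rightarrow> real. \<lbrakk>g \<in> borel_measurable lebesgue; \<forall>y. 0 \<le> g y;
     (\<integral>\<^sup>+ y. ennreal (g y powr p1 y) \<partial>lebesgue) \<le> 1\<rbrakk> \<Longrightarrow>
     (\<integral>\<^sup>+ x. enn_powr (riesz \<gamma> (\<lambda>y. ennreal (g y / A2)) x) (p2 x) \<partial>lebesgue) \<le> 1"
    using hls_modular by blast
  obtain A3 where A3: "1 \<le> A3" "\<And>x R. 0 < R \<Longrightarrow> ball_int (\<lambda>y. ennreal (Phi p2 p20 x R powr - p2 y)) x R \<le> ennreal A3"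
    using p2.Phi_modular_bound by blast
  define c where "c = max A1 A2"
  have c: "1 \<le> c" "A1 \<le> c" "A2 \<le> c" using A1 by (auto simp: c_def)
  \<comment> \<open>Makes the final modular equal to at most 1: the 2 comes from splitting the power
    of a sum, the 1 from the near part and \<open>A3\<close> from the constant far part.\<close>
  define D where "D = 2 * c * (1 + A3)"
  have D: "2 * c \<le> D" "2 * c / D * (1 + A3) = 1" "0 < D" "1 \<le> D"
    using c A3 mult_mono[of 1 "2 * c" 1 "1 + A3"] by (auto simp: D_def)
  show ?thesis
  proof (intro exI[of _ D] conjI allI impI D(4))
    fix f :: "'a \<Rightarrow> real" and x :: 'a and r :: real
    assume f [measurable]: "f \<in> borel_measurable lebesgue" and r: "0 < r"
    let ?\<phi> = "Phi p2 p20 x r"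
    have \<phi>: "0 < ?\<phi>" by (rule Phi_pos[OF r])
    let ?S = "\<Sum>j. ennreal (Phi p2 p20 x r / Phi p2 p20 x (2^(j+2) * r)) * loc_norm p1 f x (2^(j+2) * r)"
    have S: "(\<Sum>j. ennreal (1 / Phi p2 p20 x (2^(j+2) * r)) * loc_norm p1 f x (2^(j+2) * r)) = ennreal (1 / ?\<phi>) * ?S"
    proof (subst ennreal_suminf_cmult[symmetric], rule suminf_cong)
      fix j :: nat
      have "1 / Phi p2 p20 x (2^(j+2) * r) = 1 / ?\<phi> * (?\<phi> / Phi p2 p20 x (2^(j+2) * r))" using \<phi> by simp
      then show "ennreal (1 / Phi p2 p20 x (2^(j+2) * r)) * loc_norm p1 f x (2^(j+2) * r)
        = ennreal (1 / ?\<phi>) * (ennreal (?\<phi> / Phi p2 p20 x (2^(j+2) * r)) * loc_norm p1 f x (2^(j+2) * r))"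
        using \<phi> by (simp only: ennreal_mult' mult.assoc divide_nonneg_pos zero_le_one)
    qed
    show "loc_norm p2 (frac_int \<gamma> f) x r \<le> ennreal D * (loc_norm p1 f x (2 * r) + ?S)"
    proof (cases "?S")
      case top
      then show ?thesis using D(3) by (simp add: ennreal_mult_top)
    next
      case (real s)
      \<comment> \<open>\<open>le_var_norm\<close> needs a bound proportional to the scaling, so the
        additive far contribution \<open>D * s\<close> is first moved to the left by truncated
        subtraction.\<close>
      have "loc_norm p2 (frac_int \<gamma> f) x r - ennreal (D * s) \<le> ennreal D * var_norm p1 (\<lambda>y. f y * indicator (ball x (2 * r)) y)"
      proof (rule le_var_norm[OF _ D(3)])
        fix \<mu> :: real assume l: "0 < \<mu>" "modular p1 (\<lambda>y. f y * indicator (ball x (2 * r)) y) \<mu> \<le> 1"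
        define g where "g = (\<lambda>y. \<bar>f y * indicator (ball x (2 * r)) y\<bar> / \<mu>)"
        have [measurable]: "g \<in> borel_measurable lebesgue" unfolding g_def by measurable
        define U where "U = riesz \<gamma> (\<lambda>y. ennreal (g y / A2))"
        have [measurable]: "U \<in> borel_measurable lebesgue" unfolding U_def by measurable
        have U: "(\<integral>\<^sup>+ x. enn_powr (U x) (p2 x) \<partial>lebesgue) \<le> 1"
          unfolding U_def using l by (intro A2) (auto simp: g_def modular_def)
        let ?\<Lambda> = "D * (\<mu> + s)"
        have \<Lambda>: "0 < ?\<Lambda>" using D l real by simp
        have If: "ennreal \<bar>frac_int \<gamma> f y / ?\<Lambda>\<bar> \<le> ennreal (c / D) * (U y + ennreal (1 / ?\<phi>))" if y: "y \<in> ball x r" for y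
        proof -
          have "ennreal \<bar>frac_int \<gamma> f y\<bar> \<le> riesz \<gamma> (\<lambda>z. ennreal \<bar>f z\<bar>) y" by (rule frac_int_le_riesz)
          also have "(\<lambda>z. ennreal \<bar>f z\<bar>) = (\<lambda>z. ennreal (\<mu> * A2) * ennreal (g z / A2) + ennreal \<bar>f z\<bar> * indicator (- ball x (2 * r)) z)"
            using l A2 by (auto simp: g_def indicator_def fun_eq_iff simp flip: ennreal_mult')
          also have "riesz \<gamma> \<dots> y = ennreal (\<mu> * A2) * U y + riesz \<gamma> (\<lambda>z. ennreal \<bar>f z\<bar> * indicator (- ball x (2 * r)) z) y"
            unfolding U_def by (subst riesz_add) (auto simp: riesz_cmult)
          also have "\<dots> \<le> ennreal (\<mu> * A2) * U y + ennreal A1 * (ennreal (1 / ?\<phi>) * ennreal s)"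
            using A1(2)[OF f r y] unfolding S real(2) by (rule add_left_mono)
          also have "\<dots> = ennreal (\<mu> * A2) * U y + ennreal (A1 * s) * ennreal (1 / ?\<phi>)"
            using A1 real(1) by (simp add: ennreal_mult mult_ac)
          also have "\<dots> \<le> ennreal (c * (\<mu> + s)) * U y + ennreal (c * (\<mu> + s)) * ennreal (1 / ?\<phi>)"
          proof (intro add_mono mult_right_mono ennreal_leI)
            have "\<mu> * A2 = A2 * \<mu>" by simp
            also have "\<dots> \<le> c * (\<mu> + s)" using c l real(1) by (intro mult_mono) auto
            finally show "\<mu> * A2 \<le> c * (\<mu> + s)" .
            show "A1 * s \<le> c * (\<mu> + s)" using c l real(1) by (intro mult_mono) auto
          qed auto
          also have "\<dots> = ennreal (c * (\<mu> + s)) * (U y + ennreal (1 / ?\<phi>))" by (simp add: distrib_left)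
          finally have "ennreal (1 / ?\<Lambda>) * ennreal \<bar>frac_int \<gamma> f y\<bar> \<le> ennreal (1 / ?\<Lambda>) * (ennreal (c * (\<mu> + s)) * (U y + ennreal (1 / ?\<phi>)))"
            by (rule mult_left_mono) simp
          also have "\<dots> = ennreal (1 / ?\<Lambda> * (c * (\<mu> + s))) * (U y + ennreal (1 / ?\<phi>))"
            using \<Lambda> by (subst ennreal_mult') (simp_all only: mult.assoc divide_nonneg_pos zero_le_one)
          also have "1 / ?\<Lambda> * (c * (\<mu> + s)) = c / D" using D(3) l(1) real(1) by (simp add: add_pos_nonneg less_imp_neq[symmetric])
          finally show ?thesis using \<Lambda> by (simp add: abs_divide flip: ennreal_mult')
        qed
        have "modular p2 (\<lambda>y. frac_int \<gamma> f y * indicator (ball x r) y) ?\<Lambda>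
          = (\<integral>\<^sup>+ y. ennreal ((\<bar>frac_int \<gamma> f y\<bar> / ?\<Lambda>) powr p2 y) * indicator (ball x r) y \<partial>lebesgue)"
          unfolding modular_ball ball_int_def ..
        also have "\<dots> \<le> (\<integral>\<^sup>+ y. ennreal (2 * c / D) * (enn_powr (U y) (p2 y) +
            ennreal (?\<phi> powr - p2 y) * indicator (ball x r) y) \<partial>lebesgue)"
        proof (rule nn_integral_mono)
          fix y
          show "ennreal ((\<bar>frac_int \<gamma> f y\<bar> / ?\<Lambda>) powr p2 y) * indicator (ball x r) y
            \<le> ennreal (2 * c / D) * (enn_powr (U y) (p2 y) + ennreal (?\<phi> powr - p2 y) * indicator (ball x r) y)"
          proof (cases "y \<in> ball x r")
            case True
            have "ennreal ((\<bar>frac_int \<gamma> f y\<bar> / ?\<Lambda>) powr p2 y) = enn_powr (ennreal \<bar>frac_int \<gamma> f y / ?\<Lambda>\<bar>) (p2 y)"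
              using \<Lambda> by (simp add: enn_powr_ennreal abs_divide)
            also have "\<dots> \<le> enn_powr (ennreal (c / D) * (U y + ennreal (1 / ?\<phi>))) (p2 y)"
              using If[OF True] p2.s_pos[of y] by (intro enn_powr_mono) auto
            also have "\<dots> = ennreal ((c / D) powr p2 y) * enn_powr (U y + ennreal (1 / ?\<phi>)) (p2 y)"
              using c D p2.s_pos[of y] by (simp add: enn_powr_mult enn_powr_ennreal)
            also have "\<dots> \<le> ennreal ((c / D) powr p2 y) * (ennreal (2 powr p2 y) * (enn_powr (U y) (p2 y) + enn_powr (ennreal (1 / ?\<phi>)) (p2 y)))"
              using p2.s_pos[of y] by (intro mult_left_mono enn_powr_add_le) auto
            also have "\<dots> = ennreal ((2 * c / D) powr p2 y) * (enn_powr (U y) (p2 y) + ennreal (?\<phi> powr - p2 y))"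
            proof -
              have "(2 * c / D) powr p2 y = (c / D) powr p2 y * 2 powr p2 y"
                by (simp add: powr_mult powr_divide)
              moreover have "enn_powr (ennreal (1 / ?\<phi>)) (p2 y) = ennreal (?\<phi> powr - p2 y)"
                using \<phi> by (simp add: enn_powr_ennreal powr_divide powr_minus_divide)
              ultimately show ?thesis by (simp add: ennreal_mult mult.assoc)
            qed
            also have "\<dots> \<le> ennreal (2 * c / D) * (enn_powr (U y) (p2 y) + ennreal (?\<phi> powr - p2 y))"
            proof (intro mult_right_mono ennreal_leI)
              have "(2 * c / D) powr p2 y \<le> (2 * c / D) powr 1"
                using D c p2.s_gt1[of y] by (intro powr_mono') auto
              then show "(2 * c / D) powr p2 y \<le> 2 * c / D" using D c by simp
            qed simp
            finally show ?thesis using True by simp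
          qed simp
        qed
        also have "\<dots> = ennreal (2 * c / D) * ((\<integral>\<^sup>+ y. enn_powr (U y) (p2 y) \<partial>lebesgue) + ball_int (\<lambda>y. ennreal (?\<phi> powr - p2 y)) x r)"
          unfolding ball_int_def by (subst nn_integral_cmult, measurable, subst nn_integral_add) auto
        also have "\<dots> \<le> ennreal (2 * c / D) * (1 + ennreal A3)"
          by (intro mult_left_mono add_mono U A3 r) auto
        also have "\<dots> = ennreal (2 * c / D * (1 + A3))"
        proof -
          have "1 + ennreal A3 = ennreal (1 + A3)" using A3 by simp
          then show ?thesis using c D A3 by (simp only: ennreal_mult'[symmetric] divide_nonneg_pos mult_nonneg_nonneg)
        qed
        also have "\<dots> = 1" unfolding D(2) by simp
        finally have "loc_norm p2 (frac_int \<gamma> f) x r \<le> ennreal ?\<Lambda>"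
          unfolding loc_norm_def by (intro var_norm_le \<Lambda>)
        also have "\<dots> = ennreal (D * \<mu>) + ennreal (D * s)"
          using D l real(1) by (simp add: distrib_left)
        finally show "loc_norm p2 (frac_int \<gamma> f) x r - ennreal (D * s) \<le> ennreal D * ennreal \<mu>"
          using D l by (simp add: ennreal_minus_le_iff ennreal_mult add.commute)
      qed
      then have "loc_norm p2 (frac_int \<gamma> f) x r \<le> ennreal (D * s) + ennreal D * loc_norm p1 f x (2 * r)"
        by (simp add: ennreal_minus_le_iff loc_norm_def)
      then show ?thesis using D real by (simp add: distrib_left ennreal_mult add.commute)
    qed
  qed
qed

end

section \<open>Sufficiency\<close>

text \<open>Spending half of the geometric decay, the sum is bounded by a constant times the supremum of its
  weighted terms, which replaces Minkowski's inequality.\<close>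

lemma nn_integral_power_suminf_le:
  assumes q: "0 < q" and \<epsilon>: "0 < \<epsilon>"
  shows "\<exists>C\<ge>0. \<forall>(a :: nat \<Rightarrow> 'a \<Rightarrow> ennreal) M N. (\<forall>j. a j \<in> borel_measurable M) \<longrightarrow>
    (\<forall>j. (\<integral>\<^sup>+ x. enn_powr (a j x) q \<partial>M) \<le> ennreal ((2^j) powr - (\<epsilon> * q)) * N) \<longrightarrow>
    (\<integral>\<^sup>+ x. enn_powr (\<Sum>j. a j x) q \<partial>M) \<le> ennreal C * N"
proof -
  define h where "h = \<epsilon> / 2"
  have h: "0 < h" "0 < h * q" "\<epsilon> = h + h" using \<epsilon> q by (auto simp: h_def)
  have lt1: "2 powr - z < 1" if "0 < z" for z :: real
    using powr_less_mono[of "-z" 0 2] that by simp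
  define K where "K = 1 / (1 - 2 powr - h)"
  define L where "L = 1 / (1 - 2 powr - (h * q))"
  have KL: "0 < K" "0 < L" using lt1 h by (auto simp: K_def L_def)
  show ?thesis
  proof (intro exI[of _ "K powr q * L"] conjI allI impI)
    show "0 \<le> K powr q * L" using KL by simp
    fix a :: "nat \<Rightarrow> 'a \<Rightarrow> ennreal" and M N
    assume meas: "\<forall>j. a j \<in> borel_measurable M"
      and le: "\<forall>j. (\<integral>\<^sup>+ x. enn_powr (a j x) q \<partial>M) \<le> ennreal ((2^j) powr - (\<epsilon> * q)) * N"
    have [measurable]: "a j \<in> borel_measurable M" for j using meas by blast
    let ?b = "\<lambda>j x. ennreal ((2^j) powr (h * q)) * enn_powr (a j x) q"
    have pw: "enn_powr (\<Sum>j. a j x) q \<le> ennreal (K powr q) * (\<Sum>j. ?b j x)" for x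
    proof -
      let ?T = "\<Sum>j. ?b j x"
      have aj: "a j x \<le> ennreal ((2^j) powr - h) * enn_powr ?T (1 / q)" for j
      proof -
        have "enn_powr (ennreal ((2^j) powr h) * a j x) q = ?b j x"
          using q by (simp add: enn_powr_mult enn_powr_ennreal powr_powr)
        also have "\<dots> \<le> ?T" by (rule suminf_ge_term_ennreal)
        finally have "enn_powr (enn_powr (ennreal ((2^j) powr h) * a j x) q) (1 / q) \<le> enn_powr ?T (1 / q)"
          using q by (intro enn_powr_mono) auto
        then have "ennreal ((2^j) powr h) * a j x \<le> enn_powr ?T (1 / q)"
          using q by (subst (asm) enn_powr_inverse) auto
        then have "ennreal ((2^j) powr - h) * (ennreal ((2^j) powr h) * a j x) \<le> ennreal ((2^j) powr - h) * enn_powr ?T (1 / q)"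
          by (rule mult_left_mono) simp
        moreover have "ennreal ((2^j) powr - h) * (ennreal ((2^j) powr h) * a j x) = a j x"
        proof -
          have "(2^j) powr - h * (2^j :: real) powr h = 1" by (simp add: powr_minus)
          then have "ennreal ((2^j) powr - h) * ennreal ((2^j) powr h) = 1" by (simp flip: ennreal_mult')
          then show ?thesis by (simp add: mult.assoc[symmetric])
        qed
        ultimately show ?thesis by simp
      qed
      have "(\<Sum>j. a j x) \<le> (\<Sum>j. enn_powr ?T (1 / q) * ennreal ((2^j) powr - h))"
        using aj by (intro suminf_le summableI) (simp add: mult.commute)
      also have "\<dots> = enn_powr ?T (1 / q) * ennreal K"
        unfolding K_def using h by (subst ennreal_suminf_cmult, subst suminf_geometric_powr) auto
      finally have "enn_powr (\<Sum>j. a j x) q \<le> enn_powr (enn_powr ?T (1 / q) * ennreal K) q"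
        using q by (intro enn_powr_mono) auto
      also have "\<dots> = ennreal (K powr q) * ?T"
        using q KL by (simp add: enn_powr_mult enn_powr_powr enn_powr_ennreal mult.commute)
      finally show ?thesis .
    qed
    have "(\<integral>\<^sup>+ x. enn_powr (\<Sum>j. a j x) q \<partial>M) \<le> (\<integral>\<^sup>+ x. ennreal (K powr q) * (\<Sum>j. ?b j x) \<partial>M)"
      by (intro nn_integral_mono pw)
    also have "\<dots> = ennreal (K powr q) * (\<integral>\<^sup>+ x. (\<Sum>j. ?b j x) \<partial>M)"
      by (rule nn_integral_cmult) measurable
    also have "(\<integral>\<^sup>+ x. (\<Sum>j. ?b j x) \<partial>M) = (\<Sum>j. \<integral>\<^sup>+ x. ?b j x \<partial>M)"
      by (rule nn_integral_suminf) measurable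
    also have "\<dots> = (\<Sum>j. ennreal ((2^j) powr (h * q)) * (\<integral>\<^sup>+ x. enn_powr (a j x) q \<partial>M))"
      by (intro suminf_cong nn_integral_cmult) measurable
    also have "\<dots> \<le> (\<Sum>j. N * ennreal ((2^j) powr - (h * q)))"
    proof (intro suminf_le summableI)
      fix j :: nat
      have "ennreal ((2^j) powr (h * q)) * (\<integral>\<^sup>+ x. enn_powr (a j x) q \<partial>M)
        \<le> ennreal ((2^j) powr (h * q)) * (ennreal ((2^j) powr - (\<epsilon> * q)) * N)"
        using le by (intro mult_left_mono) auto
      also have "\<dots> = ennreal ((2^j) powr (h * q) * (2^j) powr - (\<epsilon> * q)) * N"
        by (simp add: ennreal_mult' mult.assoc)
      also have "(2^j) powr (h * q) * (2^j :: real) powr - (\<epsilon> * q) = (2^j) powr - (h * q)"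
        unfolding powr_add[symmetric] h(3) by (simp add: algebra_simps)
      finally show "ennreal ((2^j) powr (h * q)) * (\<integral>\<^sup>+ x. enn_powr (a j x) q \<partial>M) \<le> N * ennreal ((2^j) powr - (h * q))"
        by (simp add: mult.commute)
    qed
    also have "\<dots> = N * ennreal L"
      unfolding L_def using h by (subst ennreal_suminf_cmult, subst suminf_geometric_powr) auto
    also have "ennreal (K powr q) * (N * ennreal L) = ennreal (K powr q * L) * N"
      using KL by (simp add: ennreal_mult mult_ac)
    finally show "(\<integral>\<^sup>+ x. enn_powr (\<Sum>j. a j x) q \<partial>M) \<le> ennreal (K powr q * L) * N"
      by (simp add: mult_left_mono)
  qed
qed

lemma vol1_powr_le_max:
  assumes "\<bar>z\<bar> \<le> L"
  shows "vol1 TYPE('a::euclidean_space) powr z \<le> max (vol1 TYPE('a)) (1 / vol1 TYPE('a)) powr L"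
proof -
  let ?V = "vol1 TYPE('a)" and ?m = "max (vol1 TYPE('a)) (1 / vol1 TYPE('a))"
  have m1: "1 \<le> ?m" by (cases "1 \<le> ?V") (auto simp: le_max_iff_disj)
  have "?V powr z \<le> ?m powr \<bar>z\<bar>"
  proof (cases "0 \<le> z")
    case True
    then show ?thesis by (auto intro: powr_mono2)
  next
    case False
    then have "?V powr z = (1 / ?V) powr \<bar>z\<bar>" by (simp add: powr_divide powr_minus_divide)
    also have "\<dots> \<le> ?m powr \<bar>z\<bar>" by (intro powr_mono2) auto
    finally show ?thesis .
  qed
  also have "\<dots> \<le> ?m powr L" using assms m1 by (intro powr_mono) auto
  finally show ?thesis .
qed

section \<open>Weights of the target space and their behaviour over scales\<close>

locale fofana_pair = sobolev_pair p1 p2 p10 p20 a P K \<gamma>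
  for p1 p2 :: "'a::euclidean_space \<Rightarrow> real" and p10 p20 a P K \<gamma> :: real +
  fixes q \<beta> :: real
  assumes p2_less: "\<And>x. p2 x < \<beta>" and \<beta>_less: "\<beta> < q"
begin

definition wexp :: "'a \<Rightarrow> real" where
  "wexp x = 1 / \<beta> - 1 / p2 x - 1 / q"

text \<open>The weight of the target space. The source function is measured with it as well, which
  agrees with its own weight precisely under the scaling relation; this keeps \<alpha> out of the
  estimates.\<close>

definition wt :: "'a \<Rightarrow> real \<Rightarrow> real" where
  "wt x R = measure lebesgue (ball x R) powr wexp x"

text \<open>The degree of \<open>wt x R * R powr (n / p2 x)\<close> as a function of
  \<open>R\<close>, the same for all centres; it becomes the geometric decay rate over
  scales.\<close>

definition eps :: real where
  "eps = real DIM('a) * (1 / \<beta> - 1 / q)"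

lemma \<beta>_gt1: "1 < \<beta>" using p2_less[of 0] p2.s_gt1[of 0] by linarith
lemma q_gt1: "1 < q" using \<beta>_gt1 \<beta>_less by linarith

lemma eps_pos: "0 < eps"
  using \<beta>_gt1 \<beta>_less by (simp add: eps_def frac_less2)

lemma wexp_bounds: "\<bar>wexp x\<bar> \<le> 2" "wexp x < 0"
proof -
  have 1: "0 < 1 / z \<and> 1 / z < 1" if "1 < z" for z :: real using that by simp
  have "1 / \<beta> < 1 / p2 x" using p2_less[of x] p2.s_pos[of x] by (simp add: frac_less2)
  then show "\<bar>wexp x\<bar> \<le> 2" "wexp x < 0"
    using 1[OF \<beta>_gt1] 1[OF q_gt1] 1[OF p2.s_gt1[of x]] unfolding wexp_def by linarith+
qed

lemma wexp_eps: "real DIM('a) * wexp x = eps - real DIM('a) / p2 x"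
  by (simp add: wexp_def eps_def algebra_simps)

lemma wt_eq: "0 \<le> R \<Longrightarrow> wt x R = vol1 TYPE('a) powr wexp x * R powr (eps - real DIM('a) / p2 x)"
  unfolding wt_def by (subst measure_lebesgue_ball) (simp_all add: powr_mult powr_powr wexp_eps)

lemma wt_nonneg: "0 \<le> wt x R" by (simp add: wt_def)

lemma borel_measurable_wexp [measurable]: "wexp \<in> borel_measurable lebesgue"
  unfolding wexp_def[abs_def] by measurable

lemma borel_measurable_wt [measurable]: "0 \<le> R \<Longrightarrow> (\<lambda>x. wt x R) \<in> borel_measurable lebesgue"
  unfolding wt_def by (subst measure_lebesgue_ball) simp_all

lemma borel_measurable_Phi2 [measurable]: "(\<lambda>x. Phi p2 p20 x R) \<in> borel_measurable lebesgue"
  unfolding Phi_def near_def by measurable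

lemma borel_measurable_loc_norm1 [measurable]:
  assumes "f \<in> borel_measurable lebesgue"
  shows "(\<lambda>x. loc_norm p1 f x R) \<in> borel_measurable lebesgue"
  using assms p1.s_pos by (intro borel_measurable_loc_norm) (auto simp: less_imp_le)

lemma wt_near_ratio:
  assumes "0 < r" "r \<le> R" "near x R"
  shows "wt x r * (Phi p2 p20 x r / Phi p2 p20 x R) = (r / R) powr eps * wt x R"
proof -
  have nr: "near x r" using assms by (auto simp: near_def)
  have "wt x r * (Phi p2 p20 x r / Phi p2 p20 x R)
    = vol1 TYPE('a) powr wexp x * (r powr (eps - real DIM('a) / p2 x) * r powr (real DIM('a) / p2 x)) * R powr - (real DIM('a) / p2 x)"
    using assms nr by (simp add: wt_eq Phi_def powr_minus_divide)
  also have "r powr (eps - real DIM('a) / p2 x) * r powr (real DIM('a) / p2 x) = r powr eps"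
    by (simp add: powr_add[symmetric])
  also have "R powr - (real DIM('a) / p2 x) = R powr - eps * R powr (eps - real DIM('a) / p2 x)"
    by (simp add: powr_add[symmetric])
  also have "vol1 TYPE('a) powr wexp x * r powr eps * (R powr - eps * R powr (eps - real DIM('a) / p2 x)) = (r / R) powr eps * wt x R"
    using assms by (simp add: wt_eq powr_divide powr_minus_divide)
  finally show ?thesis .
qed

text \<open>The mismatch, to the power \<open>q\<close>, between the size
  \<open>R powr (n / p20)\<close> of the norm of a large indicator and the power
  \<open>R powr (n / p2 z)\<close> that the weight at the centre \<open>z\<close> expects.\<close>

definition kap :: "real \<Rightarrow> 'a \<Rightarrow> real" where
  "kap R z = R powr (real DIM('a) * q * (1 / p20 - 1 / p2 z))"

definition cV :: real where
  "cV = max (vol1 TYPE('a)) (1 / vol1 TYPE('a)) powr (2 * q)"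

lemma cV_pos: "0 < cV" by (simp add: cV_def max_def)

lemma vol1_powr_le:
  "vol1 TYPE('a) powr (wexp x * q) \<le> cV" "1 / cV \<le> vol1 TYPE('a) powr (wexp x * q)"
proof -
  let ?V = "vol1 TYPE('a)"
  have e: "\<bar>wexp x * q\<bar> \<le> 2 * q"
    using wexp_bounds[of x] q_gt1 mult_right_mono[of "\<bar>wexp x\<bar>" 2 q] by (simp add: abs_mult)
  show "?V powr (wexp x * q) \<le> cV" unfolding cV_def by (rule vol1_powr_le_max[OF e])
  have "?V powr - (wexp x * q) \<le> cV" unfolding cV_def using e by (intro vol1_powr_le_max) simp
  then show "1 / cV \<le> ?V powr (wexp x * q)"
    using cV_pos by (simp add: powr_minus_divide divide_simps mult.commute)
qed

text \<open>At radius \<open>r\<close> the mismatch is 1 in the near case and otherwise a power of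
  \<open>r\<close> with \<open>1 < r \<le> R\<close>; depending on the sign of the exponent it is at
  most 1 or at most \<open>kap R x\<close>.\<close>

lemma wt_Phi_le:
  assumes r: "0 < r" "r \<le> R" "1 < R"
  shows "(wt x r * Phi p2 p20 x r) powr q \<le> cV * r powr (eps * q) * (1 + kap R x)"
proof -
  let ?n = "real DIM('a)"
  define h where "h = Phi p2 p20 x r * r powr - (?n / p2 x)"
  have h0: "0 \<le> h" by (simp add: h_def Phi_def)
  have "wt x r * Phi p2 p20 x r = vol1 TYPE('a) powr wexp x * r powr eps * h"
    using r by (simp add: wt_eq h_def powr_diff powr_minus_divide)
  then have "(wt x r * Phi p2 p20 x r) powr q = vol1 TYPE('a) powr (wexp x * q) * r powr (eps * q) * h powr q"
    by (simp add: powr_mult powr_powr)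
  also have "\<dots> \<le> cV * r powr (eps * q) * (1 + kap R x)"
  proof (intro mult_mono vol1_powr_le)
    show "h powr q \<le> 1 + kap R x"
    proof (cases "near x r")
      case True
      then have "h = 1" using r by (simp add: h_def Phi_def powr_minus_divide)
      then show ?thesis by (simp add: kap_def)
    next
      case False
      then have r1: "1 < r" by (auto simp: near_def)
      define d where "d = ?n * q * (1 / p20 - 1 / p2 x)"
      have "h = r powr (?n / p20) * r powr - (?n / p2 x)" using False by (simp add: h_def Phi_def)
      also have "\<dots> = r powr (?n / p20 - ?n / p2 x)" by (simp add: powr_add[symmetric])
      finally have "h powr q = r powr d" by (simp add: powr_powr d_def algebra_simps)
      also have "\<dots> \<le> 1 + R powr d"
      proof (cases "0 \<le> d")
        case True
        then have "r powr d \<le> R powr d" using r by (intro powr_mono2) auto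
        then show ?thesis by simp
      next
        case False
        then have "r powr d \<le> r powr 0" using r1 by (intro powr_mono) auto
        then show ?thesis using r1 by (simp add: add_increasing2)
      qed
      finally show ?thesis by (simp add: kap_def d_def)
    qed
  qed (use cV_pos in auto)
  finally show ?thesis .
qed

text \<open>Up to powers of \<open>R\<close> that do not depend on \<open>z\<close>,
  \<open>kap\<close> is the \<open>q\<close>-th power of the weight itself. The radius
  \<open>5 * R\<close> is chosen because a ball of that size around any \<open>z\<close> in
  \<open>ball 0 (2 * R)\<close> contains \<open>ball 0 (3 * R)\<close>.\<close>

lemma kap_le_wt:
  assumes "1 < R"
  shows "kap R z \<le> cV * 5 powr (2 * real DIM('a) * q) * R powr - (eps * q) * R powr (real DIM('a) * q / p20) * wt z (5 * R) powr q"
proof -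
  let ?n = "real DIM('a)"
  have "wt z (5 * R) powr q = vol1 TYPE('a) powr (wexp z * q) * 5 powr (?n * wexp z * q) * R powr ((eps - ?n / p2 z) * q)"
    using assms by (simp add: wt_eq powr_mult powr_powr wexp_eps)
  also have "\<dots> \<ge> 1 / cV * 5 powr - (2 * ?n * q) * R powr ((eps - ?n / p2 z) * q)"
  proof (intro mult_right_mono mult_mono vol1_powr_le powr_mono)
    have "\<bar>?n * wexp z * q\<bar> \<le> ?n * 2 * q" using wexp_bounds(1)[of z] q_gt1
      by (simp add: abs_mult)
    then show "- (2 * ?n * q) \<le> ?n * wexp z * q" by linarith
  qed (use cV_pos in auto)
  finally have "cV * 5 powr (2 * ?n * q) * R powr - (eps * q) * R powr (?n * q / p20) * (1 / cV * 5 powr - (2 * ?n * q) * R powr ((eps - ?n / p2 z) * q))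
    \<le> cV * 5 powr (2 * ?n * q) * R powr - (eps * q) * R powr (?n * q / p20) * wt z (5 * R) powr q"
    using cV_pos by (intro mult_left_mono) auto
  moreover have "cV * 5 powr (2 * ?n * q) * R powr - (eps * q) * R powr (?n * q / p20) * (1 / cV * 5 powr - (2 * ?n * q) * R powr ((eps - ?n / p2 z) * q)) = kap R z"
  proof -
    have "cV * 5 powr (2 * ?n * q) * R powr - (eps * q) * R powr (?n * q / p20) * (1 / cV * 5 powr - (2 * ?n * q) * R powr ((eps - ?n / p2 z) * q))
      = (cV * (1 / cV)) * (5 powr (2 * ?n * q) * 5 powr - (2 * ?n * q)) * (R powr - (eps * q) * R powr (?n * q / p20) * R powr ((eps - ?n / p2 z) * q))"
      by (simp only: mult_ac)
    also have "cV * (1 / cV) = 1" using cV_pos by simp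
    also have "5 powr (2 * ?n * q) * 5 powr - (2 * ?n * q) = (1::real)" by (simp add: powr_minus)
    also have "R powr - (eps * q) * R powr (?n * q / p20) * R powr ((eps - ?n / p2 z) * q) = kap R z"
      unfolding powr_add[symmetric] kap_def by (simp add: algebra_simps)
    finally show ?thesis by simp
  qed
  ultimately show ?thesis by simp
qed

text \<open>\<open>kap\<close> may be tiny near the origin, but on points with norm at least
  \<open>R\<close> the decay condition bounds it below. These points fill a fixed fraction of the
  ball, so the integral of \<open>kap\<close> controls the whole volume.\<close>

lemma ball_volume_le_kap:
  assumes R: "1 < R"
  shows "ennreal (vol1 TYPE('a) * (2 * R) powr real DIM('a))
    \<le> ennreal (4 powr real DIM('a) * exp (real DIM('a) * q * K)) * ball_int (\<lambda>z. ennreal (kap R z)) 0 (2 * R)"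
proof -
  let ?n = "real DIM('a)"
  obtain b :: 'a where b: "norm b = 1" using vector_choose_size[of 1] by auto
  \<comment> \<open>The ball of radius \<open>R / 2\<close> around \<open>c\<close> lies between the
    spheres of radius \<open>R\<close> and \<open>2 * R\<close>; the \<open>4 powr n\<close> is its
    volume ratio to \<open>ball 0 (2 * R)\<close>.\<close>
  define c where "c = (3 * R / 2) *\<^sub>R b"
  have c: "norm c = 3 * R / 2" using b R by (simp add: c_def)
  have sub: "R \<le> norm z \<and> norm z < 2 * R" if "z \<in> ball c (R / 2)" for z
  proof -
    have "norm (c - z) < R / 2" using that by (simp add: dist_norm)
    moreover have "norm c \<le> norm (c - z) + norm z" "norm z \<le> norm c + norm (c - z)"
      using norm_triangle_ineq[of "c - z" z] norm_triangle_ineq[of c "z - c"] by (auto simp: norm_minus_commute)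
    ultimately show ?thesis using c by linarith
  qed
  have kap_ge: "exp (- (?n * q * K)) \<le> kap R z" if "z \<in> ball c (R / 2)" for z
  proof -
    have "0 \<le> ln R" using R by simp
    have "ln R \<le> ln (exp 1 + norm z)" using sub[OF that] R by (intro ln_mono) (auto simp: add_increasing)
    then have "\<bar>1 / p2 z - 1 / p20\<bar> * ln R \<le> \<bar>1 / p2 z - 1 / p20\<bar> * ln (exp 1 + norm z)" by (intro mult_left_mono) auto
    also have "\<dots> \<le> K" by (rule p2.decay)
    finally have 1: "\<bar>1 / p2 z - 1 / p20\<bar> * ln R \<le> K" .
    have "- ((1 / p20 - 1 / p2 z) * ln R) \<le> \<bar>(1 / p20 - 1 / p2 z) * ln R\<bar>" by (rule abs_ge_minus_self)
    also have "\<dots> = \<bar>1 / p2 z - 1 / p20\<bar> * ln R" using \<open>0 \<le> ln R\<close> by (simp add: abs_mult abs_minus_commute)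
    finally have "- K \<le> (1 / p20 - 1 / p2 z) * ln R" using 1 by linarith
    then have "?n * q * - K \<le> ?n * q * ((1 / p20 - 1 / p2 z) * ln R)" using q_gt1 by (intro mult_left_mono) auto
    then show ?thesis using R by (simp add: kap_def powr_def mult_ac)
  qed
  have "ennreal (vol1 TYPE('a) * (2 * R) powr ?n)
    = ennreal (4 powr ?n * exp (?n * q * K)) * (ennreal (exp (- (?n * q * K))) * ennreal (vol1 TYPE('a) * (R / 2) powr ?n))"
  proof -
    have "(2 * R) powr ?n = 4 powr ?n * (R / 2) powr ?n" by (simp add: powr_mult[symmetric])
    moreover have "exp (?n * q * K) * exp (- (?n * q * K)) = 1" by (simp add: exp_minus)
    ultimately have "vol1 TYPE('a) * (2 * R) powr ?n
      = 4 powr ?n * exp (?n * q * K) * (exp (- (?n * q * K)) * (vol1 TYPE('a) * (R / 2) powr ?n))"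
      by (simp add: mult_ac)
    then show ?thesis by (simp only: ennreal_mult' powr_ge_zero exp_ge_zero mult_nonneg_nonneg)
  qed
  also have "ennreal (exp (- (?n * q * K))) * ennreal (vol1 TYPE('a) * (R / 2) powr ?n)
    = (\<integral>\<^sup>+ z. ennreal (exp (- (?n * q * K))) * indicator (ball c (R / 2)) z \<partial>lebesgue)"
    using R by (simp add: nn_integral_cmult nn_integral_indicator_ball del: nn_integral_indicator)
  also have "\<dots> \<le> ball_int (\<lambda>z. ennreal (kap R z)) 0 (2 * R)"
    unfolding ball_int_def
  proof (rule nn_integral_mono)
    fix z
    show "ennreal (exp (- (?n * q * K))) * indicator (ball c (R / 2)) z \<le> ennreal (kap R z) * indicator (ball 0 (2 * R)) z"
      using kap_ge[of z] sub[of z] by (cases "z \<in> ball c (R / 2)") (auto intro!: ennreal_leI)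
  qed
  finally show ?thesis by (simp add: mult_left_mono)
qed

lemma borel_measurable_kap [measurable]: "kap R \<in> borel_measurable lebesgue"
  unfolding kap_def[abs_def] by measurable

text \<open>The geometric factor recovered on average over the centres: in the bound
  \<open>1 + kap R x\<close> the 1 is absorbed by \<open>ball_volume_le_kap\<close>, and
  \<open>kap_le_wt\<close> converts the rest into the weight at a larger scale.\<close>

lemma wt_Phi_integral_le:
  "\<exists>C\<ge>0. \<forall>r R. 0 < r \<longrightarrow> r \<le> R \<longrightarrow> 1 < R \<longrightarrow>
     ball_int (\<lambda>x. ennreal ((wt x r * Phi p2 p20 x r) powr q)) 0 (2 * R)
      \<le> ennreal (C * (r / R) powr (eps * q) * R powr (real DIM('a) * q / p20))
         * ball_int (\<lambda>z. ennreal (wt z (5 * R) powr q)) 0 (2 * R)"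
proof -
  let ?n = "real DIM('a)"
  define c1 where "c1 = 4 powr ?n * exp (?n * q * K)"
  define c2 where "c2 = cV * 5 powr (2 * ?n * q)"
  have c: "0 \<le> c1" "0 \<le> c2" using cV_pos by (auto simp: c1_def c2_def)
  show ?thesis
  proof (intro exI[of _ "cV * (1 + c1) * c2"] conjI allI impI)
    show "0 \<le> cV * (1 + c1) * c2" using c cV_pos by simp
    fix r R :: real assume r: "0 < r" "r \<le> R" "1 < R"
    let ?I = "ball_int (\<lambda>z. ennreal (kap R z)) 0 (2 * R)"
    let ?J = "ball_int (\<lambda>z. ennreal (wt z (5 * R) powr q)) 0 (2 * R)"
    define A where "A = cV * r powr (eps * q)"
    define B where "B = c2 * R powr - (eps * q) * R powr (?n * q / p20)"
    have AB: "0 \<le> A" "0 \<le> B" using cV_pos c by (auto simp: A_def B_def)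
    have "ball_int (\<lambda>x. ennreal ((wt x r * Phi p2 p20 x r) powr q)) 0 (2 * R)
      \<le> (\<integral>\<^sup>+ x. ennreal A * (indicator (ball 0 (2 * R)) x + ennreal (kap R x) * indicator (ball 0 (2 * R)) x) \<partial>lebesgue)"
      unfolding ball_int_def
    proof (rule nn_integral_mono)
      fix x
      have "ennreal ((wt x r * Phi p2 p20 x r) powr q) \<le> ennreal (A * (1 + kap R x))"
        using wt_Phi_le[OF r, of x] by (intro ennreal_leI) (simp add: A_def)
      also have "\<dots> = ennreal A * (1 + ennreal (kap R x))"
        using AB by (simp add: ennreal_mult' kap_def)
      finally show "ennreal ((wt x r * Phi p2 p20 x r) powr q) * indicator (ball 0 (2 * R)) x
        \<le> ennreal A * (indicator (ball 0 (2 * R)) x + ennreal (kap R x) * indicator (ball 0 (2 * R)) x)"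
        by (cases "x \<in> ball 0 (2 * R)") auto
    qed
    also have "\<dots> = ennreal A * (ennreal (vol1 TYPE('a) * (2 * R) powr ?n) + ?I)"
    proof -
      have "(\<integral>\<^sup>+ x. indicator (ball 0 (2 * R)) x + ennreal (kap R x) * indicator (ball 0 (2 * R)) x \<partial>lebesgue)
        = (\<integral>\<^sup>+ x. indicator (ball (0::'a) (2 * R)) x \<partial>lebesgue) + ?I"
        unfolding ball_int_def by (rule nn_integral_add) measurable
      also have "(\<integral>\<^sup>+ x. indicator (ball (0::'a) (2 * R)) x \<partial>lebesgue) = ennreal (vol1 TYPE('a) * (2 * R) powr ?n)"
        using r by (intro nn_integral_indicator_ball) simp
      finally show ?thesis by (subst nn_integral_cmult) auto
    qed
    also have "\<dots> \<le> ennreal A * (ennreal c1 * ?I + ?I)"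
      using ball_volume_le_kap[OF r(3)] by (intro mult_left_mono add_right_mono) (auto simp: c1_def)
    also have "\<dots> = ennreal (A * (1 + c1)) * ?I"
      using AB c by (simp add: ennreal_mult' distrib_left distrib_right mult.assoc add.commute)
    also have "?I \<le> ennreal B * ?J"
    proof -
      have "?I \<le> (\<integral>\<^sup>+ z. ennreal B * (ennreal (wt z (5 * R) powr q) * indicator (ball 0 (2 * R)) z) \<partial>lebesgue)"
        unfolding ball_int_def
      proof (rule nn_integral_mono)
        fix z
        have "ennreal (kap R z) \<le> ennreal (B * wt z (5 * R) powr q)"
          using kap_le_wt[OF r(3), of z] by (intro ennreal_leI) (simp add: B_def c2_def)
        also have "\<dots> = ennreal B * ennreal (wt z (5 * R) powr q)" using AB by (intro ennreal_mult') simp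
        finally show "ennreal (kap R z) * indicator (ball 0 (2 * R)) z
          \<le> ennreal B * (ennreal (wt z (5 * R) powr q) * indicator (ball 0 (2 * R)) z)"
          by (simp add: mult.assoc[symmetric] mult_right_mono)
      qed
      also have "\<dots> = ennreal B * ?J"
      proof -
        have [measurable]: "(\<lambda>z. wt z (5 * R)) \<in> borel_measurable lebesgue" using r by (intro borel_measurable_wt) simp
        show ?thesis unfolding ball_int_def by (rule nn_integral_cmult) measurable
      qed
      finally show ?thesis .
    qed
    also have "ennreal (A * (1 + c1)) * (ennreal B * ?J) = ennreal (A * (1 + c1) * B) * ?J"
      using AB c by (subst ennreal_mult'[of "A * (1 + c1)"]) (simp_all add: mult.assoc)
    also have "A * (1 + c1) * B = cV * (1 + c1) * c2 * (r / R) powr (eps * q) * R powr (?n * q / p20)"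
      using r by (simp add: A_def B_def powr_divide powr_minus_divide)
    finally show "ball_int (\<lambda>x. ennreal ((wt x r * Phi p2 p20 x r) powr q)) 0 (2 * R)
      \<le> ennreal (cV * (1 + c1) * c2 * (r / R) powr (eps * q) * R powr (?n * q / p20)) * ?J"
      by (simp add: mult_left_mono)
  qed
qed

end

context fofana_pair
begin

text \<open>The decay \<open>(r / R) powr (eps * q)\<close> is exact and pointwise at centres with
  \<open>near x R\<close>. All other centres lie in \<open>ball 0 (2 * R)\<close> and are handled by
  the averaged bound.\<close>

lemma term_estimate:
  "\<exists>C\<ge>0. \<forall>f N r R. f \<in> borel_measurable lebesgue \<longrightarrow>
     (\<forall>R>0. (\<integral>\<^sup>+ x. enn_powr (ennreal (wt x R) * loc_norm p1 f x R) q \<partial>lebesgue) \<le> N) \<longrightarrow>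
     0 < r \<longrightarrow> r \<le> R \<longrightarrow>
     (\<integral>\<^sup>+ x. enn_powr (ennreal (wt x r * (Phi p2 p20 x r / Phi p2 p20 x R)) * loc_norm p1 f x R) q \<partial>lebesgue)
       \<le> ennreal (C * (r / R) powr (eps * q)) * N"
proof -
  let ?n = "real DIM('a)"
  obtain C where C: "0 \<le> C" "\<And>r R. \<lbrakk>0 < r; r \<le> R; 1 < R\<rbrakk> \<Longrightarrow>
     ball_int (\<lambda>x. ennreal ((wt x r * Phi p2 p20 x r) powr q)) 0 (2 * R)
      \<le> ennreal (C * (r / R) powr (eps * q) * R powr (?n * q / p20))
         * ball_int (\<lambda>z. ennreal (wt z (5 * R) powr q)) 0 (2 * R)"
    using wt_Phi_integral_le by blast
  show ?thesis
  proof (intro exI[of _ "1 + C"] conjI allI impI)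
    show "0 \<le> 1 + C" using C by simp
    fix f :: "'a \<Rightarrow> real" and N and r R :: real
    assume f [measurable]: "f \<in> borel_measurable lebesgue"
      and N: "\<forall>R>0. (\<integral>\<^sup>+ x. enn_powr (ennreal (wt x R) * loc_norm p1 f x R) q \<partial>lebesgue) \<le> N"
      and r: "0 < r" "r \<le> R"
    have R: "0 < R" using r by simp
    have q: "0 < q" using q_gt1 by simp
    let ?F = "loc_norm p1 f"
    let ?t = "\<lambda>x. enn_powr (ennreal (wt x r * (Phi p2 p20 x r / Phi p2 p20 x R)) * ?F x R) q"
    have [measurable]: "(\<lambda>x. wt x z) \<in> borel_measurable lebesgue" if "0 < z" for z
      using that by (intro borel_measurable_wt) simp
    have near_part: "?t x = ennreal ((r / R) powr (eps * q)) * enn_powr (ennreal (wt x R) * ?F x R) q" if "near x R" for x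
    proof -
      have "?t x = enn_powr (ennreal ((r / R) powr eps) * (ennreal (wt x R) * ?F x R)) q"
        unfolding wt_near_ratio[OF r that] by (simp add: ennreal_mult' mult.assoc)
      also have "\<dots> = ennreal ((r / R) powr (eps * q)) * enn_powr (ennreal (wt x R) * ?F x R) q"
        unfolding enn_powr_mult[OF q, of "ennreal ((r / R) powr eps)"] by (simp add: enn_powr_ennreal powr_powr)
      finally show ?thesis .
    qed
    have I1: "(\<integral>\<^sup>+ x. ennreal ((r / R) powr (eps * q)) * enn_powr (ennreal (wt x R) * ?F x R) q \<partial>lebesgue)
      \<le> ennreal ((r / R) powr (eps * q)) * N"
    proof -
      have "(\<integral>\<^sup>+ x. ennreal ((r / R) powr (eps * q)) * enn_powr (ennreal (wt x R) * ?F x R) q \<partial>lebesgue)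
        = ennreal ((r / R) powr (eps * q)) * (\<integral>\<^sup>+ x. enn_powr (ennreal (wt x R) * ?F x R) q \<partial>lebesgue)"
        using R by (intro nn_integral_cmult) measurable
      then show ?thesis using N R by (simp add: mult_left_mono)
    qed
    show "(\<integral>\<^sup>+ x. ?t x \<partial>lebesgue) \<le> ennreal ((1 + C) * (r / R) powr (eps * q)) * N"
    proof (cases "R \<le> 1")
      case True
      then have "near x R" for x :: 'a by (auto simp: near_def)
      then have "(\<integral>\<^sup>+ x. ?t x \<partial>lebesgue) \<le> ennreal ((r / R) powr (eps * q)) * N"
        using I1 by (simp only: near_part)
      also have "\<dots> \<le> ennreal ((1 + C) * (r / R) powr (eps * q)) * N"
        using C by (intro mult_right_mono ennreal_leI) (auto simp: mult_le_cancel_right1)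
      finally show ?thesis .
    next
      case False
      then have R1: "1 < R" by simp
      \<comment> \<open>For far points the local norm is compared with the one over \<open>ball 0 (3 * R)\<close>, and this with the
        average over all centres \<open>z\<close> in \<open>ball 0 (2 * R)\<close>.\<close>
      define F0 where "F0 = enn_powr (?F 0 (3 * R)) q"
      let ?B = "ball_int (\<lambda>z. ennreal (wt z (5 * R) powr q)) 0 (2 * R)"
      let ?u = "R powr - (?n * q / p20)"
      have far: "?t x \<le> (F0 * ennreal ?u) * (ennreal ((wt x r * Phi p2 p20 x r) powr q) * indicator (ball 0 (2 * R)) x)"
        if "\<not> near x R" for x
      proof -
        have x: "norm x < 2 * R" using that by (auto simp: near_def)
        have sub: "ball x R \<subseteq> ball 0 (3 * R)"
        proof
          fix z assume "z \<in> ball x R"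
          then have "norm (z - x) < R" by (simp add: dist_norm norm_minus_commute)
          then show "z \<in> ball 0 (3 * R)" using x norm_triangle_ineq[of "z - x" x] by simp
        qed
        have "wt x r * (Phi p2 p20 x r / Phi p2 p20 x R) = R powr - (?n / p20) * (wt x r * Phi p2 p20 x r)"
          using that by (simp add: Phi_def powr_minus_divide)
        then have "?t x = ennreal ((R powr - (?n / p20) * (wt x r * Phi p2 p20 x r)) powr q) * enn_powr (?F x R) q"
          using q wt_nonneg[of x r] by (simp add: enn_powr_mult enn_powr_ennreal Phi_def)
        also have "(R powr - (?n / p20) * (wt x r * Phi p2 p20 x r)) powr q = ?u * (wt x r * Phi p2 p20 x r) powr q"
          by (subst powr_mult) (simp add: powr_powr)
        also have "ennreal (?u * (wt x r * Phi p2 p20 x r) powr q) * enn_powr (?F x R) q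
          \<le> ennreal (?u * (wt x r * Phi p2 p20 x r) powr q) * F0"
          unfolding F0_def using q p1.s_pos sub
          by (intro mult_left_mono enn_powr_mono loc_norm_mono) (auto simp: less_imp_le)
        also have "\<dots> = (F0 * ennreal ?u) * (ennreal ((wt x r * Phi p2 p20 x r) powr q) * indicator (ball 0 (2 * R)) x)"
          using x by (simp add: ennreal_mult' mult_ac)
        finally show ?thesis .
      qed
      have F0B: "F0 * ?B \<le> N"
      proof -
        have "F0 * ?B = (\<integral>\<^sup>+ z. F0 * (ennreal (wt z (5 * R) powr q) * indicator (ball 0 (2 * R)) z) \<partial>lebesgue)"
          unfolding ball_int_def using R by (intro nn_integral_cmult[symmetric]) measurable
        also have "\<dots> \<le> (\<integral>\<^sup>+ z. enn_powr (ennreal (wt z (5 * R)) * ?F z (5 * R)) q \<partial>lebesgue)"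
        proof (rule nn_integral_mono)
          fix z
          show "F0 * (ennreal (wt z (5 * R) powr q) * indicator (ball 0 (2 * R)) z)
            \<le> enn_powr (ennreal (wt z (5 * R)) * ?F z (5 * R)) q"
          proof (cases "z \<in> ball 0 (2 * R)")
            case True
            have sub: "ball 0 (3 * R) \<subseteq> ball z (5 * R)"
            proof
              fix y :: 'a assume "y \<in> ball 0 (3 * R)"
              then show "y \<in> ball z (5 * R)"
                using True norm_triangle_ineq4[of z y] by (simp add: dist_norm)
            qed
            have "F0 * ennreal (wt z (5 * R) powr q) \<le> enn_powr (?F z (5 * R)) q * ennreal (wt z (5 * R) powr q)"
              unfolding F0_def using q p1.s_pos sub
              by (intro mult_right_mono enn_powr_mono loc_norm_mono) (auto simp: less_imp_le)
            also have "\<dots> = enn_powr (ennreal (wt z (5 * R)) * ?F z (5 * R)) q"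
              using q wt_nonneg by (simp add: enn_powr_mult enn_powr_ennreal mult.commute)
            finally show ?thesis using True by simp
          qed simp
        qed
        also have "\<dots> \<le> N" using N R by simp
        finally show ?thesis .
      qed
      have "(\<integral>\<^sup>+ x. ?t x \<partial>lebesgue) \<le> (\<integral>\<^sup>+ x. ennreal ((r / R) powr (eps * q)) * enn_powr (ennreal (wt x R) * ?F x R) q
        + (F0 * ennreal ?u) * (ennreal ((wt x r * Phi p2 p20 x r) powr q) * indicator (ball 0 (2 * R)) x) \<partial>lebesgue)"
      proof (rule nn_integral_mono)
        fix x
        show "?t x \<le> ennreal ((r / R) powr (eps * q)) * enn_powr (ennreal (wt x R) * ?F x R) q
          + (F0 * ennreal ?u) * (ennreal ((wt x r * Phi p2 p20 x r) powr q) * indicator (ball 0 (2 * R)) x)"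
          using near_part[of x] far[of x] by (cases "near x R") (auto intro: add_increasing add_increasing2)
      qed
      also have "\<dots> = (\<integral>\<^sup>+ x. ennreal ((r / R) powr (eps * q)) * enn_powr (ennreal (wt x R) * ?F x R) q \<partial>lebesgue)
        + (\<integral>\<^sup>+ x. (F0 * ennreal ?u) * (ennreal ((wt x r * Phi p2 p20 x r) powr q) * indicator (ball 0 (2 * R)) x) \<partial>lebesgue)"
        using R r by (intro nn_integral_add) measurable
      also have "(\<integral>\<^sup>+ x. (F0 * ennreal ?u) * (ennreal ((wt x r * Phi p2 p20 x r) powr q) * indicator (ball 0 (2 * R)) x) \<partial>lebesgue)
        = (F0 * ennreal ?u) * ball_int (\<lambda>x. ennreal ((wt x r * Phi p2 p20 x r) powr q)) 0 (2 * R)"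
        unfolding ball_int_def using r by (intro nn_integral_cmult) measurable
      also have "\<dots> \<le> (F0 * ennreal ?u) * (ennreal (C * (r / R) powr (eps * q) * R powr (?n * q / p20)) * ?B)"
        by (intro mult_left_mono C r R1) simp
      also have "\<dots> = ennreal ?u * ennreal (C * (r / R) powr (eps * q) * R powr (?n * q / p20)) * (F0 * ?B)"
        by (simp only: mult_ac)
      also have "ennreal ?u * ennreal (C * (r / R) powr (eps * q) * R powr (?n * q / p20)) = ennreal (C * (r / R) powr (eps * q))"
        using R by (simp add: powr_minus divide_simps flip: ennreal_mult')
      also have "ennreal (C * (r / R) powr (eps * q)) * (F0 * ?B) \<le> ennreal (C * (r / R) powr (eps * q)) * N"
        by (intro mult_left_mono F0B) simp
      also have "(\<integral>\<^sup>+ x. ennreal ((r / R) powr (eps * q)) * enn_powr (ennreal (wt x R) * ?F x R) q \<partial>lebesgue)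
          + ennreal (C * (r / R) powr (eps * q)) * N
        \<le> ennreal ((r / R) powr (eps * q)) * N + ennreal (C * (r / R) powr (eps * q)) * N"
        by (rule add_right_mono[OF I1])
      also have "\<dots> = ennreal ((1 + C) * (r / R) powr (eps * q)) * N"
        using C by (simp add: distrib_right[symmetric] distrib_right[of 1 C] flip: ennreal_plus)
      finally show ?thesis by (simp only: add_left_mono)
    qed
  qed
qed

lemma wt_double: "0 < r \<Longrightarrow> wt x r \<le> 2 powr (2 * real DIM('a)) * wt x (2 * r)"
proof -
  assume r: "0 < r"
  let ?n = "real DIM('a)"
  have "wt x (2 * r) = 2 powr (?n * wexp x) * wt x r"
    using r unfolding wexp_eps by (simp add: wt_eq powr_mult)
  then have "wt x r = 2 powr - (?n * wexp x) * wt x (2 * r)" by (simp add: powr_minus)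
  also have "\<dots> \<le> 2 powr (2 * ?n) * wt x (2 * r)"
  proof (intro mult_right_mono powr_mono wt_nonneg)
    have "\<bar>?n * wexp x\<bar> \<le> ?n * 2" unfolding abs_mult using wexp_bounds(1)[of x] by (intro mult_mono) auto
    then show "- (?n * wexp x) \<le> 2 * ?n" by linarith
  qed simp
  finally show ?thesis .
qed

text \<open>After \<open>local_estimate\<close> the first term only needs the weight doubled, and
  the series is summed in the integral norm by \<open>nn_integral_power_suminf_le\<close>. Working
  with a uniform bound \<open>N\<close> for the \<open>q\<close>-th powers avoids roots and suprema
  until the Fofana norms are inserted.\<close>

lemma sufficiency:
  "\<exists>C\<ge>0. \<forall>f N r. f \<in> borel_measurable lebesgue \<longrightarrow>
     (\<forall>R>0. (\<integral>\<^sup>+ x. enn_powr (ennreal (wt x R) * loc_norm p1 f x R) q \<partial>lebesgue) \<le> N) \<longrightarrow> 0 < r \<longrightarrow>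
     (\<integral>\<^sup>+ x. enn_powr (ennreal (wt x r) * loc_norm p2 (frac_int \<gamma> f) x r) q \<partial>lebesgue) \<le> ennreal C * N"
proof -
  let ?n = "real DIM('a)"
  obtain C1 where C1: "1 \<le> C1" "\<And>(f :: 'a \<Rightarrow> real) x r. \<lbrakk>f \<in> borel_measurable lebesgue; 0 < r\<rbrakk> \<Longrightarrow>
     loc_norm p2 (frac_int \<gamma> f) x r \<le> ennreal C1 * (loc_norm p1 f x (2 * r)
       + (\<Sum>j. ennreal (Phi p2 p20 x r / Phi p2 p20 x (2^(j+2) * r)) * loc_norm p1 f x (2^(j+2) * r)))"
    using local_estimate by blast
  obtain C2 where C2: "0 \<le> C2" "\<And>(f :: 'a \<Rightarrow> real) N r R. \<lbrakk>f \<in> borel_measurable lebesgue;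
     \<forall>R>0. (\<integral>\<^sup>+ x. enn_powr (ennreal (wt x R) * loc_norm p1 f x R) q \<partial>lebesgue) \<le> N;
     0 < r; r \<le> R\<rbrakk> \<Longrightarrow>
     (\<integral>\<^sup>+ x. enn_powr (ennreal (wt x r * (Phi p2 p20 x r / Phi p2 p20 x R)) * loc_norm p1 f x R) q \<partial>lebesgue)
       \<le> ennreal (C2 * (r / R) powr (eps * q)) * N"
    using term_estimate by blast
  have q: "0 < q" using q_gt1 by simp
  obtain C3 where C3: "0 \<le> C3" "\<And>(a :: nat \<Rightarrow> 'a \<Rightarrow> ennreal) M N. \<lbrakk>\<forall>j. a j \<in> borel_measurable M;
     \<forall>j. (\<integral>\<^sup>+ x. enn_powr (a j x) q \<partial>M) \<le> ennreal ((2^j) powr - (eps * q)) * N\<rbrakk> \<Longrightarrow>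
    (\<integral>\<^sup>+ x. enn_powr (\<Sum>j. a j x) q \<partial>M) \<le> ennreal C3 * N"
    using nn_integral_power_suminf_le[OF q eps_pos, where 'a='a] by blast
  define D where "D = 2 powr (2 * ?n)"
  define E where "E = C1 powr q * 2 powr q"
  have DE: "0 < D" "0 < E" using C1 by (auto simp: D_def E_def)
  show ?thesis
  proof (intro exI[of _ "E * (D powr q + C3 * C2)"] conjI allI impI)
    show "0 \<le> E * (D powr q + C3 * C2)" using DE C2 C3 by simp
    fix f :: "'a \<Rightarrow> real" and N and r :: real
    assume f [measurable]: "f \<in> borel_measurable lebesgue"
      and N: "\<forall>R>0. (\<integral>\<^sup>+ x. enn_powr (ennreal (wt x R) * loc_norm p1 f x R) q \<partial>lebesgue) \<le> N"
      and r: "0 < r"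
    define b where "b = (\<lambda>j x. ennreal (wt x r * (Phi p2 p20 x r / Phi p2 p20 x (2^(j+2) * r))) * loc_norm p1 f x (2^(j+2) * r))"
    have [measurable]: "(\<lambda>x. wt x z) \<in> borel_measurable lebesgue" if "0 < z" for z
      using that by (intro borel_measurable_wt) simp
    have b_meas [measurable]: "b j \<in> borel_measurable lebesgue" for j unfolding b_def using r by measurable
    have bI: "(\<integral>\<^sup>+ x. enn_powr (b j x) q \<partial>lebesgue) \<le> ennreal ((2^j) powr - (eps * q)) * (ennreal C2 * N)" for j :: nat
    proof -
      have "r \<le> 2^(j+2) * r" using r by (simp add: mult_le_cancel_right1 one_le_power del: power_Suc)
      then have "(\<integral>\<^sup>+ x. enn_powr (b j x) q \<partial>lebesgue) \<le> ennreal (C2 * (r / (2^(j+2) * r)) powr (eps * q)) * N"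
        unfolding b_def by (rule C2(2)[OF f N r])
      also have "\<dots> \<le> ennreal (C2 * (2^j) powr - (eps * q)) * N"
      proof (intro mult_right_mono ennreal_leI mult_left_mono)
        have "(r / (2^(j+2) * r)) powr (eps * q) = (2^(j+2)) powr - (eps * q)"
          using r by (simp add: powr_divide powr_minus_divide del: power_Suc)
        also have "\<dots> \<le> (2^j) powr - (eps * q)"
          using eps_pos q by (intro powr_mono2') auto
        finally show "(r / (2^(j+2) * r)) powr (eps * q) \<le> (2^j) powr - (eps * q)" .
      qed (use C2 in auto)
      also have "\<dots> = ennreal ((2^j) powr - (eps * q)) * (ennreal C2 * N)"
        using C2 by (simp add: ennreal_mult' mult_ac)
      finally show ?thesis .
    qed
    have sumI: "(\<integral>\<^sup>+ x. enn_powr (\<Sum>j. b j x) q \<partial>lebesgue) \<le> ennreal C3 * (ennreal C2 * N)"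
      by (intro C3) (use bI in auto)
    have pw: "enn_powr (ennreal (wt x r) * loc_norm p2 (frac_int \<gamma> f) x r) q
      \<le> ennreal E * (ennreal (D powr q) * enn_powr (ennreal (wt x (2 * r)) * loc_norm p1 f x (2 * r)) q + enn_powr (\<Sum>j. b j x) q)" for x
    proof -
      have "ennreal (wt x r) * loc_norm p2 (frac_int \<gamma> f) x r \<le> ennreal (wt x r) * (ennreal C1 * (loc_norm p1 f x (2 * r)
       + (\<Sum>j. ennreal (Phi p2 p20 x r / Phi p2 p20 x (2^(j+2) * r)) * loc_norm p1 f x (2^(j+2) * r))))"
        by (intro mult_left_mono C1 f r) simp
      also have "\<dots> = ennreal C1 * (ennreal (wt x r) * loc_norm p1 f x (2 * r) + (\<Sum>j. b j x))"
      proof -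
        have "(\<Sum>j. b j x) = ennreal (wt x r) * (\<Sum>j. ennreal (Phi p2 p20 x r / Phi p2 p20 x (2^(j+2) * r)) * loc_norm p1 f x (2^(j+2) * r))"
          unfolding b_def by (subst ennreal_suminf_cmult[symmetric], rule suminf_cong) (simp only: ennreal_mult' wt_nonneg mult.assoc)
        then show ?thesis by (simp add: distrib_left mult_ac)
      qed
      also have "\<dots> \<le> ennreal C1 * (ennreal D * (ennreal (wt x (2 * r)) * loc_norm p1 f x (2 * r)) + (\<Sum>j. b j x))"
      proof (intro mult_left_mono add_right_mono)
        have "ennreal (wt x r) \<le> ennreal D * ennreal (wt x (2 * r))"
          using wt_double[OF r, of x] DE by (simp add: D_def ennreal_leI flip: ennreal_mult')
        then show "ennreal (wt x r) * loc_norm p1 f x (2 * r) \<le> ennreal D * (ennreal (wt x (2 * r)) * loc_norm p1 f x (2 * r))"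
          by (simp add: mult.assoc[symmetric] mult_right_mono)
      qed simp
      finally have "enn_powr (ennreal (wt x r) * loc_norm p2 (frac_int \<gamma> f) x r) q \<le>
        enn_powr (ennreal C1 * (ennreal D * (ennreal (wt x (2 * r)) * loc_norm p1 f x (2 * r)) + (\<Sum>j. b j x))) q"
        using q by (intro enn_powr_mono) auto
      also have "\<dots> = ennreal (C1 powr q) * enn_powr (ennreal D * (ennreal (wt x (2 * r)) * loc_norm p1 f x (2 * r)) + (\<Sum>j. b j x)) q"
        using C1 by (subst enn_powr_mult[OF q]) (simp add: enn_powr_ennreal)
      also have "\<dots> \<le> ennreal (C1 powr q) * (ennreal (2 powr q) * (enn_powr (ennreal D * (ennreal (wt x (2 * r)) * loc_norm p1 f x (2 * r))) q + enn_powr (\<Sum>j. b j x) q))"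
        using q by (intro mult_left_mono enn_powr_add_le) auto
      also have "enn_powr (ennreal D * (ennreal (wt x (2 * r)) * loc_norm p1 f x (2 * r))) q
        = ennreal (D powr q) * enn_powr (ennreal (wt x (2 * r)) * loc_norm p1 f x (2 * r)) q"
        using DE by (subst enn_powr_mult[OF q]) (simp add: enn_powr_ennreal)
      finally show ?thesis
        by (simp add: E_def ennreal_mult' mult.assoc)
    qed
    have "(\<integral>\<^sup>+ x. enn_powr (ennreal (wt x r) * loc_norm p2 (frac_int \<gamma> f) x r) q \<partial>lebesgue)
      \<le> (\<integral>\<^sup>+ x. ennreal E * (ennreal (D powr q) * enn_powr (ennreal (wt x (2 * r)) * loc_norm p1 f x (2 * r)) q + enn_powr (\<Sum>j. b j x) q) \<partial>lebesgue)"
      by (intro nn_integral_mono pw)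
    also have "\<dots> = ennreal E * (\<integral>\<^sup>+ x. ennreal (D powr q) * enn_powr (ennreal (wt x (2 * r)) * loc_norm p1 f x (2 * r)) q + enn_powr (\<Sum>j. b j x) q \<partial>lebesgue)"
      using r by (intro nn_integral_cmult) measurable
    also have "(\<integral>\<^sup>+ x. ennreal (D powr q) * enn_powr (ennreal (wt x (2 * r)) * loc_norm p1 f x (2 * r)) q + enn_powr (\<Sum>j. b j x) q \<partial>lebesgue)
      = (\<integral>\<^sup>+ x. ennreal (D powr q) * enn_powr (ennreal (wt x (2 * r)) * loc_norm p1 f x (2 * r)) q \<partial>lebesgue) + (\<integral>\<^sup>+ x. enn_powr (\<Sum>j. b j x) q \<partial>lebesgue)"
      using r by (intro nn_integral_add) measurable
    also have "(\<integral>\<^sup>+ x. ennreal (D powr q) * enn_powr (ennreal (wt x (2 * r)) * loc_norm p1 f x (2 * r)) q \<partial>lebesgue)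
      = ennreal (D powr q) * (\<integral>\<^sup>+ x. enn_powr (ennreal (wt x (2 * r)) * loc_norm p1 f x (2 * r)) q \<partial>lebesgue)"
      using r by (intro nn_integral_cmult) measurable
    also have "ennreal E * (ennreal (D powr q) * (\<integral>\<^sup>+ x. enn_powr (ennreal (wt x (2 * r)) * loc_norm p1 f x (2 * r)) q \<partial>lebesgue) + (\<integral>\<^sup>+ x. enn_powr (\<Sum>j. b j x) q \<partial>lebesgue))
      \<le> ennreal E * (ennreal (D powr q) * N + ennreal C3 * (ennreal C2 * N))"
      using N r by (intro mult_left_mono add_mono sumI) auto
    also have "\<dots> = ennreal (E * (D powr q + C3 * C2)) * N"
    proof -
      have "ennreal (E * (D powr q + C3 * C2)) = ennreal E * (ennreal (D powr q) + ennreal C3 * ennreal C2)"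
        using DE C2 C3 by (simp add: ennreal_mult')
      then show ?thesis by (simp add: algebra_simps)
    qed
    finally show "(\<integral>\<^sup>+ x. enn_powr (ennreal (wt x r) * loc_norm p2 (frac_int \<gamma> f) x r) q \<partial>lebesgue)
      \<le> ennreal (E * (D powr q + C3 * C2)) * N" .
  qed
qed

end

section \<open>Necessity\<close>

text \<open>The Bochner integral is 0 where it diverges, so a lower bound on \<open>riesz\<close>
  transfers to \<open>frac_int\<close> only once finiteness is known.\<close>

lemma frac_int_eq_riesz:
  fixes f :: "'a::euclidean_space \<Rightarrow> real"
  assumes [measurable]: "f \<in> borel_measurable lebesgue" and f: "\<And>y. 0 \<le> f y"
    and fin: "riesz \<gamma> (\<lambda>y. ennreal (f y)) x < top"
  shows "ennreal (frac_int \<gamma> f x) = riesz \<gamma> (\<lambda>y. ennreal (f y)) x"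
proof -
  let ?k = "\<lambda>y. f y / norm (x - y) powr (real DIM('a) - \<gamma>)"
  have eq: "riesz \<gamma> (\<lambda>y. ennreal (f y)) x = (\<integral>\<^sup>+ y. ennreal (?k y) \<partial>lebesgue)"
    unfolding riesz_def
    by (intro nn_integral_cong, simp only: powr_minus) (simp add: f divide_inverse flip: ennreal_mult')
  have "integrable lebesgue ?k"
    using fin f unfolding eq by (intro integrableI_nonneg) auto
  then show ?thesis
    unfolding eq frac_int_def using f by (intro nn_integral_eq_integral[symmetric]) auto
qed

lemma riesz_indicator_ball:
  fixes c y :: "'a::euclidean_space"
  assumes \<gamma>: "0 < \<gamma>" "\<gamma> < real DIM('a)" and \<rho>: "0 < \<rho>" and y: "y \<in> ball c \<rho>"
  shows "riesz \<gamma> (\<lambda>z. indicator (ball c \<rho>) z) y < top"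
    and "ennreal (vol1 TYPE('a) * 2 powr - (real DIM('a) - \<gamma>) * \<rho> powr \<gamma>) \<le> riesz \<gamma> (\<lambda>z. indicator (ball c \<rho>) z) y"
proof -
  let ?s = "real DIM('a) - \<gamma>" and ?n = "real DIM('a)"
  have s: "0 \<le> ?s" "?s < ?n" using \<gamma> by auto
  have sub: "norm (y - z) < 2 * \<rho>" if "z \<in> ball c \<rho>" for z
    using y that dist_triangle2[of y z c] by (simp add: dist_norm[symmetric] dist_commute)
  have "riesz \<gamma> (\<lambda>z. indicator (ball c \<rho>) z) y
    \<le> (\<integral>\<^sup>+ z. indicator (ball c \<rho>) z * ennreal (norm (y - z) powr - ?s) * indicator (ball y (2 * \<rho>)) z \<partial>lebesgue)"
    unfolding riesz_def
  proof (rule nn_integral_mono)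
    fix z
    show "indicator (ball c \<rho>) z * ennreal (norm (y - z) powr - ?s)
      \<le> indicator (ball c \<rho>) z * ennreal (norm (y - z) powr - ?s) * indicator (ball y (2 * \<rho>)) z"
      using sub[of z] by (auto simp: indicator_def dist_norm)
  qed
  also have "\<dots> \<le> ennreal (vol1 TYPE('a) * 2 powr ?s / (1 - 2 powr - (?n - ?s)) * (2 * \<rho>) powr (?n - ?s)) * maximal (\<lambda>z. indicator (ball c \<rho>) z) y"
    using s \<rho> by (intro riesz_near_le) auto
  also have "\<dots> \<le> ennreal (vol1 TYPE('a) * 2 powr ?s / (1 - 2 powr - (?n - ?s)) * (2 * \<rho>) powr (?n - ?s)) * 1"
    by (intro mult_left_mono maximal_le_1) (auto simp: indicator_def)
  also have "\<dots> < top" by (simp only: mult_1_right ennreal_less_top)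
  finally show "riesz \<gamma> (\<lambda>z. indicator (ball c \<rho>) z) y < top" .
  \<comment> \<open>At \<open>z = y\<close> the kernel has the value 0 by the convention for
    \<open>powr\<close>, so the pointwise lower bound fails there and is claimed almost everywhere
    only.\<close>
  have AE: "AE z in lebesgue. z \<noteq> y" by (rule AE_completion, rule AE_lborel_singleton)
  have "ennreal (vol1 TYPE('a) * 2 powr - ?s * \<rho> powr \<gamma>) = ennreal ((2 * \<rho>) powr - ?s) * ennreal (vol1 TYPE('a) * \<rho> powr ?n)"
  proof -
    have "(2 * \<rho>) powr - ?s * (vol1 TYPE('a) * \<rho> powr ?n) = vol1 TYPE('a) * 2 powr - ?s * (\<rho> powr - ?s * \<rho> powr ?n)"
      unfolding powr_mult by (simp only: mult_ac)
    also have "\<rho> powr - ?s * \<rho> powr ?n = \<rho> powr \<gamma>" unfolding powr_add[symmetric] by simp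
    finally show ?thesis by (simp only: ennreal_mult'[symmetric] powr_ge_zero)
  qed
  also have "\<dots> = (\<integral>\<^sup>+ z. ennreal ((2 * \<rho>) powr - ?s) * indicator (ball c \<rho>) z \<partial>lebesgue)"
    using \<rho> by (simp add: nn_integral_cmult nn_integral_indicator_ball del: nn_integral_indicator)
  also have "\<dots> \<le> riesz \<gamma> (\<lambda>z. indicator (ball c \<rho>) z) y"
    unfolding riesz_def
  proof (rule nn_integral_mono_AE, use AE in eventually_elim)
    fix z assume "z \<noteq> y"
    show "ennreal ((2 * \<rho>) powr - ?s) * indicator (ball c \<rho>) z \<le> indicator (ball c \<rho>) z * ennreal (norm (y - z) powr - ?s)"
    proof (cases "z \<in> ball c \<rho>")
      case True
      have "(2 * \<rho>) powr - ?s \<le> norm (y - z) powr - ?s"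
        using sub[OF True] s \<open>z \<noteq> y\<close> by (intro powr_mono2') auto
      then show ?thesis using True by (simp add: ennreal_leI)
    qed simp
  qed
  finally show "ennreal (vol1 TYPE('a) * 2 powr - (real DIM('a) - \<gamma>) * \<rho> powr \<gamma>) \<le> riesz \<gamma> (\<lambda>z. indicator (ball c \<rho>) z) y" .
qed

lemma var_norm_zero: "(\<And>x. f x = 0) \<Longrightarrow> var_norm p f = 0"
proof -
  assume f: "\<And>x. f x = 0"
  have "var_norm p f \<le> ennreal e" if "0 < e" for e
    using that f by (intro var_norm_le) (simp_all add: modular_def)
  then have "\<not> 0 < var_norm p f"
    by (metis dense ennreal_cases ennreal_less_zero_iff not_le top.not_eq_extremum not_less_iff_gr_or_eq)
  then show ?thesis by simp
qed

context log_exponent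
begin

lemma var_norm_ball_le:
  "\<exists>A\<ge>1. \<forall>x R. 0 < R \<longrightarrow> var_norm s (indicator (ball x R)) \<le> ennreal (A * Phi s s0 x R)"
proof -
  obtain A where A: "1 \<le> A" "\<And>x R. 0 < R \<Longrightarrow> ball_int (\<lambda>y. ennreal (Phi s s0 x R powr - s y)) x R \<le> ennreal A"
    using Phi_modular_bound by blast
  show ?thesis
  proof (intro exI[of _ A] conjI allI impI A)
    fix x :: 'a and R :: real assume R: "0 < R"
    let ?\<phi> = "Phi s s0 x R"
    have \<phi>: "0 < ?\<phi>" by (rule Phi_pos[OF R])
    have "modular s (\<lambda>y. 1 * indicator (ball x R) y) (A * ?\<phi>) \<le> (\<integral>\<^sup>+ y. ennreal (1 / A) * (ennreal (?\<phi> powr - s y) * indicator (ball x R) y) \<partial>lebesgue)"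
      unfolding modular_ball ball_int_def
    proof (rule nn_integral_mono)
      fix y
      have "(1 / A) powr s y \<le> (1 / A) powr 1" using A s_gt1[of y] by (intro powr_mono') auto
      then have "(1 / A) powr s y * ?\<phi> powr - s y \<le> 1 / A * ?\<phi> powr - s y"
        using A by (intro mult_right_mono) auto
      moreover have "(\<bar>1\<bar> / (A * ?\<phi>)) powr s y = (1 / A) powr s y * ?\<phi> powr - s y"
        by (simp add: powr_divide powr_mult powr_minus_divide)
      ultimately have "(\<bar>1\<bar> / (A * ?\<phi>)) powr s y \<le> 1 / A * ?\<phi> powr - s y" by simp
      then have "ennreal ((\<bar>1\<bar> / (A * ?\<phi>)) powr s y) \<le> ennreal (1 / A) * ennreal (?\<phi> powr - s y)"
        using A by (simp add: ennreal_leI flip: ennreal_mult')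
      then show "ennreal ((\<bar>1\<bar> / (A * ?\<phi>)) powr s y) * indicator (ball x R) y
        \<le> ennreal (1 / A) * (ennreal (?\<phi> powr - s y) * indicator (ball x R) y)"
        by (simp add: mult.assoc[symmetric] mult_right_mono)
    qed
    also have "\<dots> = ennreal (1 / A) * ball_int (\<lambda>y. ennreal (?\<phi> powr - s y)) x R"
      unfolding ball_int_def by (rule nn_integral_cmult) measurable
    also have "\<dots> \<le> ennreal (1 / A) * ennreal A" by (intro mult_left_mono A R) simp
    also have "\<dots> = 1" using A by (simp flip: ennreal_mult')
    finally show "var_norm s (indicator (ball x R)) \<le> ennreal (A * ?\<phi>)"
      using A \<phi> by (intro var_norm_le) auto
  qed
qed

text \<open>A scaling below the claimed value would have modular at least 2. The near condition at
  radius \<open>2 * \<rho>\<close> is used because \<open>ball x (2 * \<rho>)\<close> contains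
  \<open>ball z \<rho>\<close>, so all exponents there may be compared with the one at
  \<open>x\<close>.\<close>

lemma var_norm_ball_ge:
  assumes k: "0 < k"
  shows "\<exists>c>0. \<forall>z x \<rho> t. 0 < \<rho> \<longrightarrow> near x (2 * \<rho>) \<longrightarrow> x \<in> ball z \<rho> \<longrightarrow> 0 < t \<longrightarrow>
    ennreal (c * t * \<rho> powr (real DIM('a) / s x)) \<le> var_norm s (\<lambda>y. k * t * indicator (ball z \<rho>) y)"
proof -
  let ?n = "real DIM('a)" and ?V = "vol1 TYPE('a)"
  define M where "M = exp (?n * P * K) * 2 powr (?n * P)"
  have M: "0 < M" by (simp add: M_def)
  \<comment> \<open>The first entry gives \<open>k / c \<ge> 1\<close>, so its power
    \<open>s y\<close> may be lowered to 1; the second gives the strict contradiction.\<close>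
  define c where "c = min k (k * ?V / (2 * M))"
  have c: "0 < c" "c \<le> k" "c \<le> k * ?V / (2 * M)" using k M by (auto simp: c_def)
  show ?thesis
  proof (intro exI[of _ c] conjI allI impI c)
    fix z x :: 'a and \<rho> t :: real
    assume \<rho>: "0 < \<rho>" and nr: "near x (2 * \<rho>)" and xz: "x \<in> ball z \<rho>" and t: "0 < t"
    let ?B = "c * t * \<rho> powr (?n / s x)"
    have "ennreal ?B \<le> ennreal 1 * var_norm s (\<lambda>y. k * t * indicator (ball z \<rho>) y)"
    proof (rule le_var_norm)
      fix l :: real
      assume l: "0 < l" "modular s (\<lambda>y. k * t * indicator (ball z \<rho>) y) l \<le> 1"
      have "?B \<le> l"
      proof (rule ccontr)
        assume "\<not> ?B \<le> l"
        then have lB: "l < ?B" by simp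
        have pw: "k / c * (\<rho> powr - ?n / M) \<le> (\<bar>k * t\<bar> / l) powr s y" if y: "y \<in> ball z \<rho>" for y
        proof -
          have yx: "y \<in> ball x (2 * \<rho>)" using y xz dist_triangle2[of x y z] by (simp add: dist_commute)
          define e where "e = ?n * s y * (1 / s x - 1 / s y)"
          have e: "\<bar>e\<bar> \<le> ?n * P * \<bar>1 / s x - 1 / s y\<bar>"
            unfolding e_def abs_mult using upper[of y] s_pos[of y] by (intro mult_right_mono mult_mono) auto
          have "\<bar>1 / s x - 1 / s y\<bar> \<le> 1"
          proof -
            have "0 < 1 / s w \<and> 1 / s w < 1" for w using s_gt1[of w] by simp
            from this[of x] this[of y] show ?thesis by linarith
          qed
          then have "?n * P * \<bar>1 / s x - 1 / s y\<bar> \<le> ?n * P * 1" using P_gt1 by (intro mult_left_mono) auto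
          with e have e2: "\<bar>e\<bar> \<le> ?n * P" by linarith
          have "\<rho> powr e = (2 * \<rho>) powr e * 2 powr - e" by (simp add: powr_mult powr_minus)
          also have "\<dots> \<le> exp (?n * P * K) * 2 powr (?n * P)"
            using e e2 P_gt1 \<rho> by (intro mult_mono powr_osc[OF _ nr yx] powr_mono) auto
          finally have "\<rho> powr e \<le> M" by (simp add: M_def)
          then have "1 / M \<le> \<rho> powr - e" using M \<rho> by (simp add: powr_minus divide_simps)
          moreover have "- ?n + (- e) = - (?n / s x) * s y" using s_pos[of x] s_pos[of y] by (simp add: e_def field_simps)
          then have "\<rho> powr - ?n * \<rho> powr - e = (\<rho> powr - (?n / s x)) powr s y"
            unfolding powr_powr powr_add[symmetric] by simp
          ultimately have 1: "\<rho> powr - ?n / M \<le> (\<rho> powr - (?n / s x)) powr s y"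
            using mult_left_mono[of "1 / M" "\<rho> powr - e" "\<rho> powr - ?n"] by simp
          have "(k / c) powr 1 \<le> (k / c) powr s y" using c s_gt1[of y] by (intro powr_mono) auto
          then have "k / c \<le> (k / c) powr s y" using c k by simp
          then have "k / c * (\<rho> powr - ?n / M) \<le> (k / c) powr s y * (\<rho> powr - (?n / s x)) powr s y"
            using 1 M by (intro mult_mono) auto
          also have "\<dots> = (k / c * \<rho> powr - (?n / s x)) powr s y" by (rule powr_mult[symmetric])
          also have "\<dots> \<le> (\<bar>k * t\<bar> / l) powr s y"
          proof (rule powr_mono2)
            have "k / c * \<rho> powr - (?n / s x) = k * t / ?B" using c t \<rho> by (simp add: powr_minus divide_simps)
            also have "\<dots> \<le> k * t / l"
            proof (rule divide_left_mono)
              show "l \<le> ?B" using lB by (rule less_imp_le)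
              have "0 < ?B" using lB l(1) by (rule less_trans[rotated])
              then show "0 < ?B * l" using l(1) by (rule mult_pos_pos)
            qed (use k t in simp)
            also have "\<dots> = \<bar>k * t\<bar> / l" using k t by simp
            finally show "k / c * \<rho> powr - (?n / s x) \<le> \<bar>k * t\<bar> / l" .
          qed (use s_pos[of y] k c in auto)
          finally show ?thesis .
        qed
        have "ennreal (k / c * (\<rho> powr - ?n / M)) * ennreal (?V * \<rho> powr ?n)
          = (\<integral>\<^sup>+ y. ennreal (k / c * (\<rho> powr - ?n / M)) * indicator (ball z \<rho>) y \<partial>lebesgue)"
          using \<rho> by (simp add: nn_integral_cmult nn_integral_indicator_ball del: nn_integral_indicator)
        also have "\<dots> \<le> modular s (\<lambda>y. k * t * indicator (ball z \<rho>) y) l"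
          unfolding modular_ball ball_int_def
        proof (rule nn_integral_mono)
          fix y
          show "ennreal (k / c * (\<rho> powr - ?n / M)) * indicator (ball z \<rho>) y
            \<le> ennreal ((\<bar>k * t\<bar> / l) powr s y) * indicator (ball z \<rho>) y"
            using pw[of y] by (cases "y \<in> ball z \<rho>") (auto intro: ennreal_leI)
        qed
        also note l(2)
        also have "ennreal (k / c * (\<rho> powr - ?n / M)) * ennreal (?V * \<rho> powr ?n) = ennreal (k * ?V / (c * M))"
          using k c M \<rho> by (simp add: powr_minus divide_simps flip: ennreal_mult')
        finally have "k * ?V / (c * M) \<le> 1" by simp
        then have "k * ?V / M \<le> c" using c M by (simp add: divide_simps mult_ac)
        moreover have "k * ?V / (2 * M) < k * ?V / M" using k M by (intro divide_strict_left_mono) auto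
        ultimately have "c < c" using c(3) by (meson le_less_trans less_le_trans)
        then show False by simp
      qed
      then show "ennreal ?B \<le> ennreal 1 * ennreal l" by (simp add: ennreal_leI)
    qed simp
    then show "ennreal ?B \<le> var_norm s (\<lambda>y. k * t * indicator (ball z \<rho>) y)" by simp
  qed
qed

end

lemma loc_norm_eq_0:
  assumes "\<And>y. y \<in> ball x R \<Longrightarrow> f y = 0"
  shows "loc_norm p f x R = 0"
  unfolding loc_norm_def using assms by (intro var_norm_zero) (auto simp: indicator_def)

section \<open>Testing boundedness on indicators of balls\<close>

locale fofana_test = fofana_pair p1 p2 p10 p20 a P K \<gamma> q \<beta>
  for p1 p2 :: "'a::euclidean_space \<Rightarrow> real" and p10 p20 a P K \<gamma> q \<beta> :: real +
  fixes \<alpha> :: real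
  assumes p1_less: "\<And>x. p1 x < \<alpha>" and \<alpha>_less: "\<alpha> < q"
begin

text \<open>Positive and below 1; the source weight has the exponent \<open>- gap x - 1 / q\<close>,
  so \<open>gap\<close> alone carries its dependence on the centre.\<close>

definition gap :: "'a \<Rightarrow> real" where
  "gap x = 1 / p1 x - 1 / \<alpha>"

definition wt1 :: "'a \<Rightarrow> real \<Rightarrow> real" where
  "wt1 x R = measure lebesgue (ball x R) powr (1 / \<alpha> - 1 / p1 x - 1 / q)"

lemma \<alpha>_gt1: "1 < \<alpha>" using p1_less[of 0] p1.s_gt1[of 0] by linarith

lemma gap_bounds: "0 < gap x" "gap x < 1"
proof -
  have 1: "0 < 1 / z \<and> 1 / z < 1" if "1 < z" for z :: real using that by simp
  have "1 / \<alpha> < 1 / p1 x" using p1_less[of x] p1.s_pos[of x] by (simp add: frac_less2)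
  then show "0 < gap x" "gap x < 1"
    using 1[OF \<alpha>_gt1] 1[OF p1.s_gt1[of x]] unfolding gap_def by linarith+
qed

lemma wt1_powr_le:
  assumes "0 < R"
  shows "wt1 x R powr q \<le> cV * R powr (- real DIM('a) - real DIM('a) * q * gap x)"
proof -
  let ?n = "real DIM('a)"
  have q: "1 < q" by (rule q_gt1)
  have "wt1 x R = vol1 TYPE('a) powr (- gap x - 1 / q) * R powr (?n * (- gap x - 1 / q))"
    unfolding wt1_def using assms by (subst measure_lebesgue_ball) (simp_all add: gap_def powr_mult powr_powr)
  then have "wt1 x R powr q = vol1 TYPE('a) powr ((- gap x - 1 / q) * q) * R powr (?n * (- gap x - 1 / q) * q)"
    by (simp add: powr_mult powr_powr)
  also have "?n * (- gap x - 1 / q) * q = - ?n - ?n * q * gap x" using q by (simp add: field_simps)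
  also have "vol1 TYPE('a) powr ((- gap x - 1 / q) * q) * R powr (- ?n - ?n * q * gap x)
    \<le> cV * R powr (- ?n - ?n * q * gap x)"
  proof (intro mult_right_mono)
    have "(- gap x - 1 / q) * q = - (gap x * q) - 1" using q by (simp add: field_simps)
    moreover have "0 \<le> gap x * q" "gap x * q \<le> 1 * q" using gap_bounds[of x] q by (auto intro: mult_right_mono less_imp_le)
    ultimately have "\<bar>(- gap x - 1 / q) * q\<bar> \<le> 2 * q" using q by linarith
    then show "vol1 TYPE('a) powr ((- gap x - 1 / q) * q) \<le> cV" unfolding cV_def by (rule vol1_powr_le_max)
  qed simp
  finally show ?thesis .
qed

text \<open>For \<open>r \<le> \<rho>\<close> the local norm is that of a ball of radius
  \<open>r\<close> and the exponent at the centre cancels against the weight. For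
  \<open>r > \<rho>\<close> it is saturated at the norm of the test ball and only the integral of
  the weight is left. That integral is the hypothesis on \<open>Q\<close>, kept abstract because
  small and large test balls need different arguments for it.\<close>

lemma test_upper:
  "\<exists>C\<ge>0. \<forall>c \<rho> Q. 0 < \<rho> \<longrightarrow> (\<forall>x\<in>ball c (2 * \<rho>). near x (2 * \<rho>)) \<longrightarrow> 0 \<le> Q \<longrightarrow>
    (\<forall>r>\<rho>. ball_int (\<lambda>x. ennreal (r powr (- real DIM('a) - real DIM('a) * q * gap x))) c (2 * r)
       \<le> ennreal (Q * \<rho> powr - (real DIM('a) * q * gap c))) \<longrightarrow>
    (\<forall>r>0. (\<integral>\<^sup>+ x. enn_powr (ennreal (wt1 x r) * loc_norm p1 (indicator (ball c \<rho>)) x r) q \<partial>lebesgue)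
       \<le> ennreal (C * (1 + Q) * \<rho> powr (real DIM('a) * q / \<alpha>)))"
proof -
  let ?n = "real DIM('a)" and ?V = "vol1 TYPE('a)"
  obtain A where A: "1 \<le> A" "\<And>x R. 0 < R \<Longrightarrow> var_norm p1 (indicator (ball x R)) \<le> ennreal (A * Phi p1 p10 x R)"
    using p1.var_norm_ball_le by blast
  have q: "0 < q" using q_gt1 by simp
  define B where "B = cV * A powr q"
  have B: "0 \<le> B" using cV_pos by (simp add: B_def)
  have V2: "0 \<le> ?V * 2 powr ?n" by (simp add: less_imp_le)
  have p1_nonneg: "0 \<le> p1 x" for x using p1.s_pos[of x] by simp
  have bound: "enn_powr (ennreal (wt1 x r) * loc_norm p1 (indicator (ball c \<rho>)) x r) q
      \<le> ennreal (B * (r powr (- ?n - ?n * q * gap x) * L powr q))"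
    if r: "0 < r" and L: "0 \<le> L" "loc_norm p1 (indicator (ball c \<rho>)) x r \<le> ennreal (A * L)" for x c \<rho> r L
  proof -
    have "enn_powr (ennreal (wt1 x r) * loc_norm p1 (indicator (ball c \<rho>)) x r) q \<le> enn_powr (ennreal (wt1 x r) * ennreal (A * L)) q"
      using q L by (intro enn_powr_mono mult_left_mono) auto
    also have "\<dots> = ennreal (wt1 x r powr q * (A powr q * L powr q))"
      using q A L by (subst enn_powr_mult[OF q]) (simp add: enn_powr_ennreal wt1_def powr_mult flip: ennreal_mult')
    also have "\<dots> \<le> ennreal ((cV * r powr (- ?n - ?n * q * gap x)) * (A powr q * L powr q))"
      by (intro ennreal_leI mult_right_mono wt1_powr_le r) simp
    finally show ?thesis by (simp add: B_def mult_ac)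
  qed
  show ?thesis
  proof (intro exI[of _ "B * (1 + ?V * 2 powr ?n)"] conjI allI impI)
    show "0 \<le> B * (1 + ?V * 2 powr ?n)" using B V2 by (intro mult_nonneg_nonneg add_nonneg_nonneg) auto
    fix c :: 'a and \<rho> Q r :: real
    assume \<rho>: "0 < \<rho>" and nr: "\<forall>x\<in>ball c (2 * \<rho>). near x (2 * \<rho>)" and Q: "0 \<le> Q"
      and QI: "\<forall>r>\<rho>. ball_int (\<lambda>x. ennreal (r powr (- ?n - ?n * q * gap x))) c (2 * r)
       \<le> ennreal (Q * \<rho> powr - (?n * q * gap c))"
      and r: "0 < r"
    let ?f = "indicator (ball c \<rho>) :: 'a \<Rightarrow> real"
    let ?t = "\<lambda>x. enn_powr (ennreal (wt1 x r) * loc_norm p1 ?f x r) q"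
    have zero: "loc_norm p1 ?f x r = 0" if "x \<notin> ball c (\<rho> + r)" for x
    proof (rule loc_norm_eq_0)
      fix y assume "y \<in> ball x r"
      then show "?f y = 0" using that dist_triangle[of c x y] by (auto simp: indicator_def dist_commute)
    qed
    show "(\<integral>\<^sup>+ x. ?t x \<partial>lebesgue) \<le> ennreal (B * (1 + ?V * 2 powr ?n) * (1 + Q) * \<rho> powr (?n * q / \<alpha>))"
    proof (cases "r \<le> \<rho>")
      case True
      define E where "E = B * r powr (?n * q / \<alpha> - ?n)"
      have "(\<integral>\<^sup>+ x. ?t x \<partial>lebesgue) \<le> (\<integral>\<^sup>+ x. ennreal E * indicator (ball c (2 * \<rho>)) x \<partial>lebesgue)"
      proof (rule nn_integral_mono)
        fix x
        show "?t x \<le> ennreal E * indicator (ball c (2 * \<rho>)) x"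
        proof (cases "x \<in> ball c (2 * \<rho>)")
          case False
          then have "x \<notin> ball c (\<rho> + r)" using True by auto
          then show ?thesis by (simp add: zero)
        next
          case x: True
          have nx: "near x r" using nr[rule_format, OF x] True r unfolding near_def by linarith
          have "loc_norm p1 ?f x r \<le> var_norm p1 (indicator (ball x r))"
            unfolding loc_norm_def using p1_nonneg by (intro var_norm_mono) (auto simp: indicator_def)
          also have "\<dots> \<le> ennreal (A * r powr (?n / p1 x))" using A(2)[OF r, of x] nx by (simp add: Phi_def)
          finally have "?t x \<le> ennreal (B * (r powr (- ?n - ?n * q * gap x) * (r powr (?n / p1 x)) powr q))"
            by (intro bound r) auto
          also have "r powr (- ?n - ?n * q * gap x) * (r powr (?n / p1 x)) powr q = r powr (?n * q / \<alpha> - ?n)"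
            unfolding powr_powr powr_add[symmetric] by (simp add: gap_def algebra_simps)
          finally show ?thesis using x by (simp add: E_def)
        qed
      qed
      also have "\<dots> = ennreal E * ennreal (?V * (2 * \<rho>) powr ?n)"
        using \<rho> by (simp add: nn_integral_cmult nn_integral_indicator_ball del: nn_integral_indicator)
      also have "\<dots> = ennreal (E * (?V * (2 * \<rho>) powr ?n))"
        using B by (intro ennreal_mult'[symmetric]) (simp add: E_def)
      also have "\<dots> \<le> ennreal (B * (1 + ?V * 2 powr ?n) * (1 + Q) * \<rho> powr (?n * q / \<alpha>))"
      proof (rule ennreal_leI)
        \<comment> \<open>This is where \<open>\<alpha> < q\<close> enters: the bound increases with
          \<open>r\<close>, so \<open>r = \<rho>\<close> is the worst case.\<close>
        have "0 \<le> ?n * q / \<alpha> - ?n" using \<alpha>_less \<alpha>_gt1 by (simp add: divide_simps)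
        then have "r powr (?n * q / \<alpha> - ?n) \<le> \<rho> powr (?n * q / \<alpha> - ?n)" using True r by (intro powr_mono2) auto
        then have "E * (?V * (2 * \<rho>) powr ?n) \<le> B * \<rho> powr (?n * q / \<alpha> - ?n) * (?V * (2 * \<rho>) powr ?n)"
          unfolding E_def using B by (intro mult_right_mono mult_left_mono) auto
        also have "\<dots> = B * (?V * 2 powr ?n) * (\<rho> powr (?n * q / \<alpha> - ?n) * \<rho> powr ?n)"
          by (simp only: powr_mult mult_ac)
        also have "\<rho> powr (?n * q / \<alpha> - ?n) * \<rho> powr ?n = \<rho> powr (?n * q / \<alpha>)"
          unfolding powr_add[symmetric] by simp
        also have "B * (?V * 2 powr ?n) * \<rho> powr (?n * q / \<alpha>) \<le> B * (1 + ?V * 2 powr ?n) * (1 + Q) * \<rho> powr (?n * q / \<alpha>)"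
        proof (intro mult_right_mono)
          have "B * (?V * 2 powr ?n) * 1 \<le> B * (1 + ?V * 2 powr ?n) * (1 + Q)"
            using B V2 Q by (intro mult_mono) auto
          then show "B * (?V * 2 powr ?n) \<le> B * (1 + ?V * 2 powr ?n) * (1 + Q)" by simp
        qed simp
        finally show "E * (?V * (2 * \<rho>) powr ?n) \<le> B * (1 + ?V * 2 powr ?n) * (1 + Q) * \<rho> powr (?n * q / \<alpha>)" .
      qed
      finally show ?thesis .
    next
      case False
      then have r\<rho>: "\<rho> < r" by simp
      define L where "L = \<rho> powr (?n / p1 c)"
      have nc: "near c \<rho>" using nr[rule_format, of c] \<rho> unfolding near_def by simp
      have "(\<integral>\<^sup>+ x. ?t x \<partial>lebesgue) \<le> (\<integral>\<^sup>+ x. ennreal (B * L powr q) *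
          (ennreal (r powr (- ?n - ?n * q * gap x)) * indicator (ball c (2 * r)) x) \<partial>lebesgue)"
      proof (rule nn_integral_mono)
        fix x
        show "?t x \<le> ennreal (B * L powr q) * (ennreal (r powr (- ?n - ?n * q * gap x)) * indicator (ball c (2 * r)) x)"
        proof (cases "x \<in> ball c (2 * r)")
          case False
          then have "x \<notin> ball c (\<rho> + r)" using r\<rho> by auto
          then show ?thesis by (simp add: zero)
        next
          case True
          have "loc_norm p1 ?f x r \<le> var_norm p1 (indicator (ball c \<rho>))"
            unfolding loc_norm_def using p1_nonneg by (intro var_norm_mono) (auto simp: indicator_def)
          also have "\<dots> \<le> ennreal (A * L)" using A(2)[OF \<rho>, of c] nc by (simp add: Phi_def L_def)
          finally have "?t x \<le> ennreal (B * (r powr (- ?n - ?n * q * gap x) * L powr q))"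
            by (intro bound r) (auto simp: L_def)
          also have "\<dots> = ennreal (B * L powr q) * ennreal (r powr (- ?n - ?n * q * gap x))"
            using B by (simp add: mult_ac flip: ennreal_mult')
          finally show ?thesis using True by simp
        qed
      qed
      also have "\<dots> = ennreal (B * L powr q) * ball_int (\<lambda>x. ennreal (r powr (- ?n - ?n * q * gap x))) c (2 * r)"
      proof -
        have [measurable]: "gap \<in> borel_measurable lebesgue" unfolding gap_def[abs_def] by measurable
        show ?thesis unfolding ball_int_def by (rule nn_integral_cmult) measurable
      qed
      also have "\<dots> \<le> ennreal (B * L powr q) * ennreal (Q * \<rho> powr - (?n * q * gap c))"
        using QI r\<rho> by (intro mult_left_mono) auto
      also have "\<dots> = ennreal (B * L powr q * (Q * \<rho> powr - (?n * q * gap c)))"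
        using B by (intro ennreal_mult'[symmetric]) simp
      also have "B * L powr q * (Q * \<rho> powr - (?n * q * gap c)) = B * Q * \<rho> powr (?n * q / \<alpha>)"
      proof -
        have "L powr q * \<rho> powr - (?n * q * gap c) = \<rho> powr (?n * q / \<alpha>)"
          unfolding L_def powr_powr powr_add[symmetric] by (simp add: gap_def algebra_simps)
        then show ?thesis by (metis mult.assoc mult.left_commute)
      qed
      also have "ennreal (B * Q * \<rho> powr (?n * q / \<alpha>)) \<le> ennreal (B * (1 + ?V * 2 powr ?n) * (1 + Q) * \<rho> powr (?n * q / \<alpha>))"
      proof (intro ennreal_leI mult_right_mono mult_mono)
        show "B \<le> B * (1 + ?V * 2 powr ?n)" using B V2 by (simp add: mult_le_cancel_left1)
      qed (use B V2 Q in auto)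
      finally show ?thesis .
    qed
  qed
qed

text \<open>While \<open>2 * r \<le> 1\<close> the oscillation condition at the origin exchanges
  \<open>gap x\<close> for \<open>gap 0\<close>. Beyond that the power of \<open>2 * r\<close> is at
  most 1, which the power of \<open>\<rho>\<close> on the right exceeds.\<close>

lemma Q_small:
  "\<exists>Q\<ge>0. \<forall>\<rho>. 0 < \<rho> \<longrightarrow> \<rho> \<le> 1 / 8 \<longrightarrow>
    (\<forall>r>\<rho>. ball_int (\<lambda>x. ennreal (r powr (- real DIM('a) - real DIM('a) * q * gap x))) 0 (2 * r)
       \<le> ennreal (Q * \<rho> powr - (real DIM('a) * q * gap 0)))"
proof -
  let ?n = "real DIM('a)" and ?V = "vol1 TYPE('a)"
  have q: "1 < q" by (rule q_gt1)
  have nq: "0 < ?n * q" using q by simp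
  have K: "0 \<le> K" using p1.decay[of 0] by (simp add: order_trans[OF abs_ge_zero])
  define D where "D = 2 powr (?n * q) * exp (?n * q * K)"
  have D: "2 powr (?n * q) \<le> D" unfolding D_def using K nq by (simp add: mult_le_cancel_left1)
  then have D0: "0 \<le> D" by (smt (verit) powr_ge_zero)
  show ?thesis
  proof (intro exI[of _ "D * (?V * 2 powr ?n)"] conjI allI impI)
    show "0 \<le> D * (?V * 2 powr ?n)" using D0 by (intro mult_nonneg_nonneg) auto
    fix \<rho> r :: real assume \<rho>: "0 < \<rho>" "\<rho> \<le> 1 / 8" and r: "\<rho> < r"
    have pw: "r powr - (?n * q * gap x) \<le> D * \<rho> powr - (?n * q * gap 0)" if x: "x \<in> ball 0 (2 * r)" for x
    proof -
      have "r powr - (?n * q * gap x) = 2 powr (?n * q * gap x) * (2 * r) powr - (?n * q * gap x)"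
        by (simp add: powr_mult powr_minus)
      also have "\<dots> \<le> 2 powr (?n * q) * (exp (?n * q * K) * \<rho> powr - (?n * q * gap 0))"
      proof (rule mult_mono)
        have "?n * q * gap x \<le> ?n * q * 1" using gap_bounds[of x] nq by (intro mult_left_mono) auto
        then show "2 powr (?n * q * gap x) \<le> 2 powr (?n * q)" by (intro powr_mono) auto
        show "(2 * r) powr - (?n * q * gap x) \<le> exp (?n * q * K) * \<rho> powr - (?n * q * gap 0)"
        proof (cases "2 * r \<le> 1")
          case True
          have "(2 * r) powr - (?n * q * gap x) = (2 * r) powr (?n * q * (gap 0 - gap x)) * (2 * r) powr - (?n * q * gap 0)"
            unfolding powr_add[symmetric] by (simp add: algebra_simps)
          also have "\<dots> \<le> exp (?n * q * K) * \<rho> powr - (?n * q * gap 0)"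
          proof (rule mult_mono)
            show "(2 * r) powr (?n * q * (gap 0 - gap x)) \<le> exp (?n * q * K)"
              using True \<rho> r x nq q by (intro p1.powr_osc[of "2 * r" 0 x]) (auto simp: near_def gap_def abs_mult)
            show "(2 * r) powr - (?n * q * gap 0) \<le> \<rho> powr - (?n * q * gap 0)"
              using \<rho> r nq gap_bounds[of 0] by (intro powr_mono2') auto
          qed auto
          finally show ?thesis .
        next
          case False
          have "(2 * r) powr - (?n * q * gap x) \<le> (2 * r) powr 0"
            using False nq gap_bounds[of x] by (intro powr_mono) auto
          also have "\<dots> = 1 * 1 powr - (?n * q * gap 0)" using r \<rho> by simp
          also have "\<dots> \<le> exp (?n * q * K) * \<rho> powr - (?n * q * gap 0)"
            using K nq gap_bounds[of 0] \<rho> by (intro mult_mono powr_mono2') auto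
          finally show ?thesis .
        qed
      qed auto
      finally show ?thesis by (simp add: D_def mult.assoc)
    qed
    let ?G = "D * \<rho> powr - (?n * q * gap 0) * r powr - ?n"
    have "ball_int (\<lambda>x. ennreal (r powr (- ?n - ?n * q * gap x))) 0 (2 * r) \<le> (\<integral>\<^sup>+ (x::'a). ennreal ?G * indicator (ball 0 (2 * r)) x \<partial>lebesgue)"
      unfolding ball_int_def
    proof (rule nn_integral_mono)
      fix x
      show "ennreal (r powr (- ?n - ?n * q * gap x)) * indicator (ball 0 (2 * r)) x \<le> ennreal ?G * indicator (ball 0 (2 * r)) x"
      proof (cases "x \<in> ball 0 (2 * r)")
        case True
        have "r powr (- ?n - ?n * q * gap x) = r powr - (?n * q * gap x) * r powr - ?n"
          unfolding powr_add[symmetric] by (simp add: algebra_simps)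
        also have "\<dots> \<le> ?G" by (intro mult_right_mono pw True) simp
        finally show ?thesis using True by (simp add: ennreal_leI)
      qed simp
    qed
    also have "\<dots> = ennreal ?G * ennreal (?V * (2 * r) powr ?n)"
      using r \<rho> by (simp add: nn_integral_cmult nn_integral_indicator_ball del: nn_integral_indicator)
    also have "\<dots> = ennreal (D * (?V * 2 powr ?n) * \<rho> powr - (?n * q * gap 0))"
    proof -
      have "r powr - ?n * r powr ?n = 1" using r \<rho> by (simp add: powr_minus)
      moreover have "?G * (?V * (2 * r) powr ?n) = D * (?V * 2 powr ?n) * \<rho> powr - (?n * q * gap 0) * (r powr - ?n * r powr ?n)"
        by (simp only: powr_mult mult_ac)
      ultimately have "?G * (?V * (2 * r) powr ?n) = D * (?V * 2 powr ?n) * \<rho> powr - (?n * q * gap 0)"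
        by (simp only: mult_1_right)
      then show ?thesis using D0 by (simp only: ennreal_mult'[symmetric] mult_nonneg_nonneg powr_ge_zero)
    qed
    finally show "ball_int (\<lambda>x. ennreal (r powr (- ?n - ?n * q * gap x))) 0 (2 * r)
      \<le> ennreal (D * (?V * 2 powr ?n) * \<rho> powr - (?n * q * gap 0))" .
  qed
qed

text \<open>Large test balls are placed so far from the origin that the exponent is almost constant on them and
  that the region near the origin, where the exponent may differ from its limit, is negligible.\<close>

lemma Q_large:
  "\<exists>Q\<ge>0. \<forall>\<rho> c. 1 \<le> \<rho> \<longrightarrow> norm c = 8 * \<rho> powr (1 + q) \<longrightarrow>
    (\<forall>r>\<rho>. ball_int (\<lambda>x. ennreal (r powr (- real DIM('a) - real DIM('a) * q * gap x))) c (2 * r)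
       \<le> ennreal (Q * \<rho> powr - (real DIM('a) * q * gap c)))"
proof -
  let ?n = "real DIM('a)" and ?V = "vol1 TYPE('a)"
  have q: "1 < q" by (rule q_gt1)
  have nq: "0 < ?n * q" using q by simp
  define D where "D = exp (?n * q * (2 * K))"
  show ?thesis
  proof (intro exI[of _ "D * (?V * 2 powr ?n) + ?V"] conjI allI impI)
    show "0 \<le> D * (?V * 2 powr ?n) + ?V" by (intro mult_nonneg_nonneg add_nonneg_nonneg) (auto simp: D_def)
    fix \<rho> r :: real and c :: 'a assume \<rho>: "1 \<le> \<rho>" and c: "norm c = 8 * \<rho> powr (1 + q)" and r: "\<rho> < r"
    let ?T = "\<rho> powr - (?n * q * gap c)"
    have \<rho>q: "\<rho> \<le> \<rho> powr (1 + q)" using powr_mono[of 1 "1 + q" \<rho>] \<rho> q by simp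
    have dec: "\<bar>1 / p1 x - 1 / p10\<bar> * ln \<rho> \<le> K" if "\<rho> \<le> norm x" for x
    proof -
      have "ln \<rho> \<le> ln (exp 1 + norm x)" using that \<rho> by (intro ln_mono) (auto simp: add_increasing)
      then have "\<bar>1 / p1 x - 1 / p10\<bar> * ln \<rho> \<le> \<bar>1 / p1 x - 1 / p10\<bar> * ln (exp 1 + norm x)"
        by (intro mult_left_mono) auto
      then show ?thesis using p1.decay[of x] by linarith
    qed
    \<comment> \<open>Both \<open>c\<close> and \<open>x\<close> have norm at least
      \<open>\<rho>\<close>, so both reciprocals lie within \<open>K / ln \<rho>\<close> of their
      limit and the difference of the gaps costs a constant.\<close>
    have pw: "r powr - (?n * q * gap x) \<le> D * ?T" if x: "\<rho> \<le> norm x" for x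
    proof -
      have "r powr - (?n * q * gap x) \<le> \<rho> powr - (?n * q * gap x)"
        using \<rho> r nq gap_bounds[of x] by (intro powr_mono2') auto
      also have "\<dots> = \<rho> powr (?n * q * (gap c - gap x)) * ?T"
        unfolding powr_add[symmetric] by (simp add: algebra_simps)
      also have "\<dots> \<le> D * ?T"
      proof (intro mult_right_mono)
        have ln0: "0 \<le> ln \<rho>" using \<rho> by simp
        have "(gap c - gap x) * ln \<rho> \<le> (\<bar>1 / p1 c - 1 / p10\<bar> + \<bar>1 / p1 x - 1 / p10\<bar>) * ln \<rho>"
          using ln0 by (intro mult_right_mono) (auto simp: gap_def)
        also have "\<dots> \<le> K + K" unfolding distrib_right using dec[of c] dec[OF x] \<rho>q c \<rho> by (intro add_mono) auto
        finally have "?n * q * ((gap c - gap x) * ln \<rho>) \<le> ?n * q * (2 * K)" using nq by (intro mult_left_mono) auto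
        then show "\<rho> powr (?n * q * (gap c - gap x)) \<le> D" using \<rho> by (simp add: powr_def D_def mult.assoc)
      qed simp
      finally show ?thesis .
    qed
    have rn: "r powr (- ?n - ?n * q * gap x) = r powr - (?n * q * gap x) * r powr - ?n" for x
      unfolding powr_add[symmetric] by (simp add: algebra_simps)
    let ?G = "D * ?T * r powr - ?n" and ?H = "?T * \<rho> powr - ?n"
    have DT: "0 \<le> D * ?T" by (simp add: D_def)
    \<comment> \<open>A ball around \<open>c\<close> reaching into \<open>ball 0 \<rho>\<close> has
      \<open>r \<ge> \<rho> powr (1 + q)\<close>, and then \<open>r powr - n\<close> is at most
      \<open>\<rho> powr - (n * q)\<close> times \<open>\<rho> powr - n\<close>. As
      \<open>gap c < 1\<close>, this is small enough whatever the exponent is near the origin; it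
      explains the distance chosen for \<open>c\<close>.\<close>
    have far: "r powr (- ?n - ?n * q * gap x) \<le> ?H" if "norm x < \<rho>" "x \<in> ball c (2 * r)" for x
    proof -
      have "norm c \<le> norm (c - x) + norm x" using norm_triangle_ineq[of "c - x" x] by simp
      then have "8 * \<rho> powr (1 + q) < 2 * r + \<rho>" using that c by (simp add: dist_norm)
      then have "\<rho> powr (1 + q) \<le> r" using \<rho>q \<rho> by linarith
      have "r powr (- ?n - ?n * q * gap x) \<le> r powr - ?n"
        using \<rho> r nq gap_bounds[of x] by (intro powr_mono) auto
      also have "\<dots> \<le> (\<rho> powr (1 + q)) powr - ?n"
        using \<open>\<rho> powr (1 + q) \<le> r\<close> \<rho> by (intro powr_mono2') auto
      also have "\<dots> = \<rho> powr - (?n * q * 1) * \<rho> powr - ?n"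
        unfolding powr_powr powr_add[symmetric] by (simp add: algebra_simps)
      also have "\<dots> \<le> ?T * \<rho> powr - ?n"
      proof (intro mult_right_mono powr_mono)
        show "- (?n * q * 1) \<le> - (?n * q * gap c)" using gap_bounds[of c] nq by (intro le_imp_neg_le mult_left_mono) auto
      qed (use \<rho> in auto)
      finally show ?thesis .
    qed
    have "ball_int (\<lambda>x. ennreal (r powr (- ?n - ?n * q * gap x))) c (2 * r)
      \<le> (\<integral>\<^sup>+ (x::'a). ennreal ?G * indicator (ball c (2 * r)) x + ennreal ?H * indicator (ball 0 \<rho>) x \<partial>lebesgue)"
      unfolding ball_int_def
    proof (rule nn_integral_mono)
      fix x
      show "ennreal (r powr (- ?n - ?n * q * gap x)) * indicator (ball c (2 * r)) x
        \<le> ennreal ?G * indicator (ball c (2 * r)) x + ennreal ?H * indicator (ball 0 \<rho>) x"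
      proof (cases "x \<in> ball c (2 * r)")
        case x: True
        show ?thesis
        proof (cases "\<rho> \<le> norm x")
          case True
          have "r powr (- ?n - ?n * q * gap x) \<le> ?G" unfolding rn by (intro mult_right_mono pw True) simp
          then show ?thesis using x by (auto intro: add_increasing2 ennreal_leI)
        next
          case False
          then have "r powr (- ?n - ?n * q * gap x) \<le> ?H" using x by (intro far) auto
          then show ?thesis using x False by (auto intro: add_increasing ennreal_leI)
        qed
      qed simp
    qed
    also have "\<dots> = (\<integral>\<^sup>+ (x::'a). ennreal ?G * indicator (ball c (2 * r)) x \<partial>lebesgue) + (\<integral>\<^sup>+ (x::'a). ennreal ?H * indicator (ball 0 \<rho>) x \<partial>lebesgue)"
      by (rule nn_integral_add) measurable
    also have "\<dots> = ennreal ?G * ennreal (?V * (2 * r) powr ?n) + ennreal ?H * ennreal (?V * \<rho> powr ?n)"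
      using r \<rho> by (simp add: nn_integral_cmult nn_integral_indicator_ball del: nn_integral_indicator)
    also have "\<dots> = ennreal (?G * (?V * (2 * r) powr ?n) + ?H * (?V * \<rho> powr ?n))"
    proof -
      have "0 \<le> ?G" "0 \<le> ?H" "0 \<le> ?V * (2 * r) powr ?n" "0 \<le> ?V * \<rho> powr ?n" using DT by (auto intro: mult_nonneg_nonneg)
      then show ?thesis by (simp only: ennreal_mult[symmetric] ennreal_plus[symmetric] mult_nonneg_nonneg)
    qed
    also have "?G * (?V * (2 * r) powr ?n) + ?H * (?V * \<rho> powr ?n) = (D * (?V * 2 powr ?n) + ?V) * ?T"
    proof -
      have 1: "r powr - ?n * r powr ?n = 1" "\<rho> powr - ?n * \<rho> powr ?n = 1" using r \<rho> by (simp_all add: powr_minus)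
      have "?G * (?V * (2 * r) powr ?n) = D * (?V * 2 powr ?n) * ?T * (r powr - ?n * r powr ?n)"
        by (simp only: powr_mult mult_ac)
      moreover have "?H * (?V * \<rho> powr ?n) = ?V * ?T * (\<rho> powr - ?n * \<rho> powr ?n)"
        by (simp only: mult_ac)
      ultimately show ?thesis unfolding 1 by (simp only: distrib_right mult_1_right)
    qed
    finally show "ball_int (\<lambda>x. ennreal (r powr (- ?n - ?n * q * gap x))) c (2 * r)
      \<le> ennreal ((D * (?V * 2 powr ?n) + ?V) * ?T)" .
  qed
qed

text \<open>On the test ball the potential is at least a multiple of
  \<open>\<rho> powr \<gamma>\<close>, and from each of its points a ball of radius
  \<open>2 * \<rho>\<close> sees all of it. The exponent at the centre cancels against the weight,
  leaving \<open>\<rho> powr (eps + \<gamma>)\<close>; its \<open>q\<close>-th power times the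
  volume gives the exponent stated.\<close>

lemma test_lower:
  "\<exists>c0>0. \<forall>c \<rho>. 0 < \<rho> \<longrightarrow> (\<forall>x\<in>ball c (2 * \<rho>). near x (2 * \<rho>)) \<longrightarrow>
    ennreal (c0 * \<rho> powr (q * (\<gamma> + real DIM('a) / \<beta>)))
    \<le> (\<integral>\<^sup>+ x. enn_powr (ennreal (wt x (2 * \<rho>)) * loc_norm p2 (frac_int \<gamma> (indicator (ball c \<rho>))) x (2 * \<rho>)) q \<partial>lebesgue)"
proof -
  let ?n = "real DIM('a)" and ?V = "vol1 TYPE('a)"
  have q: "0 < q" using q_gt1 by simp
  define k where "k = ?V * 2 powr - (?n - \<gamma>)"
  have k: "0 < k" by (simp add: k_def)
  obtain c1 where c1: "0 < c1" "\<And>z x \<rho> t. \<lbrakk>0 < \<rho>; near x (2 * \<rho>); x \<in> ball z \<rho>; 0 < t\<rbrakk> \<Longrightarrow>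
    ennreal (c1 * t * \<rho> powr (?n / p2 x)) \<le> var_norm p2 (\<lambda>y. k * t * indicator (ball z \<rho>) y)"
    using p2.var_norm_ball_ge[OF k] by blast
  define c0 where "c0 = (1 / cV * 2 powr - (2 * ?n * q) * c1 powr q) * ?V"
  have c0: "0 < c0" using cV_pos c1 by (simp add: c0_def)
  show ?thesis
  proof (intro exI[of _ c0] conjI allI impI c0)
    fix c :: 'a and \<rho> :: real
    assume \<rho>: "0 < \<rho>" and nr: "\<forall>x\<in>ball c (2 * \<rho>). near x (2 * \<rho>)"
    let ?f = "indicator (ball c \<rho>) :: 'a \<Rightarrow> real"
    let ?E = "1 / cV * 2 powr - (2 * ?n * q) * c1 powr q * \<rho> powr (q * (\<gamma> + ?n / \<beta>) - ?n)"
    have If: "k * \<rho> powr \<gamma> \<le> frac_int \<gamma> ?f y" if y: "y \<in> ball c \<rho>" for y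
    proof -
      have ind: "(\<lambda>z. ennreal (?f z)) = (\<lambda>z. indicator (ball c \<rho>) z)" by (auto simp: indicator_def)
      have eq: "ennreal (frac_int \<gamma> ?f y) = riesz \<gamma> (\<lambda>z. ennreal (?f z)) y"
        by (rule frac_int_eq_riesz) (use riesz_indicator_ball(1)[OF \<gamma>_pos \<gamma>_less \<rho> y] in \<open>auto simp: ind\<close>)
      have "ennreal (k * \<rho> powr \<gamma>) \<le> ennreal (frac_int \<gamma> ?f y)"
        unfolding eq ind k_def by (rule riesz_indicator_ball(2)[OF \<gamma>_pos \<gamma>_less \<rho> y])
      moreover have "0 < k * \<rho> powr \<gamma>" using k \<rho> by simp
      ultimately show ?thesis by (metis ennreal_le_iff2 not_le)
    qed
    have pw: "?E \<le> (wt x (2 * \<rho>) * (c1 * \<rho> powr \<gamma> * \<rho> powr (?n / p2 x))) powr q" if x: "x \<in> ball c \<rho>" for x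
    proof -
      have "wt x (2 * \<rho>) * (c1 * \<rho> powr \<gamma> * \<rho> powr (?n / p2 x))
        = ?V powr wexp x * 2 powr (?n * wexp x) * c1 * (\<rho> powr (eps - ?n / p2 x) * \<rho> powr \<gamma> * \<rho> powr (?n / p2 x))"
        using \<rho> unfolding wexp_eps by (simp add: wt_eq powr_mult mult_ac)
      also have "\<rho> powr (eps - ?n / p2 x) * \<rho> powr \<gamma> * \<rho> powr (?n / p2 x) = \<rho> powr (eps + \<gamma>)"
        unfolding powr_add[symmetric] by simp
      finally have e1: "wt x (2 * \<rho>) * (c1 * \<rho> powr \<gamma> * \<rho> powr (?n / p2 x))
        = ?V powr wexp x * 2 powr (?n * wexp x) * c1 * \<rho> powr (eps + \<gamma>)" .
      have "(wt x (2 * \<rho>) * (c1 * \<rho> powr \<gamma> * \<rho> powr (?n / p2 x))) powr q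
        = ?V powr (wexp x * q) * 2 powr (?n * wexp x * q) * c1 powr q * \<rho> powr ((eps + \<gamma>) * q)"
        unfolding e1 by (simp add: powr_mult powr_powr)
      also have "(eps + \<gamma>) * q = q * (\<gamma> + ?n / \<beta>) - ?n" using q by (simp add: eps_def field_simps)
      also have "?E \<le> ?V powr (wexp x * q) * 2 powr (?n * wexp x * q) * c1 powr q * \<rho> powr (q * (\<gamma> + ?n / \<beta>) - ?n)"
      proof (intro mult_right_mono mult_mono vol1_powr_le powr_mono)
        have "\<bar>?n * wexp x * q\<bar> \<le> ?n * 2 * q" using wexp_bounds(1)[of x] q_gt1 by (simp add: abs_mult)
        then show "- (2 * ?n * q) \<le> ?n * wexp x * q" by linarith
      qed (use cV_pos in auto)
      finally show ?thesis .
    qed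
    have "ennreal (c0 * \<rho> powr (q * (\<gamma> + ?n / \<beta>))) = ennreal ?E * ennreal (?V * \<rho> powr ?n)"
    proof -
      have "\<rho> powr (q * (\<gamma> + ?n / \<beta>)) = \<rho> powr (q * (\<gamma> + ?n / \<beta>) - ?n) * \<rho> powr ?n"
        unfolding powr_add[symmetric] by simp
      then have "c0 * \<rho> powr (q * (\<gamma> + ?n / \<beta>)) = ?E * (?V * \<rho> powr ?n)"
        by (simp only: c0_def mult_ac)
      moreover have "0 \<le> ?E" using cV_pos by simp
      ultimately show ?thesis by (simp only: ennreal_mult')
    qed
    also have "\<dots> = (\<integral>\<^sup>+ x. ennreal ?E * indicator (ball c \<rho>) x \<partial>lebesgue)"
      using \<rho> by (simp add: nn_integral_cmult nn_integral_indicator_ball del: nn_integral_indicator)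
    also have "\<dots> \<le> (\<integral>\<^sup>+ x. enn_powr (ennreal (wt x (2 * \<rho>)) * loc_norm p2 (frac_int \<gamma> ?f) x (2 * \<rho>)) q \<partial>lebesgue)"
    proof (rule nn_integral_mono)
      fix x
      show "ennreal ?E * indicator (ball c \<rho>) x \<le> enn_powr (ennreal (wt x (2 * \<rho>)) * loc_norm p2 (frac_int \<gamma> ?f) x (2 * \<rho>)) q"
      proof (cases "x \<in> ball c \<rho>")
        case True
        have nx: "near x (2 * \<rho>)" using nr True \<rho> by auto
        have "ennreal (c1 * \<rho> powr \<gamma> * \<rho> powr (?n / p2 x)) \<le> var_norm p2 (\<lambda>y. k * \<rho> powr \<gamma> * indicator (ball c \<rho>) y)"
          using \<rho> by (intro c1 nx True) auto
        also have "\<dots> \<le> loc_norm p2 (frac_int \<gamma> ?f) x (2 * \<rho>)"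
          unfolding loc_norm_def
        proof (rule var_norm_mono)
          fix y
          show "\<bar>k * \<rho> powr \<gamma> * indicator (ball c \<rho>) y\<bar> \<le> \<bar>frac_int \<gamma> ?f y * indicator (ball x (2 * \<rho>)) y\<bar>"
          proof (cases "y \<in> ball c \<rho>")
            case y: True
            have "y \<in> ball x (2 * \<rho>)" using y True dist_triangle2[of x y c] by (simp add: dist_commute)
            then show ?thesis using y If[OF y] k by simp
          qed simp
          show "0 \<le> p2 y" using p2.s_pos[of y] by simp
        qed
        finally have 1: "ennreal (c1 * \<rho> powr \<gamma> * \<rho> powr (?n / p2 x)) \<le> loc_norm p2 (frac_int \<gamma> ?f) x (2 * \<rho>)" .
        have "ennreal ?E \<le> ennreal ((wt x (2 * \<rho>) * (c1 * \<rho> powr \<gamma> * \<rho> powr (?n / p2 x))) powr q)"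
          by (intro ennreal_leI pw True)
        also have "\<dots> = enn_powr (ennreal (wt x (2 * \<rho>)) * ennreal (c1 * \<rho> powr \<gamma> * \<rho> powr (?n / p2 x))) q"
          using c1 wt_nonneg[of x "2 * \<rho>"] by (simp add: enn_powr_ennreal flip: ennreal_mult')
        also have "\<dots> \<le> enn_powr (ennreal (wt x (2 * \<rho>)) * loc_norm p2 (frac_int \<gamma> ?f) x (2 * \<rho>)) q"
          using q 1 by (intro enn_powr_mono mult_left_mono) auto
        finally show ?thesis using True by simp
      qed simp
    qed
    finally show "ennreal (c0 * \<rho> powr (q * (\<gamma> + ?n / \<beta>)))
      \<le> (\<integral>\<^sup>+ x. enn_powr (ennreal (wt x (2 * \<rho>)) * loc_norm p2 (frac_int \<gamma> ?f) x (2 * \<rho>)) q \<partial>lebesgue)" .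
  qed
qed

end

section \<open>Log-Hoelder continuity\<close>

lemma abs_inverse_diff_le:
  fixes s t :: real
  assumes "1 \<le> s" "1 \<le> t"
  shows "\<bar>1 / s - 1 / t\<bar> \<le> \<bar>s - t\<bar>"
proof -
  have "\<bar>1 / s - 1 / t\<bar> = \<bar>s - t\<bar> / (s * t)"
    using assms by (simp add: divide_simps abs_mult abs_minus_commute)
  also have "\<dots> \<le> \<bar>s - t\<bar> / 1"
    using assms mult_mono[of 1 s 1 t] by (intro divide_left_mono) auto
  finally show ?thesis by simp
qed

text \<open>The decay condition makes the values along a ray a Cauchy sequence. It compares every
  \<open>x\<close> with all points of at least the same norm, hence with the tail of the ray, and
  survives the limit.\<close>

lemma log_hoelder_limit:
  fixes p :: "'a::euclidean_space \<Rightarrow> real"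
  assumes lh: "log_hoelder C p" and C: "0 < C"
  obtains p0 where "\<And>x. \<bar>p x - p0\<bar> \<le> C / ln (norm x + exp 1)"
    "\<And>c. (\<And>x. c \<le> p x) \<Longrightarrow> c \<le> p0" "\<And>c. (\<And>x. p x \<le> c) \<Longrightarrow> p0 \<le> c"
proof -
  obtain b :: 'a where b: "norm b = 1" using vector_choose_size[of 1] by auto
  define s where "s k = p (real k *\<^sub>R b)" for k :: nat
  have ns: "norm (real k *\<^sub>R b) = real k" for k using b by simp
  have far: "\<bar>p x - s k\<bar> \<le> C / ln (norm x + exp 1)" if "norm x \<le> real k" for x k
    using lh that ns[of k] unfolding log_hoelder_def s_def by metis
  have "Cauchy s"
  proof (rule metric_CauchyI)
    fix e :: real assume e: "0 < e"
    obtain M :: nat where M: "exp (C / e) < real M" using reals_Archimedean2 by blast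
    show "\<exists>M. \<forall>m\<ge>M. \<forall>n\<ge>M. dist (s m) (s n) < e"
    proof (intro exI allI impI)
      have main: "dist (s m) (s n) < e" if "M \<le> m" "m \<le> n" for m n
      proof -
        have "exp (C / e) < real m + exp 1" using M that by (smt (verit) exp_gt_zero of_nat_mono)
        then have "C / e < ln (real m + exp 1)" by (metis exp_gt_zero ln_exp ln_less_cancel_iff order_less_trans)
        moreover have "0 < C / e" using C e by simp
        moreover have "C < ln (real m + exp 1) * e"
          using calculation(1) e by (simp add: pos_divide_less_eq)
        ultimately have "0 < ln (real m + exp 1)" "C < ln (real m + exp 1) * e" by (auto intro: less_trans)
        then have "C / ln (real m + exp 1) < e" by (simp add: pos_divide_less_eq mult.commute)
        moreover have "\<bar>s m - s n\<bar> \<le> C / ln (real m + exp 1)"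
          using far[of "real m *\<^sub>R b" n] that b by (simp add: s_def)
        ultimately show ?thesis by (simp add: dist_real_def)
      qed
      fix m n assume "M \<le> m" "M \<le> n"
      then show "dist (s m) (s n) < e" using main[of m n] main[of n m] by (cases "m \<le> n") (auto simp: dist_commute)
    qed
  qed
  then obtain p0 where p0: "s \<longlonglongrightarrow> p0" using Cauchy_convergent[of s] convergentD by blast
  show ?thesis
  proof (rule that[of p0])
    fix x :: 'a
    have "\<forall>\<^sub>F k in sequentially. norm x \<le> real k"
      by (intro eventually_sequentiallyI[of "nat \<lceil>norm x\<rceil>"]) linarith
    then have "\<forall>\<^sub>F k in sequentially. \<bar>p x - s k\<bar> \<le> C / ln (norm x + exp 1)"
      by eventually_elim (rule far)
    then show "\<bar>p x - p0\<bar> \<le> C / ln (norm x + exp 1)"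
      by (rule tendsto_upperbound[rotated]) (auto intro!: tendsto_intros p0)
  next
    fix c assume "\<And>x. c \<le> p x"
    then show "c \<le> p0" by (intro tendsto_lowerbound[OF p0]) (auto simp: s_def)
  next
    fix c assume "\<And>x. p x \<le> c"
    then show "p0 \<le> c" by (intro tendsto_upperbound[OF p0]) (auto simp: s_def)
  qed
qed

text \<open>\<open>p_minus\<close> is only an essential infimum. Continuity turns the almost
  everywhere bound into a bound at every point: a violation would persist on a ball of positive
  measure.\<close>

lemma log_hoelder_lower:
  fixes p :: "'a::euclidean_space \<Rightarrow> real"
  assumes p: "var_exp p" and lh: "log_hoelder C p" and C: "0 < C"
  obtains a where "1 < a" "\<And>x. a \<le> p x"
proof -
  have meas [measurable]: "p \<in> borel_measurable lebesgue" and "p_minus p > 1" using p by (auto simp: var_exp_def)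
  then obtain a where a: "1 < ereal a" "ereal a < p_minus p"
    using ereal_dense2[of 1 "p_minus p"] by (auto simp: one_ereal_def)
  have lt: "esssup lebesgue (\<lambda>x. - ereal (p x)) < - ereal a"
    using a(2) unfolding p_minus_def ereal_less_uminus_reorder[of "ereal a"] .
  have "AE x in lebesgue. - ereal (p x) \<le> esssup lebesgue (\<lambda>x. - ereal (p x))"
    by (rule esssup_AE)
  then have AE: "AE x in lebesgue. a < p x"
  proof eventually_elim
    fix x assume "- ereal (p x) \<le> esssup lebesgue (\<lambda>x. - ereal (p x))"
    then have "- ereal (p x) < - ereal a" using lt by (rule le_less_trans)
    then show "a < p x" by simp
  qed
  have "a \<le> p x" for x
  proof (rule ccontr)
    assume "\<not> a \<le> p x"
    then have d: "0 < a - p x" by simp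
    \<comment> \<open>The bound \<open>1 / 2\<close> makes the local condition applicable; the
      exponential makes its modulus of continuity at most \<open>a - p x\<close>.\<close>
    define \<delta> where "\<delta> = min (1 / 2) (exp (- (C / (a - p x))))"
    have \<delta>: "0 < \<delta>" "\<delta> \<le> 1 / 2" "ln \<delta> \<le> - (C / (a - p x))"
      using ln_mono[of \<delta> "exp (- (C / (a - p x)))"] by (auto simp: \<delta>_def)
    have sub: "\<not> a < p y" if y: "y \<in> ball x \<delta>" for y
    proof (cases "y = x")
      case False
      have n: "0 < norm (x - y)" "norm (x - y) < \<delta>" using False y by (auto simp: dist_norm)
      then have "ln (norm (x - y)) < ln \<delta>" using \<delta> by (subst ln_less_cancel_iff) auto
      then have l: "C / (a - p x) < - ln (norm (x - y))" using \<delta> by linarith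
      have "\<bar>p x - p y\<bar> \<le> C / (- ln (norm (x - y)))"
        using lh n \<delta> False unfolding log_hoelder_def by (metis less_eq_real_def order_trans)
      also have "\<dots> \<le> C / (C / (a - p x))"
      proof (rule divide_left_mono)
        have "0 < C / (a - p x)" using C d by simp
        then show "0 < - ln (norm (x - y)) * (C / (a - p x))" using l by (intro mult_pos_pos) auto
      qed (use l C in auto)
      also have "\<dots> = a - p x" using C by simp
      finally show ?thesis by linarith
    qed (use d in simp)
    from AE obtain N where N: "{y \<in> space lebesgue. \<not> a < p y} \<subseteq> N" "emeasure lebesgue N = 0" "N \<in> sets lebesgue"
      by (rule AE_E)
    then have "emeasure lebesgue (ball x \<delta>) \<le> emeasure lebesgue N"
      using sub by (intro emeasure_mono) auto
    moreover have "0 < vol1 TYPE('a) * \<delta> powr real DIM('a)" using \<delta> by (intro mult_pos_pos) auto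
    ultimately show False using N(2) \<delta>(1) emeasure_lebesgue_ball[of \<delta> x] by (simp only: ennreal_eq_0_iff le_zero_eq less_imp_le not_le)
  qed
  then show ?thesis using a that[of a] by (simp add: one_ereal_def)
qed

text \<open>Two conditions in the hypotheses yield one condition on \<open>near\<close> balls, by a
  split on the radius. The additional 1 in \<open>C + 1\<close> pays for radii between
  \<open>1 / 2\<close> and 1.\<close>

lemma log_exponent_intro:
  fixes p :: "'a::euclidean_space \<Rightarrow> real"
  assumes lh: "log_hoelder C p" and C: "0 < C" and meas: "p \<in> borel_measurable lebesgue"
    and a: "1 < a" and lower: "\<And>x. a \<le> p x" "a \<le> p0" and upper: "\<And>x. p x \<le> P" "p0 \<le> P"
    and lim: "\<And>x. \<bar>p x - p0\<bar> \<le> C / ln (norm x + exp 1)"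
  shows "log_exponent p p0 a P (C + 1)"
proof
  have p1: "1 \<le> p x" for x using a lower(1)[of x] by linarith
  have p01: "1 \<le> p0" using a lower(2) by linarith
  have ln0: "1 \<le> ln (norm z + exp 1)" for z :: 'a
    using ln_mono[of "exp 1" "norm z + exp 1"] by simp
  show "\<bar>1 / p x - 1 / p0\<bar> * ln (exp 1 + norm x) \<le> C + 1" for x
  proof -
    have "\<bar>1 / p x - 1 / p0\<bar> \<le> C / ln (norm x + exp 1)"
      using abs_inverse_diff_le[OF p1 p01, of x] lim[of x] by linarith
    then have "\<bar>1 / p x - 1 / p0\<bar> * ln (norm x + exp 1) \<le> C" using ln0[of x] by (simp add: pos_le_divide_eq)
    then show ?thesis by (simp add: add.commute)
  qed
  fix x y :: 'a and R :: real
  assume R: "0 < R" and nr: "near x R" and y: "y \<in> ball x R"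
  let ?d = "\<bar>1 / p x - 1 / p y\<bar>"
  have d: "?d \<le> \<bar>p x - p y\<bar>" by (rule abs_inverse_diff_le[OF p1 p1])
  have xy: "norm (x - y) < R" using y by (simp add: dist_norm)
  consider "y = x" | "y \<noteq> x" "R \<le> 1 / 2" | "1 / 2 < R" "R \<le> 1" | "1 < R" by linarith
  then show "\<bar>ln R\<bar> * ?d \<le> C + 1"
  proof cases
    case 1
    then show ?thesis using C by simp
  next
    case 2
    have n: "0 < norm (x - y)" using 2 by simp
    have lt: "ln (norm (x - y)) < ln R" using n xy R by (subst ln_less_cancel_iff) auto
    have lR: "ln R < 0" using R 2 by simp
    have "?d \<le> C / (- ln (norm (x - y)))"
      using d lh 2 xy unfolding log_hoelder_def by (smt (verit))
    also have "\<dots> \<le> C / (- ln R)"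
      using lt lR C by (intro divide_left_mono mult_pos_pos) auto
    finally have "?d * (- ln R) \<le> C" using lR by (subst (asm) pos_le_divide_eq) auto
    moreover have "\<bar>ln R\<bar> = - ln R" using lR by simp
    ultimately show ?thesis by (simp add: mult.commute)
  next
    case 3
    \<comment> \<open>Neither continuity condition is needed on this bounded range of scales: the
      logarithm is at most \<open>ln 2\<close> and the reciprocals lie between 0 and 1.\<close>
    have "ln (1 / 2) \<le> ln R" using 3 by simp
    then have "- ln R \<le> ln 2" by (simp add: ln_div)
    moreover have "ln R \<le> 0" using 3 R by simp
    ultimately have "\<bar>ln R\<bar> \<le> 1" using ln_2_less_1 by linarith
    moreover have "?d \<le> 1"
    proof -
      have "0 < 1 / p z \<and> 1 / p z \<le> 1" for z using p1[of z] by simp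
      from this[of x] this[of y] show ?thesis by linarith
    qed
    ultimately have "\<bar>ln R\<bar> * ?d \<le> 1 * 1" by (intro mult_mono) auto
    then show ?thesis using C by simp
  next
    case 4
    \<comment> \<open>Only here does the definition of \<open>near\<close> matter: all points of the
      ball have norm at least \<open>R\<close>, so the decay condition gives the bound
      \<open>C / ln R\<close>.\<close>
    then have x: "R \<le> norm x / 2" using nr by (auto simp: near_def)
    have "norm x \<le> norm (x - y) + norm y" using norm_triangle_ineq[of "x - y" y] by simp
    then have ny: "R \<le> norm y" using x xy by linarith
    have nx: "R \<le> norm x" using x 4 by linarith
    have lR: "0 < ln R" using 4 by simp
    have le: "C / ln (norm z + exp 1) \<le> C / ln R" if "R \<le> norm z" for z :: 'a
    proof -
      have "ln R \<le> ln (norm z + exp 1)" using that R by (intro ln_mono) (auto simp: add_increasing2)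
      then show ?thesis using C lR by (intro divide_left_mono mult_pos_pos) auto
    qed
    have "\<bar>p x - p y\<bar> \<le> C / ln R"
    proof (cases "norm x \<le> norm y")
      case True
      then have "\<bar>p x - p y\<bar> \<le> C / ln (norm x + exp 1)" using lh unfolding log_hoelder_def by blast
      then show ?thesis using le[OF nx] by linarith
    next
      case False
      then have "\<bar>p y - p x\<bar> \<le> C / ln (norm y + exp 1)" using lh unfolding log_hoelder_def by (meson linear)
      then show ?thesis using le[OF ny] by linarith
    qed
    with d have "?d \<le> C / ln R" by linarith
    then have "?d * ln R \<le> C" using lR by (simp add: pos_le_divide_eq)
    then show ?thesis using lR by (simp add: mult.commute)
  qed
qed (use a lower upper meas in auto)

lemma powr_bounded_imp_nonpos:
  fixes d :: real
  assumes "\<And>t. 8 \<le> t \<Longrightarrow> t powr d \<le> M"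
  shows "d \<le> 0"
proof (rule ccontr)
  assume "\<not> d \<le> 0"
  then have d: "0 < d" by simp
  define t where "t = max 8 ((\<bar>M\<bar> + 1) powr (1 / d))"
  have "((\<bar>M\<bar> + 1) powr (1 / d)) powr d \<le> t powr d" using d by (intro powr_mono2) (auto simp: t_def)
  then have "\<bar>M\<bar> + 1 \<le> t powr d" using d by (simp add: powr_powr)
  moreover have "t powr d \<le> M" by (intro assms) (simp add: t_def)
  ultimately show False by linarith
qed

section \<open>Fofana norms and the two implications\<close>

lemma fofana_norm_eq:
  "fofana_norm p q \<alpha> f = (SUP r\<in>{0<..}. enn_powr (\<integral>\<^sup>+ x. enn_powr (ennreal
     (measure lebesgue (ball x r) powr (1 / \<alpha> - 1 / p x - 1 / q)) * loc_norm p f x r) q \<partial>lebesgue) (1 / q))"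
  by (simp add: fofana_norm_def Lq_norm_def loc_norm_def)

lemma fofana_norm_le:
  assumes q: "0 < q" and "\<And>r. 0 < r \<Longrightarrow> (\<integral>\<^sup>+ x. enn_powr (ennreal
     (measure lebesgue (ball x r) powr (1 / \<alpha> - 1 / p x - 1 / q)) * loc_norm p f x r) q \<partial>lebesgue) \<le> enn_powr N q"
  shows "fofana_norm p q \<alpha> f \<le> N"
  unfolding fofana_norm_eq
proof (rule SUP_least)
  fix r :: real assume "r \<in> {0<..}"
  then have "enn_powr (\<integral>\<^sup>+ x. enn_powr (ennreal
     (measure lebesgue (ball x r) powr (1 / \<alpha> - 1 / p x - 1 / q)) * loc_norm p f x r) q \<partial>lebesgue) (1 / q)
     \<le> enn_powr (enn_powr N q) (1 / q)"
    using q assms(2)[of r] by (intro enn_powr_mono) auto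
  also have "\<dots> = N" using q by (simp add: enn_powr_inverse)
  finally show "enn_powr (\<integral>\<^sup>+ x. enn_powr (ennreal
     (measure lebesgue (ball x r) powr (1 / \<alpha> - 1 / p x - 1 / q)) * loc_norm p f x r) q \<partial>lebesgue) (1 / q) \<le> N" .
qed

lemma le_fofana_norm:
  assumes q: "0 < q" and r: "0 < r"
  shows "(\<integral>\<^sup>+ x. enn_powr (ennreal
     (measure lebesgue (ball x r) powr (1 / \<alpha> - 1 / p x - 1 / q)) * loc_norm p f x r) q \<partial>lebesgue)
    \<le> enn_powr (fofana_norm p q \<alpha> f) q" (is "?I \<le> _")
proof -
  have "enn_powr ?I (1 / q) \<le> fofana_norm p q \<alpha> f"
    unfolding fofana_norm_eq using r by (intro SUP_upper) auto
  then have "enn_powr (enn_powr ?I (1 / q)) q \<le> enn_powr (fofana_norm p q \<alpha> f) q"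
    using q by (intro enn_powr_mono) auto
  then show ?thesis using q by (simp add: enn_powr_powr)
qed

text \<open>If the local norm at radius \<open>2 * \<rho>\<close> were infinite at every centre in
  \<open>ball 0 \<rho>\<close>, the norm would be infinite, the weight being positive. So some
  centre has a finite local norm, and its ball contains \<open>F\<close>.\<close>

lemma in_var_Lp_loc_of_fofana_norm:
  fixes f p :: "'a::euclidean_space \<Rightarrow> real"
  assumes f [measurable]: "f \<in> borel_measurable lebesgue" and p: "\<And>x. 0 \<le> p x"
    and q: "0 < q" and fin: "fofana_norm p q \<alpha> f < top"
  shows "in_var_Lp_loc p f"
  unfolding in_var_Lp_loc_def in_var_Lp_def
proof (intro conjI allI impI f)
  fix F :: "'a set" assume F: "compact F"
  then have Fl: "F \<in> sets lebesgue" by (simp add: borel_compact)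
  then show "(\<lambda>x. f x * indicator F x) \<in> borel_measurable lebesgue" by measurable
  obtain \<rho> where \<rho>: "0 < \<rho>" "F \<subseteq> ball 0 \<rho>"
    using bounded_subset_ballD[OF compact_imp_bounded[OF F], of 0] by auto
  have "\<exists>x\<in>ball 0 \<rho>. loc_norm p f x (2 * \<rho>) < top"
  proof (rule ccontr)
    assume "\<not> (\<exists>x\<in>ball 0 \<rho>. loc_norm p f x (2 * \<rho>) < top)"
    then have top: "loc_norm p f x (2 * \<rho>) = top" if "x \<in> ball 0 \<rho>" for x
      using that top.not_eq_extremum by blast
    have "top = (\<integral>\<^sup>+ x. top * indicator (ball (0::'a) \<rho>) x \<partial>lebesgue)"
      using \<rho> by (subst nn_integral_cmult) (simp_all add: nn_integral_indicator_ball ennreal_top_mult ennreal_eq_0_iff not_le mult_pos_pos del: nn_integral_indicator)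
    also have "\<dots> \<le> (\<integral>\<^sup>+ x. enn_powr (ennreal
     (measure lebesgue (ball x (2 * \<rho>)) powr (1 / \<alpha> - 1 / p x - 1 / q)) * loc_norm p f x (2 * \<rho>)) q \<partial>lebesgue)"
    proof (rule nn_integral_mono)
      fix x :: 'a
      have "0 < measure lebesgue (ball x (2 * \<rho>))" using \<rho> by (subst measure_lebesgue_ball) auto
      then show "top * indicator (ball 0 \<rho>) x \<le> enn_powr (ennreal
        (measure lebesgue (ball x (2 * \<rho>)) powr (1 / \<alpha> - 1 / p x - 1 / q)) * loc_norm p f x (2 * \<rho>)) q"
        using top[of x] by (cases "x \<in> ball 0 \<rho>") (auto simp: ennreal_mult_top)
    qed
    also have "\<dots> \<le> enn_powr (fofana_norm p q \<alpha> f) q" using \<rho> by (intro le_fofana_norm q) auto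
    finally show False using fin by (simp add: top_unique)
  qed
  then obtain x where x: "x \<in> ball 0 \<rho>" "loc_norm p f x (2 * \<rho>) < top" by blast
  have "F \<subseteq> ball x (2 * \<rho>)"
  proof
    fix y assume "y \<in> F"
    then have "norm y < \<rho>" using \<rho> by auto
    then show "y \<in> ball x (2 * \<rho>)" using x(1) norm_triangle_ineq4[of x y] by (simp add: dist_norm)
  qed
  then have "var_norm p (\<lambda>x. f x * indicator F x) \<le> loc_norm p f x (2 * \<rho>)"
    unfolding loc_norm_def using p by (intro var_norm_mono) (auto simp: indicator_def)
  then show "var_norm p (\<lambda>x. f x * indicator F x) < top" using x(2) by order
qed

context fofana_pair
begin

lemma fofana_bounded_of_scaling:
  assumes \<alpha>: "\<gamma> = real DIM('a) / \<alpha> - real DIM('a) / \<beta>"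
  shows "fofana_bounded (frac_int \<gamma>) p1 \<alpha> q p2 \<beta>"
proof -
  have q: "0 < q" using q_gt1 by simp
  \<comment> \<open>The scaling relation and the relation between the exponents cancel: source and
    target weights coincide at every centre.\<close>
  have wexp1: "1 / \<alpha> - 1 / p1 x - 1 / q = wexp x" for x
  proof -
    have "real DIM('a) * (1 / \<alpha> - 1 / p1 x) = real DIM('a) * (1 / \<beta> - 1 / p2 x)"
      using sobolev[of x] \<alpha> by (simp add: algebra_simps)
    then show ?thesis by (simp add: wexp_def)
  qed
  obtain C where C: "0 \<le> C" "\<And>(f :: 'a \<Rightarrow> real) N r. \<lbrakk>f \<in> borel_measurable lebesgue;
     \<forall>R>0. (\<integral>\<^sup>+ x. enn_powr (ennreal (wt x R) * loc_norm p1 f x R) q \<partial>lebesgue) \<le> N; 0 < r\<rbrakk> \<Longrightarrow>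
     (\<integral>\<^sup>+ x. enn_powr (ennreal (wt x r) * loc_norm p2 (frac_int \<gamma> f) x r) q \<partial>lebesgue) \<le> ennreal C * N"
    using sufficiency by blast
  show ?thesis
    unfolding fofana_bounded_def
  proof (intro exI[of _ "C powr (1 / q)"] conjI ballI)
    fix f assume f: "f \<in> fofana_space p1 q \<alpha>"
    then have [measurable]: "f \<in> borel_measurable lebesgue" and fin: "fofana_norm p1 q \<alpha> f < top"
      by (auto simp: fofana_space_def in_var_Lp_loc_def)
    let ?N = "fofana_norm p1 q \<alpha> f"
    have "(\<integral>\<^sup>+ x. enn_powr (ennreal (wt x R) * loc_norm p1 f x R) q \<partial>lebesgue) \<le> enn_powr ?N q" if "0 < R" for R
      using le_fofana_norm[OF q that, of \<alpha> p1 f] unfolding wexp1 wt_def .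
    then have "(\<integral>\<^sup>+ x. enn_powr (ennreal (wt x r) * loc_norm p2 (frac_int \<gamma> f) x r) q \<partial>lebesgue) \<le> ennreal C * enn_powr ?N q"
      if "0 < r" for r
      using that by (intro C) auto
    moreover have "ennreal C * enn_powr ?N q = enn_powr (ennreal (C powr (1 / q)) * ?N) q"
      using C q by (simp add: enn_powr_mult enn_powr_ennreal powr_powr)
    ultimately show le: "fofana_norm p2 q \<beta> (frac_int \<gamma> f) \<le> ennreal (C powr (1 / q)) * ?N"
      by (intro fofana_norm_le q) (simp add: wt_def wexp_def)
    also have "\<dots> < top" using fin by (simp add: ennreal_mult_less_top)
    finally have fin2: "fofana_norm p2 q \<beta> (frac_int \<gamma> f) < top" .
    have "in_var_Lp_loc p2 (frac_int \<gamma> f)"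
      using p2.s_pos by (intro in_var_Lp_loc_of_fofana_norm[OF _ _ q fin2] borel_measurable_frac_int) (auto simp: less_imp_le)
    then show "frac_int \<gamma> f \<in> fofana_space p2 q \<beta>" using fin2 by (simp add: fofana_space_def)
  qed simp
qed

end

context fofana_test
begin

text \<open>Boundedness applied to the indicator of \<open>ball c \<rho>\<close>: the
  \<open>q\<close>-th roots of the lower and upper test bounds leave this power of
  \<open>\<rho>\<close>. The constant \<open>M\<close> depends on neither \<open>c\<close> nor
  \<open>\<rho>\<close>.\<close>

lemma growth_of_fofana_bounded:
  assumes bdd: "fofana_bounded (frac_int \<gamma>) p1 \<alpha> q p2 \<beta>"
  shows "\<exists>M\<ge>0. \<forall>c \<rho> Q. 0 < \<rho> \<longrightarrow> (\<forall>x\<in>ball c (2 * \<rho>). near x (2 * \<rho>)) \<longrightarrow> 0 \<le> Q \<longrightarrow>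
    (\<forall>r>\<rho>. ball_int (\<lambda>x. ennreal (r powr (- real DIM('a) - real DIM('a) * q * gap x))) c (2 * r)
       \<le> ennreal (Q * \<rho> powr - (real DIM('a) * q * gap c))) \<longrightarrow>
    \<rho> powr (\<gamma> + real DIM('a) / \<beta> - real DIM('a) / \<alpha>) \<le> M * (1 + Q) powr (1 / q)"
proof -
  let ?n = "real DIM('a)"
  have q: "0 < q" using q_gt1 by simp
  obtain D where D: "0 \<le> D" "\<And>f. f \<in> fofana_space p1 q \<alpha> \<Longrightarrow>
     fofana_norm p2 q \<beta> (frac_int \<gamma> f) \<le> ennreal D * fofana_norm p1 q \<alpha> f"
    using bdd unfolding fofana_bounded_def by blast
  obtain C where C: "0 \<le> C" "\<And>c \<rho> Q r. \<lbrakk>0 < \<rho>; \<forall>x\<in>ball c (2 * \<rho>). near x (2 * \<rho>); 0 \<le> Q;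
    \<forall>r>\<rho>. ball_int (\<lambda>x. ennreal (r powr (- ?n - ?n * q * gap x))) c (2 * r)
       \<le> ennreal (Q * \<rho> powr - (?n * q * gap c)); 0 < r\<rbrakk> \<Longrightarrow>
    (\<integral>\<^sup>+ x. enn_powr (ennreal (wt1 x r) * loc_norm p1 (indicator (ball c \<rho>)) x r) q \<partial>lebesgue)
       \<le> ennreal (C * (1 + Q) * \<rho> powr (?n * q / \<alpha>))"
    using test_upper by blast
  obtain c0 where c0: "0 < c0" "\<And>c \<rho>. \<lbrakk>0 < \<rho>; \<forall>x\<in>ball c (2 * \<rho>). near x (2 * \<rho>)\<rbrakk> \<Longrightarrow>
    ennreal (c0 * \<rho> powr (q * (\<gamma> + ?n / \<beta>)))
    \<le> (\<integral>\<^sup>+ x. enn_powr (ennreal (wt x (2 * \<rho>)) * loc_norm p2 (frac_int \<gamma> (indicator (ball c \<rho>))) x (2 * \<rho>)) q \<partial>lebesgue)"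
    using test_lower by blast
  show ?thesis
  proof (intro exI[of _ "D * C powr (1 / q) / c0 powr (1 / q)"] conjI allI impI)
    show "0 \<le> D * C powr (1 / q) / c0 powr (1 / q)" using D by simp
    fix c :: 'a and \<rho> Q :: real
    assume \<rho>: "0 < \<rho>" and nr: "\<forall>x\<in>ball c (2 * \<rho>). near x (2 * \<rho>)" and Q: "0 \<le> Q"
      and QI: "\<forall>r>\<rho>. ball_int (\<lambda>x. ennreal (r powr (- ?n - ?n * q * gap x))) c (2 * r)
       \<le> ennreal (Q * \<rho> powr - (?n * q * gap c))"
    let ?f = "indicator (ball c \<rho>) :: 'a \<Rightarrow> real"
    define U where "U = C powr (1 / q) * (1 + Q) powr (1 / q) * \<rho> powr (?n / \<alpha>)"
    define L where "L = c0 powr (1 / q) * \<rho> powr (\<gamma> + ?n / \<beta>)"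
    have U0: "0 \<le> U" and L0: "0 \<le> L" by (simp_all add: U_def L_def)
    have Uq: "U powr q = C * (1 + Q) * \<rho> powr (?n * q / \<alpha>)"
      using C q Q by (simp add: U_def powr_mult powr_powr)
    have Lq: "L powr q = c0 * \<rho> powr (q * (\<gamma> + ?n / \<beta>))"
      using c0 q by (simp add: L_def powr_mult powr_powr mult.commute)
    have "fofana_norm p1 q \<alpha> ?f \<le> ennreal U"
    proof (rule fofana_norm_le[OF q])
      fix r :: real assume "0 < r"
      then show "(\<integral>\<^sup>+ x. enn_powr (ennreal (measure lebesgue (ball x r) powr (1 / \<alpha> - 1 / p1 x - 1 / q)) * loc_norm p1 ?f x r) q \<partial>lebesgue)
        \<le> enn_powr (ennreal U) q"
        unfolding enn_powr_ennreal[OF U0] Uq wt1_def[symmetric] by (rule C(2)[OF \<rho> nr Q QI])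
    qed
    moreover have "in_var_Lp_loc p1 ?f"
    proof (rule in_var_Lp_loc_of_fofana_norm[OF _ _ q])
      show "fofana_norm p1 q \<alpha> ?f < top" using calculation by (rule le_less_trans) simp
      show "0 \<le> p1 x" for x using p1.s_pos[of x] by simp
    qed measurable
    ultimately have "?f \<in> fofana_space p1 q \<alpha>" by (auto simp: fofana_space_def intro: le_less_trans)
    then have le: "fofana_norm p2 q \<beta> (frac_int \<gamma> ?f) \<le> ennreal D * ennreal U"
      using D(2)[of ?f] \<open>fofana_norm p1 q \<alpha> ?f \<le> ennreal U\<close> by (meson mult_left_mono order_trans zero_le)
    have "enn_powr (ennreal L) q \<le> enn_powr (fofana_norm p2 q \<beta> (frac_int \<gamma> ?f)) q"
      unfolding enn_powr_ennreal[OF L0] Lq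
      using c0(2)[OF \<rho> nr] le_fofana_norm[OF q, of "2 * \<rho>" \<beta> p2 "frac_int \<gamma> ?f"] \<rho>
      unfolding wt_def wexp_def by (auto intro: order_trans)
    then have "ennreal L \<le> fofana_norm p2 q \<beta> (frac_int \<gamma> ?f)" using q by (simp add: enn_powr_le_iff)
    also note le
    also have "ennreal D * ennreal U = ennreal (D * U)" using D by (simp add: ennreal_mult')
    finally have "L \<le> D * U" using D U0 by (subst (asm) ennreal_le_iff) auto
    then have "\<rho> powr (\<gamma> + ?n / \<beta>) * c0 powr (1 / q) \<le> D * C powr (1 / q) * (1 + Q) powr (1 / q) * \<rho> powr (?n / \<alpha>)"
      by (simp add: L_def U_def mult_ac)
    then have "\<rho> powr (\<gamma> + ?n / \<beta>) / \<rho> powr (?n / \<alpha>) \<le> D * C powr (1 / q) * (1 + Q) powr (1 / q) / c0 powr (1 / q)"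
      using \<rho> c0 by (simp add: pos_divide_le_eq pos_le_divide_eq mult_ac)
    then show "\<rho> powr (\<gamma> + ?n / \<beta> - ?n / \<alpha>) \<le> D * C powr (1 / q) / c0 powr (1 / q) * (1 + Q) powr (1 / q)"
      by (simp add: powr_diff)
  qed
qed

text \<open>A power that stays bounded as \<open>\<rho>\<close> tends to 0 has a nonnegative
  exponent, one that stays bounded as \<open>\<rho>\<close> tends to infinity a nonpositive
  one.\<close>

lemma scaling_of_fofana_bounded:
  assumes bdd: "fofana_bounded (frac_int \<gamma>) p1 \<alpha> q p2 \<beta>"
  shows "\<gamma> = real DIM('a) / \<alpha> - real DIM('a) / \<beta>"
proof -
  let ?n = "real DIM('a)"
  let ?d = "\<gamma> + ?n / \<beta> - ?n / \<alpha>"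
  obtain M where M: "0 \<le> M" "\<And>c \<rho> Q. \<lbrakk>0 < \<rho>; \<forall>x\<in>ball c (2 * \<rho>). near x (2 * \<rho>); 0 \<le> Q;
    \<forall>r>\<rho>. ball_int (\<lambda>x. ennreal (r powr (- ?n - ?n * q * gap x))) c (2 * r)
       \<le> ennreal (Q * \<rho> powr - (?n * q * gap c))\<rbrakk> \<Longrightarrow>
    \<rho> powr ?d \<le> M * (1 + Q) powr (1 / q)"
    using growth_of_fofana_bounded[OF bdd] by blast
  obtain Q1 where Q1: "0 \<le> Q1" "\<And>\<rho>. \<lbrakk>0 < \<rho>; \<rho> \<le> 1 / 8\<rbrakk> \<Longrightarrow>
    \<forall>r>\<rho>. ball_int (\<lambda>x. ennreal (r powr (- ?n - ?n * q * gap x))) 0 (2 * r)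
       \<le> ennreal (Q1 * \<rho> powr - (?n * q * gap 0))"
    using Q_small by blast
  obtain Q2 where Q2: "0 \<le> Q2" "\<And>\<rho> c. \<lbrakk>1 \<le> \<rho>; norm c = 8 * \<rho> powr (1 + q)\<rbrakk> \<Longrightarrow>
    \<forall>r>\<rho>. ball_int (\<lambda>x. ennreal (r powr (- ?n - ?n * q * gap x))) c (2 * r)
       \<le> ennreal (Q2 * \<rho> powr - (?n * q * gap c))"
    using Q_large by blast
  have "- ?d \<le> 0"
  proof (rule powr_bounded_imp_nonpos)
    fix t :: real assume t: "8 \<le> t"
    have "(1 / t) powr ?d \<le> M * (1 + Q1) powr (1 / q)"
    proof (intro M(2)[of "1 / t" 0] Q1)
      have "2 * (1 / t) \<le> 1" using t by simp
      then show "\<forall>x\<in>ball 0 (2 * (1 / t)). near x (2 * (1 / t))" by (simp add: near_def)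
      show "1 / t \<le> 1 / 8" using t by (intro divide_left_mono) auto
    qed (use t in auto)
    then show "t powr - ?d \<le> M * (1 + Q1) powr (1 / q)"
      unfolding powr_divide powr_minus_divide by simp
  qed
  moreover have "?d \<le> 0"
  proof (rule powr_bounded_imp_nonpos)
    fix t :: real assume t: "8 \<le> t"
    \<comment> \<open>The centre required by \<open>Q_large\<close>; the factor 8 also keeps
      \<open>ball c (2 * t)\<close> at norm at least \<open>4 * t\<close>, so that all its points
      satisfy the near condition.\<close>
    obtain c :: 'a where c: "norm c = 8 * t powr (1 + q)"
      using vector_choose_size[of "8 * t powr (1 + q)"] by auto
    have tq: "t \<le> t powr (1 + q)" using powr_mono[of 1 "1 + q" t] t q_gt1 by simp
    have "near x (2 * t)" if "x \<in> ball c (2 * t)" for x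
    proof -
      have "norm c \<le> norm (c - x) + norm x" using norm_triangle_ineq[of "c - x" x] by simp
      then have "4 * t \<le> norm x" using that c tq t by (simp add: dist_norm)
      then show ?thesis by (simp add: near_def)
    qed
    then show "t powr ?d \<le> M * (1 + Q2) powr (1 / q)"
      using t c by (intro M(2)[of t c] Q2) auto
  qed
  ultimately show ?thesis by linarith
qed

end

theorem theorem4p1:
  fixes p1 p2 :: "'a::euclidean_space \<Rightarrow> real" and \<gamma> q \<alpha> \<beta> C :: real
  assumes "var_exp p1" and "var_exp p2"
    and "C > 0" and "log_hoelder C p1" and "log_hoelder C p2"
    and "0 < \<gamma>" and "ereal \<gamma> < ereal (real DIM('a)) / p_plus p1"
    and "1 \<le> q" and "1 \<le> \<alpha>"
    and "\<forall>x. p1 x < \<alpha>" and "\<alpha> < q"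
    and "\<forall>x. p2 x < \<beta>" and "\<beta> < q"
    and "\<forall>x. real DIM('a) / p1 x - real DIM('a) / p2 x = \<gamma>"
  shows "fofana_bounded (frac_int \<gamma>) p1 \<alpha> q p2 \<beta> \<longleftrightarrow>
           \<gamma> = real DIM('a) / \<alpha> - real DIM('a) / \<beta>"
proof -
  let ?n = "real DIM('a)"
  obtain a1 where a1: "1 < a1" "\<And>x. a1 \<le> p1 x" using log_hoelder_lower[OF assms(1,4,3)] by blast
  obtain a2 where a2: "1 < a2" "\<And>x. a2 \<le> p2 x" using log_hoelder_lower[OF assms(2,5,3)] by blast
  define a where "a = min a1 a2"
  have a: "1 < a" "\<And>x. a \<le> p1 x" "\<And>x. a \<le> p2 x"
    using a1 a2 by (auto simp: a_def min.coboundedI1 min.coboundedI2)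
  \<comment> \<open>The exponents are below \<alpha> and \<beta> at every point, so these provide a
    pointwise upper bound.\<close>
  define P where "P = max \<alpha> \<beta>"
  have P: "\<And>x. p1 x \<le> P" "\<And>x. p2 x \<le> P"
    using assms(10,12) by (auto simp: P_def le_max_iff_disj less_imp_le)
  obtain p10 where p10: "\<And>x. \<bar>p1 x - p10\<bar> \<le> C / ln (norm x + exp 1)"
    "\<And>c. (\<And>x. c \<le> p1 x) \<Longrightarrow> c \<le> p10" "\<And>c. (\<And>x. p1 x \<le> c) \<Longrightarrow> p10 \<le> c"
    using log_hoelder_limit[OF assms(4,3)] by blast
  obtain p20 where p20: "\<And>x. \<bar>p2 x - p20\<bar> \<le> C / ln (norm x + exp 1)"
    "\<And>c. (\<And>x. c \<le> p2 x) \<Longrightarrow> c \<le> p20" "\<And>c. (\<And>x. p2 x \<le> c) \<Longrightarrow> p20 \<le> c"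
    using log_hoelder_limit[OF assms(5,3)] by blast
  interpret p1: log_exponent p1 p10 a P "C + 1"
    using assms(1) by (intro log_exponent_intro assms a P p10) (auto simp: var_exp_def)
  interpret p2: log_exponent p2 p20 a P "C + 1"
    using assms(2) by (intro log_exponent_intro assms a P p20) (auto simp: var_exp_def)
  \<comment> \<open>The limits \<open>p10\<close> and \<open>p20\<close> were obtained separately;
    their relation is recovered at a point so far out that both reciprocals are closer to their
    limits than any fixed discrepancy \<open>e\<close> permits.\<close>
  have lim: "?n / p10 - ?n / p20 = \<gamma>"
  proof (rule ccontr)
    assume "?n / p10 - ?n / p20 \<noteq> \<gamma>"
    define e where "e = \<bar>?n / p10 - ?n / p20 - \<gamma>\<bar>"
    have e: "0 < e" using \<open>_ \<noteq> \<gamma>\<close> by (simp add: e_def)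
    obtain x :: 'a where x: "norm x = exp (2 * ?n * (C + 1) / e)" using vector_choose_size[of "exp (2 * ?n * (C + 1) / e)"] by auto
    define l where "l = ln (exp 1 + norm x)"
    have "ln (exp (2 * ?n * (C + 1) / e)) < l" unfolding l_def x by (subst ln_less_cancel_iff) (auto simp: add_pos_pos)
    then have l: "2 * ?n * (C + 1) / e < l" by simp
    have l0: "0 \<le> l" using l assms(3) e by (smt (verit) divide_nonneg_pos mult_nonneg_nonneg of_nat_0_le_iff)
    have "e \<le> \<bar>?n * (1 / p1 x - 1 / p10)\<bar> + \<bar>?n * (1 / p2 x - 1 / p20)\<bar>"
      using assms(14)[rule_format, of x] unfolding e_def by (simp add: right_diff_distrib)
    also have "\<dots> = ?n * (\<bar>1 / p1 x - 1 / p10\<bar> + \<bar>1 / p2 x - 1 / p20\<bar>)" by (simp add: abs_mult distrib_left)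
    finally have "e * l \<le> ?n * (\<bar>1 / p1 x - 1 / p10\<bar> + \<bar>1 / p2 x - 1 / p20\<bar>) * l" using l0 by (rule mult_right_mono)
    also have "\<dots> = ?n * (\<bar>1 / p1 x - 1 / p10\<bar> * l + \<bar>1 / p2 x - 1 / p20\<bar> * l)" by (simp add: algebra_simps)
    also have "\<dots> \<le> ?n * ((C + 1) + (C + 1))"
      using p1.decay[of x] p2.decay[of x] by (intro mult_left_mono add_mono) (auto simp: l_def)
    also have "\<dots> = 2 * ?n * (C + 1)" by (simp add: algebra_simps)
    also have "\<dots> < e * l" using l e by (simp add: pos_divide_less_eq mult.commute)
    finally show False by simp
  qed
  interpret fofana_test p1 p2 p10 p20 a P "C + 1" \<gamma> q \<beta> \<alpha>
    by unfold_locales (use assms lim in auto)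
  show ?thesis using fofana_bounded_of_scaling scaling_of_fofana_bounded by blast
qed

end
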